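(* There is a constant $C$ depending only on $(m,m_v)$ such that for all $p,q\in X_\infty$ there is a measured family of curves $(\Gamma,I_\Gamma,\Omega_\Gamma,\nu_\Gamma)$ joining $p$ to $q$ such that each curve $t\mapsto\Gamma(t,\omega)$ is $C$-Lipschitz, $\mathcal L^1(I_\Gamma)\le C\hat d_\infty(p,q)$, and $$\mu_\Gamma\le C\big(\mu_{\infty,p}\llcorner B(p,C\hat d_\infty(p,q))+\mu_{\infty,q}\llcorner B(q,C\hat d_\infty(p,q))\big).$$
   Context: Standing construction ($n=2$). Fix an integer $L\ge100$, $m=4$, $m_v=3L$. For $j\in\mathbb Z$, $Y_j$ is the cell complex on $\mathbb R^2$ given by the tiling by rectangles $[am^{-j},(a+1)m^{-j}]\times[bm_v^{-j},(b+1)m_v^{-j}]$, $a,b\in\mathbb Z$. Let $\Phi(x,y)=(m^{-1}x,m_v^{-1}y)$. For $k,\ell\in\mathbb Z$, $i\in\{1,2,3\}$, $a_{k,\ell,i}=\{k+\tfrac i4\}\times[(3\ell+i-1)m_v^{-1},(3\ell+i)m_v^{-1}]$. $\mathcal R$ is the equivalence relation on $\mathbb R^2$ generated by $p\sim p+(0,m_v^{-1})$ for $p\in a_{k,\ell,i}$. $\Phi^j_*\mathcal R=\{(\Phi^jp,\Phi^jq):(p,q)\in\mathcal R\}$; $\mathcal R_\infty$ is generated by all $\Phi^j_*\mathcal R$. $X_\infty=\mathbb R^2/\mathcal R_\infty$, $\hat\pi^\infty$ the quotient map, $\hat d_\infty$ the largest pseudodistance on $X_\infty$ such that for every $i\in\mathbb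 Z$ and every $2$-cell $\hat\sigma$ of $Y_i$, $\hat\pi^\infty(\hat\sigma)$ has diameter $\le m^{-i}$; $\mu_\infty=\hat\pi^\infty_\#\mathcal L^2$. A measured family of curves $(\Gamma,I_\Gamma,\Omega_\Gamma,\nu_\Gamma)$ is a measurable map $\Gamma:I_\Gamma\times\Omega_\Gamma\to X_\infty$ with $I_\Gamma\subset\mathbb R$ an interval and $\nu_\Gamma$ a probability measure on $\Omega_\Gamma$, such that for some $L'$ every $t\mapsto\Gamma(t,\omega)$ is $L'$-Lipschitz; it joins $p$ to $q$ if $\Gamma(\min I_\Gamma,\omega)=p$ and $\Gamma(\max I_\Gamma,\omega)=q$ for $\nu_\Gamma$-a.e. $\omega$. Its associated measure is $\mu_\Gamma=\Gamma_\#(\mathcal L^1\times\nu_\Gamma)$. The Riesz potential centered at $p$ is the measure $\mu_{\infty,p}=\frac{\hat d_\infty(p,\cdot)}{\mu_\infty(B(p,\hat d_\infty(p,\cdot)))}\mu_\infty$. *)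

theory Defs
  imports "HOL-Analysis.Analysis" "HOL-Probability.Probability"
begin

type_synonym pt = "real \<times> real"
type_synonym xpt = "pt set"   (* points of X_infinity = equivalence classes *)

definition mh :: real where "mh = 4"
definition mv :: "nat \<Rightarrow> real" where "mv L = 3 * real L"

definition Phij :: "nat \<Rightarrow> int \<Rightarrow> pt \<Rightarrow> pt" where
  "Phij L j p = (mh powr (- real_of_int j) * fst p, mv L powr (- real_of_int j) * snd p)"

definition cellY :: "nat \<Rightarrow> int \<Rightarrow> int \<Rightarrow> int \<Rightarrow> pt set" where
  "cellY L j a b =
     {real_of_int a * mh powr (- real_of_int j) .. (real_of_int a + 1) * mh powr (- real_of_int j)}
   \<times> {real_of_int b * mv L powr (- real_of_int j) .. (real_of_int b + 1) * mv L powr (- real_of_int j)}"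

definition aseg :: "nat \<Rightarrow> int \<Rightarrow> int \<Rightarrow> int \<Rightarrow> pt set" where
  "aseg L k l i = {real_of_int k + real_of_int i / 4}
     \<times> {(3 * real_of_int l + real_of_int i - 1) / mv L .. (3 * real_of_int l + real_of_int i) / mv L}"

definition eqclose :: "(pt \<times> pt) set \<Rightarrow> (pt \<times> pt) set" where
  "eqclose G = (G \<union> G\<inverse>)\<^sup>*"

definition Rgen :: "nat \<Rightarrow> (pt \<times> pt) set" where
  "Rgen L = {(p, p + (0, 1 / mv L)) | p k l i. i \<in> {1,2,3} \<and> p \<in> aseg L k l i}"

definition Rrel :: "nat \<Rightarrow> (pt \<times> pt) set" where
  "Rrel L = eqclose (Rgen L)"

definition pushR :: "nat \<Rightarrow> int \<Rightarrow> (pt \<times> pt) set" where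
  "pushR L j = {(Phij L j p, Phij L j q) | p q. (p, q) \<in> Rrel L}"

definition Rinf :: "nat \<Rightarrow> (pt \<times> pt) set" where
  "Rinf L = eqclose (\<Union>j. pushR L j)"

definition Xinf :: "nat \<Rightarrow> xpt set" where
  "Xinf L = UNIV // Rinf L"

definition piinf :: "nat \<Rightarrow> pt \<Rightarrow> xpt" where
  "piinf L z = Rinf L `` {z}"

definition pseudodist_on :: "xpt set \<Rightarrow> (xpt \<Rightarrow> xpt \<Rightarrow> real) \<Rightarrow> bool" where
  "pseudodist_on X \<delta> \<longleftrightarrow>
     (\<forall>x\<in>X. \<delta> x x = 0) \<and> (\<forall>x\<in>X. \<forall>y\<in>X. 0 \<le> \<delta> x y \<and> \<delta> x y = \<delta> y x) \<and>
     (\<forall>x\<in>X. \<forall>y\<in>X. \<forall>z\<in>X. \<delta> x z \<le> \<delta> x y + \<delta> y z)"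

definition admissible :: "nat \<Rightarrow> (xpt \<Rightarrow> xpt \<Rightarrow> real) \<Rightarrow> bool" where
  "admissible L \<delta> \<longleftrightarrow> pseudodist_on (Xinf L) \<delta> \<and>
     (\<forall>i a b. \<forall>x\<in>cellY L i a b. \<forall>y\<in>cellY L i a b.
        \<delta> (piinf L x) (piinf L y) \<le> mh powr (- real_of_int i))"

definition dinf :: "nat \<Rightarrow> xpt \<Rightarrow> xpt \<Rightarrow> real" where
  "dinf L x y = Sup {\<delta> x y | \<delta>. admissible L \<delta>}"

definition Ball_inf :: "nat \<Rightarrow> xpt \<Rightarrow> real \<Rightarrow> xpt set" where
  "Ball_inf L p r = {x \<in> Xinf L. dinf L p x < r}"

definition opens_inf :: "nat \<Rightarrow> xpt set set" where
  "opens_inf L = {U. U \<subseteq> Xinf L \<and> (\<forall>x\<in>U. \<exists>r>0. Ball_inf L x r \<subseteq> U)}"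

definition Xmeas :: "nat \<Rightarrow> xpt measure" where
  "Xmeas L = sigma (Xinf L) (opens_inf L)"

definition muinf :: "nat \<Rightarrow> xpt measure" where
  "muinf L = distr lborel (Xmeas L) (piinf L)"

definition riesz :: "nat \<Rightarrow> xpt \<Rightarrow> xpt measure" where
  "riesz L p = density (muinf L)
     (\<lambda>x. ennreal (dinf L p x) / emeasure (muinf L) (Ball_inf L p (dinf L p x)))"

definition measured_family ::
  "nat \<Rightarrow> (real \<Rightarrow> 'w \<Rightarrow> xpt) \<Rightarrow> real \<Rightarrow> real \<Rightarrow> 'w measure \<Rightarrow> real \<Rightarrow> bool" where
  "measured_family L \<Gamma> a b \<nu> Lc \<longleftrightarrow> a \<le> b \<and> prob_space \<nu> \<and>
     (\<lambda>(t,\<omega>). \<Gamma> t \<omega>) \<in> measurable (restrict_space lborel {a..b} \<Otimes>\<^sub>M \<nu>) (Xmeas L) \<and>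
     (\<forall>\<omega>\<in>space \<nu>. \<forall>s\<in>{a..b}. \<forall>t\<in>{a..b}. dinf L (\<Gamma> s \<omega>) (\<Gamma> t \<omega>) \<le> Lc * \<bar>s - t\<bar>)"

definition joins :: "(real \<Rightarrow> 'w \<Rightarrow> xpt) \<Rightarrow> real \<Rightarrow> real \<Rightarrow> 'w measure \<Rightarrow> xpt \<Rightarrow> xpt \<Rightarrow> bool" where
  "joins \<Gamma> a b \<nu> p q \<longleftrightarrow> (AE \<omega> in \<nu>. \<Gamma> a \<omega> = p \<and> \<Gamma> b \<omega> = q)"

definition curve_measure :: "nat \<Rightarrow> (real \<Rightarrow> 'w \<Rightarrow> xpt) \<Rightarrow> real \<Rightarrow> real \<Rightarrow> 'w measure \<Rightarrow> xpt measure" where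
  "curve_measure L \<Gamma> a b \<nu> = distr (restrict_space lborel {a..b} \<Otimes>\<^sub>M \<nu>) (Xmeas L) (\<lambda>(t,\<omega>). \<Gamma> t \<omega>)"

end

theory Submission
  imports Defs
begin

text \<open>
  Gluing takes place only on vertical lines whose abscissa is of the form
  \<open>4\<^sup>-\<^sup>n (4k + i)\<close>, \<open>i \<in> {1,2,3}\<close>, and each such line carries gluings of the single level \<open>n\<close>.
  Moving back and forth across a cell of level \<open>n - 1\<close> therefore lets a curve climb or descend
  through strips of height \<open>(3L)\<^sup>-\<^sup>n\<close> by jumping at glued segments, at a cost comparable to \<open>4\<^sup>-\<^sup>n\<close>
  per strip. A point chosen uniformly in the level-\<open>n\<close> strip containing \<open>p\<close> lies in a uniformly
  distributed substrip of level \<open>n + 1\<close>, at an independent uniform offset inside it; transporting each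
  substrip onto the one containing \<open>p\<close>, for all levels in succession, yields curves that end in \<open>p\<close>.
  At level \<open>k\<close> they occupy the ball of radius comparable to \<open>4\<^sup>-\<^sup>k\<close> with density at most a constant
  times \<open>(3L)\<^sup>k\<close>, which is the order of the Riesz potential there, and the sum over \<open>k\<close> is geometric.
  Two such families, for \<open>p\<close> and for \<open>q\<close>, are joined at the scale of the distance of \<open>p\<close> and \<open>q\<close>.

  The estimates need lower bounds for the distance. These come from potentials: an invariant function
  whose oscillation on each cell of level \<open>i\<close> is at most \<open>4\<^sup>-\<^sup>i\<close> is \<open>1\<close>-Lipschitz. They are built from the
  abscissa and from a height that differs little from the ordinate but is constant across all gluings
  finer than a given scale.
\<close>

section \<open>The quotient pseudodistance\<close>

text \<open>A vertical step of height \<open>(3L)^-i\<close> is only known to cost about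
  \<open>4^-i\<close>, so subdividing it worsens the bound by \<open>3L/4\<close> per level. This is
  why the curves use horizontal motion and jumps alone. Lower bounds for the distance serve three
  ends. They bound volumes of balls from above, which makes the Riesz density large. They show that
  nearby points lie in neighbouring strips up to jumps on one coarse line, which gives the piece of
  curve between the two scales of \<open>p\<close> and \<open>q\<close>. They show that classes at
  distance zero coincide, which settles that case of the theorem. Fine gluings can be absorbed into
  the height, coarse ones cannot: their displacement exceeds the scale under study. The potential
  therefore measures the distance to the set of all glued copies of a height. The bound
  \<open>L \<ge> 100\<close> gives \<open>M \<ge> 300\<close>, large against the displacement 9 and
  the Lipschitz constants 10 and 36 of one flattening, so that infinitely many of them compose with
  total displacement at most 1/20.\<close>

definition hs :: "int \<Rightarrow> real" where "hs j = 4 powr (- real_of_int j)"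
definition vs :: "nat \<Rightarrow> int \<Rightarrow> real" where "vs L j = mv L powr (- real_of_int j)"

lemma hs_pos [simp]: "0 < hs j" by (simp add: hs_def)
lemma hs_nonneg [simp]: "0 \<le> hs j" using hs_pos[of j] by linarith
lemma hs_nz [simp]: "hs j \<noteq> 0" using hs_pos[of j] by linarith
lemma hs_add: "hs (i + j) = hs i * hs j" by (simp add: hs_def flip: powr_add)
lemma hs_0 [simp]: "hs 0 = 1" by (simp add: hs_def)
lemma hs_nat: "hs (int n) = (1/4) ^ n"
  by (simp add: hs_def powr_minus powr_realpow power_one_over inverse_eq_divide)
lemma hs_minus_nat: "hs (- int n) = 4 ^ n"
  by (simp add: hs_def powr_realpow)
lemma hs_Suc: "hs (i + 1) = hs i / 4" using hs_nat[of 1] by (simp add: hs_add)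
lemma hs_le_iff: "hs i \<le> hs j \<longleftrightarrow> j \<le> i" by (simp add: hs_def)

text \<open>Replaces a length by a scale; the factor 4 lost is the ratio of consecutive cell
  widths.\<close>

lemma hs_scale:
  assumes "0 < D" obtains i where "D \<le> hs i" "hs i \<le> 4 * D"
proof -
  define i where "i = \<lfloor>- log 4 D\<rfloor>"
  have 1: "real_of_int i \<le> - log 4 D" "- log 4 D < real_of_int i + 1" unfolding i_def by linarith+
  have "4 powr (log 4 D) \<le> hs i" unfolding hs_def using 1 by (intro powr_mono) auto
  moreover have "hs (i+1) \<le> 4 powr (log 4 D)" unfolding hs_def using 1 by (intro powr_mono) auto
  ultimately show thesis using assms that[of i] by (auto simp: hs_Suc)
qed

lemma equiv_eqclose: "equiv UNIV (eqclose G)"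
proof (intro equivI)
  show "sym (eqclose G)" unfolding eqclose_def by (intro sym_rtrancl) (auto simp: sym_def)
qed (auto simp: eqclose_def refl_on_def trans_rtrancl)

locale glued_plane =
  fixes L :: nat
  assumes L_ge: "L \<ge> 100"
begin

abbreviation M :: real where "M \<equiv> mv L"
abbreviation V :: "int \<Rightarrow> real" where "V \<equiv> vs L"
abbreviation pr :: "pt \<Rightarrow> xpt" where "pr \<equiv> piinf L"
abbreviation d :: "xpt \<Rightarrow> xpt \<Rightarrow> real" where "d \<equiv> dinf L"

lemma M_ge: "M \<ge> 300" using L_ge by (simp add: mv_def)
lemma M_pos [simp]: "M > 0" using M_ge by linarith
lemma M_nonneg [simp]: "0 \<le> M" using M_ge by linarith
lemma M_nz [simp]: "M \<noteq> 0" using M_ge by linarith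
lemma V_pos [simp]: "0 < V j" by (simp add: vs_def)
lemma V_nonneg [simp]: "0 \<le> V j" using V_pos[of j] by linarith
lemma V_nz [simp]: "V j \<noteq> 0" using V_pos[of j] by linarith
lemma V_add: "V (i + j) = V i * V j" by (simp add: vs_def flip: powr_add)
lemma V_0 [simp]: "V 0 = 1" by (simp add: vs_def)
lemma V_minus_nat: "V (- int n) = M ^ n" by (simp add: vs_def powr_realpow)
lemma V_nat: "V (int n) = 1 / M ^ n"
  by (simp add: vs_def powr_minus powr_realpow inverse_eq_divide)
lemma V_Suc: "V (i + 1) = V i / M" using V_nat[of 1] by (simp add: V_add)
lemma V_le_iff: "V i \<le> V j \<longleftrightarrow> j \<le> i" using M_ge by (simp add: vs_def)

lemma Phij_eq: "Phij L j (x, y) = (hs j * x, V j * y)"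
  by (simp add: Phij_def hs_def vs_def mh_def)

lemma cellY_iff:
  "(x, y) \<in> cellY L j a b \<longleftrightarrow> real_of_int a * hs j \<le> x \<and> x \<le> (real_of_int a + 1) * hs j \<and>
     real_of_int b * V j \<le> y \<and> y \<le> (real_of_int b + 1) * V j"
  by (auto simp: cellY_def hs_def vs_def mh_def)

lemma Phij_Phij: "Phij L i (Phij L j z) = Phij L (i + j) z"
  by (cases z) (simp add: Phij_eq hs_add V_add)

lemma Phij_0 [simp]: "Phij L 0 z = z" by (cases z) (simp add: Phij_eq)

lemma Phij_cell: "z \<in> cellY L i a b \<Longrightarrow> Phij L j z \<in> cellY L (i + j) a b"
proof (cases z)
  case (Pair x y)
  assume "z \<in> cellY L i a b"
  then have *: "real_of_int a * hs i \<le> x" "x \<le> (real_of_int a + 1) * hs i"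
     "real_of_int b * V i \<le> y" "y \<le> (real_of_int b + 1) * V i" by (auto simp: Pair cellY_iff)
  show ?thesis
    using mult_left_mono[OF *(1), of "hs j"] mult_left_mono[OF *(2), of "hs j"]
      mult_left_mono[OF *(3), of "V j"] mult_left_mono[OF *(4), of "V j"]
    by (simp add: Pair Phij_eq cellY_iff hs_add V_add mult_ac)
qed

lemma pr_eq_iff: "pr z = pr w \<longleftrightarrow> (z, w) \<in> Rinf L"
  unfolding piinf_def using equiv_eqclose eq_equiv_class_iff[of UNIV "Rinf L" z w]
  by (auto simp: Rinf_def)

lemma Xinf_eq: "Xinf L = range pr" by (auto simp: Xinf_def quotient_def piinf_def)
lemma pr_in [simp]: "pr z \<in> Xinf L" by (simp add: Xinf_eq)

lemma pr_glue: "(p, q) \<in> Rgen L \<Longrightarrow> pr (Phij L j p) = pr (Phij L j q)"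
  unfolding pr_eq_iff Rinf_def eqclose_def pushR_def Rrel_def by blast

text \<open>\<open>Rinf\<close> is an equivalence closure of rescaled equivalence closures, so
  invariance spreads from the elementary translations by two inductions.\<close>

lemma Rinf_invariant:
  assumes inv: "\<And>j p q. (p, q) \<in> Rgen L \<Longrightarrow> U (Phij L j p) = U (Phij L j q)"
    and zw: "(z, w) \<in> Rinf L"
  shows "U z = U w"
proof -
  have R: "U (Phij L j p) = U (Phij L j q)" if "(p, q) \<in> Rrel L" for j p q
    using that unfolding Rrel_def eqclose_def
    by (induction rule: rtrancl_induct) (auto dest: inv[of _ _ j])
  have P: "U p = U q" if "(p, q) \<in> (\<Union>j. pushR L j)" for p q
    using that R unfolding pushR_def by fastforce
  show ?thesis using zw unfolding Rinf_def eqclose_def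
  proof (induction rule: rtrancl_induct)
    case (step y z)
    then have "U y = U z" using P[of y z] P[of z y] by (metis Un_iff converse_iff)
    then show ?case using step.IH by simp
  qed simp
qed

lemma admissible_cell:
  "admissible L \<delta> \<Longrightarrow> z \<in> cellY L i a b \<Longrightarrow> w \<in> cellY L i a b \<Longrightarrow> \<delta> (pr z) (pr w) \<le> hs i"
  by (auto simp: admissible_def hs_def mh_def)

lemma admissible_pd:
  assumes "admissible L \<delta>"
  shows "\<delta> (pr z) (pr z) = 0" "0 \<le> \<delta> (pr z) (pr w)" "\<delta> (pr z) (pr w) = \<delta> (pr w) (pr z)"
    "\<delta> (pr z) (pr w) \<le> \<delta> (pr z) (pr u) + \<delta> (pr u) (pr w)"
proof -
  have *: "\<And>x. x \<in> Xinf L \<Longrightarrow> \<delta> x x = 0" "\<And>x y. x \<in> Xinf L \<Longrightarrow> y \<in> Xinf L \<Longrightarrow> 0 \<le> \<delta> x y \<and> \<delta> x y = \<delta> y x"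
    "\<And>x y z. x \<in> Xinf L \<Longrightarrow> y \<in> Xinf L \<Longrightarrow> z \<in> Xinf L \<Longrightarrow> \<delta> x z \<le> \<delta> x y + \<delta> y z"
    using assms by (simp_all add: admissible_def pseudodist_on_def)
  show "\<delta> (pr z) (pr z) = 0" "0 \<le> \<delta> (pr z) (pr w)" "\<delta> (pr z) (pr w) = \<delta> (pr w) (pr z)"
    "\<delta> (pr z) (pr w) \<le> \<delta> (pr z) (pr u) + \<delta> (pr u) (pr w)"
    using *(1)[OF pr_in] *(2)[OF pr_in pr_in, of z w] *(3)[OF pr_in pr_in pr_in, of z w u] by auto
qed

lemma admissible_0: "admissible L (\<lambda>_ _. 0)"
  by (auto simp: admissible_def pseudodist_on_def)

text \<open>Cells of very negative level with a corner at the origin exhaust each quadrant. Routing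
  two points through the origin bounds all admissible pseudodistances between them, so the supremum
  in \<open>dinf\<close> is finite.\<close>

lemma common_cell_origin: "\<exists>i a b. z \<in> cellY L i a b \<and> (0, 0) \<in> cellY L i a b"
proof (cases z)
  case (Pair x y)
  obtain n :: nat where n: "max \<bar>x\<bar> \<bar>y\<bar> \<le> 4 ^ n"
    using real_arch_pow[of 4 "max \<bar>x\<bar> \<bar>y\<bar>"] by (auto intro: less_imp_le)
  have "(4::real) ^ n \<le> M ^ n" using M_ge by (intro power_mono) auto
  then have y: "\<bar>y\<bar> \<le> M ^ n" using n by linarith
  have "z \<in> cellY L (- int n) (if x \<ge> 0 then 0 else -1) (if y \<ge> 0 then 0 else -1)"
     "(0,0) \<in> cellY L (- int n) (if x \<ge> 0 then 0 else -1) (if y \<ge> 0 then 0 else -1)"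
    using n y by (auto simp: Pair cellY_iff hs_minus_nat V_minus_nat)
  then show ?thesis by blast
qed

lemma dinf_bdd: "bdd_above {\<delta> (pr z) (pr w) |\<delta>. admissible L \<delta>}"
proof -
  obtain i a b where 1: "z \<in> cellY L i a b" "(0, 0) \<in> cellY L i a b" using common_cell_origin by blast
  obtain j a' b' where 2: "w \<in> cellY L j a' b'" "(0, 0) \<in> cellY L j a' b'" using common_cell_origin by blast
  have "\<delta> (pr z) (pr w) \<le> hs i + hs j" if "admissible L \<delta>" for \<delta>
    using admissible_cell[OF that 1] admissible_cell[OF that 2(2,1)]
      admissible_pd(4)[OF that, of z w "(0,0)"] by linarith
  then show ?thesis by (intro bdd_aboveI[of _ "hs i + hs j"]) auto
qed

lemma dinf_ge_admissible: "admissible L \<delta> \<Longrightarrow> \<delta> (pr z) (pr w) \<le> d (pr z) (pr w)"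
  unfolding dinf_def by (intro cSup_upper dinf_bdd) auto

lemma dinf_le:
  assumes "\<And>\<delta>. admissible L \<delta> \<Longrightarrow> \<delta> (pr z) (pr w) \<le> c" shows "d (pr z) (pr w) \<le> c"
  unfolding dinf_def using assms admissible_0 by (intro cSup_least) auto

lemma dinf_nonneg [simp]: "0 \<le> d (pr z) (pr w)"
  using dinf_ge_admissible[OF admissible_0, of z w] by simp

lemma dinf_refl [simp]: "d (pr z) (pr z) = 0"
  using dinf_le[of z z 0] by (force intro: antisym simp: admissible_pd)

lemma dinf_sym: "d (pr z) (pr w) = d (pr w) (pr z)"
  by (intro antisym dinf_le; subst admissible_pd(3); simp add: dinf_ge_admissible)

lemma dinf_triangle: "d (pr z) (pr w) \<le> d (pr z) (pr u) + d (pr u) (pr w)"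
proof (rule dinf_le)
  fix \<delta> assume a: "admissible L \<delta>"
  show "\<delta> (pr z) (pr w) \<le> d (pr z) (pr u) + d (pr u) (pr w)"
    using admissible_pd(4)[OF a, of z w u] dinf_ge_admissible[OF a, of z u]
      dinf_ge_admissible[OF a, of u w] by linarith
qed

lemma dinf_cell: "z \<in> cellY L i a b \<Longrightarrow> w \<in> cellY L i a b \<Longrightarrow> d (pr z) (pr w) \<le> hs i"
  by (intro dinf_le admissible_cell)

text \<open>The floors of \<open>x / h\<close> and \<open>x' / h\<close> differ by at most 1, so the
  two tiling intervals touch, and \<open>c\<close> is a common point.\<close>

lemma adjacent_intervals:
  fixes x x' h :: real
  assumes h: "0 < h" and "\<bar>x - x'\<bar> \<le> h"
  shows "\<exists>a a' c. real_of_int a * h \<le> x \<and> x \<le> (real_of_int a + 1) * h \<and>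
     real_of_int a' * h \<le> x' \<and> x' \<le> (real_of_int a' + 1) * h \<and>
     real_of_int a * h \<le> c \<and> c \<le> (real_of_int a + 1) * h \<and>
     real_of_int a' * h \<le> c \<and> c \<le> (real_of_int a' + 1) * h"
proof -
  define a a' where "a = \<lfloor>x / h\<rfloor>" and "a' = \<lfloor>x' / h\<rfloor>"
  have A: "a \<le> x / h" "x / h \<le> a + 1" "a' \<le> x' / h" "x' / h \<le> a' + 1"
    unfolding a_def a'_def by linarith+
  have B: "a * h \<le> x" "x \<le> (a + 1) * h" "a' * h \<le> x'" "x' \<le> (a' + 1) * h"
    using A h by (auto simp: field_simps)
  have "\<bar>x / h - x' / h\<bar> \<le> 1" using assms by (simp add: field_simps flip: diff_divide_distrib)
  then have "a' \<le> a + 1" "a \<le> a' + 1" unfolding a_def a'_def by linarith+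
  then have "real_of_int a' \<le> a + 1" "real_of_int a \<le> a' + 1" by linarith+
  then have "a' * h \<le> (a + 1) * h" "a * h \<le> (a' + 1) * h" using h by (auto intro!: mult_right_mono)
  then show ?thesis using B h
    by (intro exI[of _ a] exI[of _ a'] exI[of _ "max (a * h) (a' * h)"]) (auto simp: algebra_simps)
qed

lemma dinf_near:
  assumes "\<bar>x - x'\<bar> \<le> hs i" "\<bar>y - y'\<bar> \<le> V i"
  shows "d (pr (x, y)) (pr (x', y')) \<le> 2 * hs i"
proof -
  obtain a a' c where A: "a * hs i \<le> x" "x \<le> (real_of_int a + 1) * hs i"
     "real_of_int a' * hs i \<le> x'" "x' \<le> (real_of_int a' + 1) * hs i"
     "real_of_int a * hs i \<le> c" "c \<le> (real_of_int a + 1) * hs i"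
     "real_of_int a' * hs i \<le> c" "c \<le> (real_of_int a' + 1) * hs i"
    using adjacent_intervals[OF hs_pos assms(1)] by blast
  obtain b b' e where B: "b * V i \<le> y" "y \<le> (real_of_int b + 1) * V i"
     "real_of_int b' * V i \<le> y'" "y' \<le> (real_of_int b' + 1) * V i"
     "real_of_int b * V i \<le> e" "e \<le> (real_of_int b + 1) * V i"
     "real_of_int b' * V i \<le> e" "e \<le> (real_of_int b' + 1) * V i"
    using adjacent_intervals[OF V_pos assms(2)] by blast
  have "d (pr (x, y)) (pr (c, e)) \<le> hs i"
    using A B by (intro dinf_cell[where a = a and b = b]) (auto simp: cellY_iff)
  moreover have "d (pr (c, e)) (pr (x', y')) \<le> hs i"
    using A B by (intro dinf_cell[where a = a' and b = b']) (auto simp: cellY_iff)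
  ultimately show ?thesis using dinf_triangle[of "(x, y)" "(x', y')" "(c, e)"] by linarith
qed

text \<open>The 8 is the 2 of \<open>dinf_near\<close> times the 4 of \<open>hs_scale\<close>; it
  becomes the speed bound of all curves.\<close>

lemma dinf_horizontal: "d (pr (x, y)) (pr (x', y)) \<le> 8 * \<bar>x - x'\<bar>"
proof (cases "x = x'")
  case False
  then obtain i where "\<bar>x - x'\<bar> \<le> hs i" "hs i \<le> 4 * \<bar>x - x'\<bar>"
    using hs_scale[of "\<bar>x - x'\<bar>"] by auto
  then show ?thesis using dinf_near[of x x' i y y] by simp
qed simp

lemma pr_continuous:
  assumes "0 < e"
  shows "\<exists>r>0. \<forall>w. dist w z < r \<longrightarrow> d (pr z) (pr w) < e"
proof (cases z)
  case (Pair x y)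
  obtain i where i: "e / 16 \<le> hs i" "hs i \<le> 4 * (e / 16)" using hs_scale[of "e/16"] assms by auto
  have "d (pr z) (pr w) < e" if "dist w z < min (hs i) (V i)" for w
  proof -
    obtain x' y' where w: "w = (x', y')" by fastforce
    have "dist x' x < min (hs i) (V i)" "dist y' y < min (hs i) (V i)"
      using that dist_fst_le[of w z] dist_snd_le[of w z] by (auto simp: w Pair)
    then have "d (pr z) (pr w) \<le> 2 * hs i"
      unfolding Pair w by (intro dinf_near) (auto simp: dist_real_def)
    then show ?thesis using i assms by linarith
  qed
  then show ?thesis by (intro exI[of _ "min (hs i) (V i)"]) auto
qed

section \<open>Borel structure of the quotient\<close>

lemma opens_inf_vimage: "U \<in> opens_inf L \<Longrightarrow> open (pr -` U)"
proof (unfold open_dist, intro ballI)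
  fix z assume U: "U \<in> opens_inf L" and "z \<in> pr -` U"
  then obtain e where e: "e > 0" "Ball_inf L (pr z) e \<subseteq> U" by (auto simp: opens_inf_def)
  obtain r where "r > 0" "\<forall>w. dist w z < r \<longrightarrow> d (pr z) (pr w) < e" using pr_continuous[OF e(1)] by blast
  then show "\<exists>e>0. \<forall>y. dist y z < e \<longrightarrow> y \<in> pr -` U"
    using e by (intro exI[of _ r]) (auto simp: Ball_inf_def)
qed

lemma opens_inf_sub: "opens_inf L \<subseteq> Pow (Xinf L)" by (auto simp: opens_inf_def)

lemma space_Xmeas [simp]: "space (Xmeas L) = Xinf L"
  unfolding Xmeas_def by (rule space_measure_of[OF opens_inf_sub])

lemma sets_Xmeas: "sets (Xmeas L) = sigma_sets (Xinf L) (opens_inf L)"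
  unfolding Xmeas_def by (rule sets_measure_of[OF opens_inf_sub])

lemma pr_measurable [measurable]: "pr \<in> borel \<rightarrow>\<^sub>M Xmeas L"
  unfolding Xmeas_def using opens_inf_sub opens_inf_vimage
  by (intro measurable_measure_of) auto

lemma Ball_inf_open: "Ball_inf L (pr z) r \<in> opens_inf L"
  unfolding opens_inf_def
proof (intro CollectI conjI ballI)
  fix x assume "x \<in> Ball_inf L (pr z) r"
  then obtain w where w: "x = pr w" "d (pr z) (pr w) < r" by (auto simp: Ball_inf_def Xinf_eq)
  have "Ball_inf L x (r - d (pr z) (pr w)) \<subseteq> Ball_inf L (pr z) r"
    unfolding Ball_inf_def Xinf_eq w using dinf_triangle[of z _ w] by (auto, smt (verit))
  then show "\<exists>ra>0. Ball_inf L x ra \<subseteq> Ball_inf L (pr z) r"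
    using w by (intro exI[of _ "r - d (pr z) (pr w)"]) auto
qed (auto simp: Ball_inf_def)

lemma Ball_inf_sets [measurable]: "Ball_inf L (pr z) r \<in> sets (Xmeas L)"
  unfolding sets_Xmeas using Ball_inf_open by blast

lemma dinf_measurable [measurable]: "d (pr z) \<in> borel_measurable (Xmeas L)"
proof (subst borel_measurable_iff_less, intro allI)
  fix a
  have "{w \<in> space (Xmeas L). d (pr z) w < a} = Ball_inf L (pr z) a" by (auto simp: Ball_inf_def)
  then show "{w \<in> space (Xmeas L). d (pr z) w < a} \<in> sets (Xmeas L)" by simp
qed

lemma emeasure_muinf: "A \<in> sets (Xmeas L) \<Longrightarrow> emeasure (muinf L) A = emeasure lborel (pr -` A)"
  unfolding muinf_def by (subst emeasure_distr) auto

text \<open>\<open>U\<close> descends to the quotient, and the difference of its values there is a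
  competitor in the supremum that defines \<open>dinf\<close>.\<close>

lemma dinf_ge_potential:
  fixes U :: "pt \<Rightarrow> real"
  assumes inv: "\<And>j p q. (p, q) \<in> Rgen L \<Longrightarrow> U (Phij L j p) = U (Phij L j q)"
    and osc: "\<And>i a b x y. x \<in> cellY L i a b \<Longrightarrow> y \<in> cellY L i a b \<Longrightarrow> \<bar>U x - U y\<bar> \<le> hs i"
  shows "\<bar>U z - U w\<bar> \<le> d (pr z) (pr w)"
proof -
  define u where "u X = U (SOME z. pr z = X)" for X
  have u: "u (pr z) = U z" for z
  proof -
    have "pr (SOME w. pr w = pr z) = pr z" by (rule someI[of _ z]) simp
    then show ?thesis unfolding u_def pr_eq_iff using Rinf_invariant[where U = U] inv by blast
  qed
  have "admissible L (\<lambda>X Y. \<bar>u X - u Y\<bar>)"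
    unfolding admissible_def pseudodist_on_def
    using osc by (auto simp: u hs_def mh_def abs_minus_commute)
  from dinf_ge_admissible[OF this, of z w] show ?thesis by (simp add: u)
qed

text \<open>After rescaling, cells of level at most 0 allow an oscillation of at least 1, which the
  range of \<open>U\<close> guarantees; only finer cells need an estimate.\<close>

lemma dinf_ge_potential_scaled:
  fixes U :: "pt \<Rightarrow> real"
  assumes inv: "\<And>j p q. (p, q) \<in> Rgen L \<Longrightarrow> U (Phij L j p) = U (Phij L j q)"
    and osc: "\<And>i a b x y. i \<ge> 1 \<Longrightarrow> x \<in> cellY L i a b \<Longrightarrow> y \<in> cellY L i a b \<Longrightarrow> \<bar>U x - U y\<bar> \<le> hs i"
    and range: "\<And>z. 0 \<le> U z" "\<And>z. U z \<le> 1"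
  shows "hs n * \<bar>U z - U w\<bar> \<le> d (pr (Phij L n z)) (pr (Phij L n w))"
proof -
  define W where "W z = hs n * U (Phij L (-n) z)" for z
  have "\<bar>W (Phij L n z) - W (Phij L n w)\<bar> \<le> d (pr (Phij L n z)) (pr (Phij L n w))"
  proof (rule dinf_ge_potential)
    show "W (Phij L j p) = W (Phij L j q)" if "(p, q) \<in> Rgen L" for j p q
      using inv[OF that] by (simp add: W_def Phij_Phij)
    fix i a b x y assume xy: "x \<in> cellY L i a b" "y \<in> cellY L i a b"
    have *: "\<bar>U (Phij L (-n) x) - U (Phij L (-n) y)\<bar> \<le> hs (i - n)"
    proof (cases "i - n \<ge> 1")
      case True then show ?thesis using osc[OF True] Phij_cell[OF xy(1), of "-n"] Phij_cell[OF xy(2), of "-n"] by auto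
    next
      case False
      then have "hs 0 \<le> hs (i - n)" by (subst hs_le_iff) simp
      moreover have "\<bar>U (Phij L (-n) x) - U (Phij L (-n) y)\<bar> \<le> 1"
        using range[of "Phij L (-n) x"] range[of "Phij L (-n) y"] by linarith
      ultimately show ?thesis by simp
    qed
    have "\<bar>W x - W y\<bar> = hs n * \<bar>U (Phij L (-n) x) - U (Phij L (-n) y)\<bar>"
      by (simp add: W_def abs_mult flip: right_diff_distrib)
    also have "\<dots> \<le> hs n * hs (i - n)" by (intro mult_left_mono *) simp
    also have "\<dots> = hs i" by (simp flip: hs_add)
    finally show "\<bar>W x - W y\<bar> \<le> hs i" .
  qed
  then show ?thesis by (simp add: W_def Phij_Phij abs_mult flip: right_diff_distrib)
qed

end

section \<open>A height invariant under fine gluings\<close>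

definition tri3 :: "real \<Rightarrow> real" where
  "tri3 s = min 1 (infdist s (range (\<lambda>k::int. 3 * real_of_int k)))"
text \<open>The sum \<open>s + collapse s\<close> is constant on each interval from
  \<open>3l - 1\<close> to \<open>3l + 1\<close> and rises with slope 3 on the remaining third of
  the period.\<close>

definition collapse :: "real \<Rightarrow> real" where "collapse s = tri3 s + 2 * tri3 (s - 1)"
definition tent :: "real \<Rightarrow> real" where "tent x = max 0 (1 - 4 * infdist x \<int>)"
text \<open>The shift by \<open>i\<close> matches the vertical offset of the segments in column
  \<open>i\<close>. Tents of radius 1/4 make each correction full on its own lines and zero on the
  other two columns and on integer lines.\<close>

definition collapse_at :: "real \<Rightarrow> real \<Rightarrow> real" where
  "collapse_at x w = w + (\<Sum>i\<in>{1,2,3::int}. tent (x - real_of_int i / 4) * collapse (w - real_of_int i))"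

lemma infdist_lip: "\<bar>infdist x A - infdist y A\<bar> \<le> \<bar>x - y\<bar>" for x :: real
  using infdist_triangle[of x A y] infdist_triangle[of y A x] by (simp add: dist_real_def abs_le_iff abs_minus_commute)

lemma infdist_ge: "A \<noteq> {} \<Longrightarrow> (\<And>a. a \<in> A \<Longrightarrow> c \<le> \<bar>x - a\<bar>) \<Longrightarrow> c \<le> infdist x A" for x :: real
  unfolding infdist_def by (auto intro!: cINF_greatest simp: dist_real_def)

lemma infdist_le_abs: "a \<in> A \<Longrightarrow> infdist x A \<le> \<bar>x - a\<bar>" for x :: real
  using infdist_le[of a A x] by (simp add: dist_real_def)

lemma tri3_lip: "\<bar>tri3 s - tri3 t\<bar> \<le> \<bar>s - t\<bar>"
  unfolding tri3_def using infdist_lip[of s "range (\<lambda>k::int. 3 * real_of_int k)" t] by (smt (verit))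

lemma tri3_bounds: "0 \<le> tri3 s" "tri3 s \<le> 1"
  unfolding tri3_def using infdist_nonneg by auto

lemma tri3_near:
  assumes "\<bar>s - 3 * real_of_int l\<bar> \<le> 1" shows "tri3 s = \<bar>s - 3 * real_of_int l\<bar>"
proof -
  have "\<bar>s - 3 * real_of_int l\<bar> \<le> \<bar>s - 3 * real_of_int k\<bar>" for k
  proof (cases "k = l")
    case False
    then have "\<bar>real_of_int k - l\<bar> \<ge> 1" by linarith
    then show ?thesis using assms by linarith
  qed simp
  then have "infdist s (range (\<lambda>k::int. 3 * real_of_int k)) = \<bar>s - 3 * real_of_int l\<bar>"
    by (intro antisym infdist_ge infdist_le_abs) auto
  then show ?thesis using assms by (simp add: tri3_def)
qed

lemma tri3_far:
  assumes "3 * real_of_int l - 2 \<le> s" "s \<le> 3 * real_of_int l - 1" shows "tri3 s = 1"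
proof -
  have "1 \<le> \<bar>s - 3 * real_of_int k\<bar>" for k
  proof (cases "k \<ge> l")
    case True
    then have "real_of_int k \<ge> l" by linarith
    then show ?thesis using assms by linarith
  next
    case False
    then have "real_of_int k \<le> l - 1" by linarith
    then show ?thesis using assms by linarith
  qed
  then have "1 \<le> infdist s (range (\<lambda>k::int. 3 * real_of_int k))" by (intro infdist_ge) auto
  then show ?thesis by (simp add: tri3_def)
qed

lemma collapse_lip: "\<bar>collapse s - collapse t\<bar> \<le> 3 * \<bar>s - t\<bar>"
  unfolding collapse_def using tri3_lip[of s t] tri3_lip[of "s - 1" "t - 1"] by (smt (verit))

lemma collapse_bounds: "0 \<le> collapse s" "collapse s \<le> 3"
  unfolding collapse_def using tri3_bounds[of s] tri3_bounds[of "s-1"] by linarith+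

text \<open>The one property of \<open>collapse\<close> that matters: \<open>s + collapse s\<close> takes the same value at glued heights.\<close>
lemma collapse_step:
  assumes "3 * real_of_int l - 1 \<le> s" "s \<le> 3 * real_of_int l"
  shows "collapse (s + 1) = collapse s - 1"
  unfolding collapse_def
  using tri3_near[of "s+1" l] tri3_near[of s l] tri3_far[of l "s-1"] assms by auto

lemma tent_lip: "\<bar>tent s - tent t\<bar> \<le> 4 * \<bar>s - t\<bar>"
  unfolding tent_def using infdist_lip[of s \<int> t] by (smt (verit))

lemma tent_bounds: "0 \<le> tent s" "tent s \<le> 1"
  unfolding tent_def using infdist_nonneg[of s \<int>] by auto

lemma tent_int: "s \<in> \<int> \<Longrightarrow> tent s = 1" by (simp add: tent_def)

lemma tent_quarter:
  fixes m :: int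
  assumes "\<not> 4 dvd m" shows "tent (real_of_int m / 4) = 0"
proof -
  have "1/4 \<le> \<bar>real_of_int m / 4 - real_of_int k\<bar>" for k :: int
  proof -
    have "m \<noteq> 4 * k" using assms by auto
    then have "\<bar>real_of_int m - 4 * real_of_int k\<bar> \<ge> 1" by linarith
    then show ?thesis by linarith
  qed
  then have "1/4 \<le> infdist (real_of_int m / 4) \<int>" by (intro infdist_ge) (auto elim!: Ints_cases)
  then show ?thesis by (simp add: tent_def)
qed

lemma collapse_at_dist: "\<bar>collapse_at x w - w\<bar> \<le> 9"
proof -
  have "0 \<le> tent (x - i) * collapse w \<and> tent (x - i) * collapse w \<le> 3" for i w
    using tent_bounds[of "x-i"] collapse_bounds[of w] mult_mono[of "tent (x-i)" 1 "collapse w" 3] by auto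
  from this[of "1/4" "w-1"] this[of "2/4" "w-2"] this[of "3/4" "w-3"]
  show ?thesis by (simp add: collapse_at_def)
qed

lemma prod_diff_le:
  fixes a b a' b' :: real
  assumes "0 \<le> a" "a \<le> 1" "0 \<le> b'" "b' \<le> 3" "\<bar>a - a'\<bar> \<le> 4 * u" "\<bar>b - b'\<bar> \<le> 3 * v"
  shows "\<bar>a * b - a' * b'\<bar> \<le> 12 * u + 3 * v"
proof -
  have "a * b - a' * b' = a * (b - b') + (a - a') * b'" by (simp add: algebra_simps)
  moreover have "\<bar>a * (b - b')\<bar> \<le> 1 * (3 * v)" unfolding abs_mult using assms by (intro mult_mono) auto
  moreover have "\<bar>(a - a') * b'\<bar> \<le> (4 * u) * 3" unfolding abs_mult using assms by (intro mult_mono) auto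
  ultimately show ?thesis by linarith
qed

text \<open>Each of the three products contributes 3 in the height, from \<open>collapse\<close>,
  and 12 in the abscissa, the slope 4 of \<open>tent\<close> times the bound 3 of
  \<open>collapse\<close>.\<close>

lemma collapse_at_lip: "\<bar>collapse_at x w - collapse_at x' w'\<bar> \<le> 10 * \<bar>w - w'\<bar> + 36 * \<bar>x - x'\<bar>"
proof -
  have *: "\<bar>tent (x - i) * collapse (w - j) - tent (x' - i) * collapse (w' - j)\<bar> \<le> 12 * \<bar>x - x'\<bar> + 3 * \<bar>w - w'\<bar>" for i j
    using tent_bounds collapse_bounds tent_lip[of "x-i" "x'-i"] collapse_lip[of "w-j" "w'-j"]
    by (intro prod_diff_le) auto
  have sum3: "\<bar>w + (a1 + (a2 + a3)) - (w' + (b1 + (b2 + b3)))\<bar> \<le> \<bar>w - w'\<bar> + \<bar>a1 - b1\<bar> + \<bar>a2 - b2\<bar> + \<bar>a3 - b3\<bar>"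
    for a1 a2 a3 b1 b2 b3 :: real by linarith
  show ?thesis unfolding collapse_at_def
    using *[of "1/4" 1] *[of "2/4" 2] *[of "3/4" 3] by (simp, intro order.trans[OF sum3]) linarith
qed

lemma collapse_at_int: "collapse_at (real_of_int m) w = w"
proof -
  have "tent (m - i / 4) = 0" if "i \<in> {1,2,3::int}" for i
  proof -
    have "i = 1 \<or> i = 2 \<or> i = 3" using that by auto
    then have "\<not> 4 dvd (4 * m - i)" by presburger
    then show ?thesis using tent_quarter[of "4 * m - i"] by (simp add: diff_divide_distrib)
  qed
  then show ?thesis by (simp add: collapse_at_def)
qed

lemma collapse_at_glue:
  assumes "i \<in> {1,2,3::int}" "3 * real_of_int l + i - 1 \<le> w" "w \<le> 3 * real_of_int l + i"
  shows "collapse_at (k + i / 4) (w + 1) = collapse_at (real_of_int k + i / 4) w"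
proof -
  have t: "tent (k + i / 4 - j / 4) = (if j = i then 1 else 0)" if "j \<in> {1,2,3::int}" for j
  proof -
    have "i = 1 \<or> i = 2 \<or> i = 3" "j = 1 \<or> j = 2 \<or> j = 3" using that assms(1) by auto
    then have "j \<noteq> i \<Longrightarrow> \<not> 4 dvd (4 * k + i - j)" by presburger
    then show ?thesis using tent_quarter[of "4 * k + i - j"] tent_int[of "real_of_int k"]
      by (auto simp: diff_divide_distrib add_divide_distrib)
  qed
  have "collapse_at (real_of_int k + i / 4) v = v + collapse (v - i)" for v :: real
    unfolding collapse_at_def using assms(1) by (subst sum.cong[OF refl, of _ _ "\<lambda>j. if j = i then collapse (v - i) else 0"]) (auto simp: t)
  then show ?thesis using collapse_step[of l "w - i"] assms(2,3) by (simp add: algebra_simps)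
qed

context glued_plane begin

primrec unfold_n :: "nat \<Rightarrow> real \<Rightarrow> real \<Rightarrow> real" where
  "unfold_n 0 x y = y"
| "unfold_n (Suc n) x y = collapse_at x (unfold_n n (4 * x) (M * y)) / M"

text \<open>
  The limit of \<open>T\<^sub>1 \<circ> T\<^sub>2 \<circ> \<dots>\<close>, where \<open>T\<^sub>n\<close> flattens the glued segments of level \<open>n\<close> on
  the lines of that level and interpolates in the abscissa. On a line of level \<open>n\<close> all finer
  maps are the identity, so they do not spoil the invariance of \<open>T\<^sub>n\<close>.
\<close>
definition hgt :: "pt \<Rightarrow> real" where
  "hgt z = lim (\<lambda>n. unfold_n n (fst z) (snd z))"

lemma abs_div_M_diff: "\<bar>c / M - y\<bar> = \<bar>c - M * y\<bar> / M"
proof -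
  have "c / M - y = (c - M * y) / M" by (simp add: diff_divide_distrib)
  then show ?thesis by (simp only: abs_divide abs_of_pos[OF M_pos])
qed

text \<open>A single flattening moves a height by at most \<open>9 / M\<close>; each enclosing map
  multiplies the discrepancy by at most \<open>10 / M\<close>, well below 1/2.\<close>

lemma unfold_n_diff: "\<bar>unfold_n (Suc n) x y - unfold_n n x y\<bar> \<le> (1/2) ^ n"
proof (induction n arbitrary: x y)
  case 0
  have "\<bar>collapse_at x (M * y) / M - y\<bar> = \<bar>collapse_at x (M * y) - M * y\<bar> / M"
    by (rule abs_div_M_diff)
  also have "\<dots> \<le> 9 / M" using collapse_at_dist by (intro divide_right_mono[OF _ M_nonneg])
  also have "\<dots> \<le> 1" using M_ge by simp
  finally show ?case by simp
next
  case (Suc n)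
  let ?a = "unfold_n (Suc n) (4*x) (M*y)" and ?b = "unfold_n n (4*x) (M*y)"
  have "\<bar>collapse_at x ?a / M - collapse_at x ?b / M\<bar> = \<bar>collapse_at x ?a - collapse_at x ?b\<bar> / M"
    by (simp flip: diff_divide_distrib)
  also have "\<dots> \<le> (10 * \<bar>?a - ?b\<bar>) / M" using collapse_at_lip[of x ?a x ?b] by (intro divide_right_mono[OF _ M_nonneg]) (simp del: unfold_n.simps)
  also have "\<dots> \<le> (10 * (1/2)^n) / M" using Suc.IH[of "4*x" "M*y"] by (intro divide_right_mono[OF _ M_nonneg] mult_left_mono) simp_all
  also have "\<dots> \<le> (10 * (1/2)^n) / 300" using M_ge by (intro divide_left_mono) auto
  also have "\<dots> \<le> (1/2) ^ Suc n" by simp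
  finally show ?case by simp
qed

lemma unfold_n_lim: "(\<lambda>n. unfold_n n x y) \<longlonglongrightarrow> hgt (x, y)"
proof -
  have "summable (\<lambda>n. unfold_n (Suc n) x y - unfold_n n x y)"
    using unfold_n_diff by (intro summable_comparison_test'[OF summable_geometric[of "1/2::real"], of 0]) auto
  then have "convergent (\<lambda>N. \<Sum>n<N. unfold_n (Suc n) x y - unfold_n n x y)"
    by (simp only: summable_iff_convergent)
  then have "convergent (\<lambda>N. unfold_n N x y - y)"
    by (simp only: sum_lessThan_telescope[where f = "\<lambda>n. unfold_n n x y"] unfold_n.simps(1))
  from convergent_add[OF this convergent_const[of y]] show ?thesis
    by (simp add: hgt_def convergent_LIMSEQ_iff)
qed

text \<open>The self-similarity from which invariance and oscillation follow: one outermost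
  flattening, applied to the height of the picture magnified by one level.\<close>

lemma hgt_eq: "hgt (x, y) = collapse_at x (hgt (4 * x, M * y)) / M"
proof -
  have "continuous_on UNIV (collapse_at x)"
    using collapse_at_lip[of x _ x]
    by (intro lipschitz_on_continuous_on[of 10] lipschitz_onI) (auto simp: dist_real_def)
  then have "isCont (collapse_at x) w" for w by (simp add: continuous_on_eq_continuous_at)
  then have "(\<lambda>n. collapse_at x (unfold_n n (4 * x) (M * y))) \<longlonglongrightarrow> collapse_at x (hgt (4 * x, M * y))"
    by (rule isCont_tendsto_compose[OF _ unfold_n_lim])
  then have "(\<lambda>n. unfold_n (Suc n) x y) \<longlonglongrightarrow> collapse_at x (hgt (4 * x, M * y)) / M"
    unfolding unfold_n.simps by (rule tendsto_divide[OF _ tendsto_const]) simp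
  moreover have "(\<lambda>n. unfold_n (Suc n) x y) \<longlonglongrightarrow> hgt (x, y)" by (intro LIMSEQ_Suc unfold_n_lim)
  ultimately show ?thesis by (rule LIMSEQ_unique[rotated])
qed

text \<open>The bound reproduces itself, since \<open>(9 + 1/20) / M\<close> is at most
  1/20.\<close>

lemma unfold_n_dist: "\<bar>unfold_n n x y - y\<bar> \<le> 1/20"
proof (induction n arbitrary: x y)
  case (Suc n)
  let ?b = "unfold_n n (4*x) (M*y)"
  have "\<bar>collapse_at x ?b / M - y\<bar> = \<bar>collapse_at x ?b - M * y\<bar> / M"
    by (rule abs_div_M_diff)
  also have "\<dots> \<le> (9 + 1/20) / M" using collapse_at_dist[of x ?b] Suc.IH[of "4*x" "M*y"]
    by (intro divide_right_mono[OF _ M_nonneg]) linarith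
  also have "\<dots> \<le> (9 + 1/20) / 300" using M_ge by (intro divide_left_mono) auto
  finally show ?case by simp
qed simp

lemma hgt_dist: "\<bar>hgt (x, y) - y\<bar> \<le> 1/20"
proof (rule LIMSEQ_le_const2[of "\<lambda>n. \<bar>unfold_n n x y - y\<bar>"])
  show "(\<lambda>n. \<bar>unfold_n n x y - y\<bar>) \<longlonglongrightarrow> \<bar>hgt (x, y) - y\<bar>" by (intro tendsto_intros unfold_n_lim)
qed (use unfold_n_dist in auto)

lemma unfold_n_int: "unfold_n n (real_of_int m) y = y"
proof (induction n arbitrary: m y)
  case (Suc n)
  from Suc.IH[of "4 * m" "M * y"] show ?case by (simp add: collapse_at_int)
qed simp

lemma hgt_int: "hgt (real_of_int m, y) = y"
  using unfold_n_lim[of "real_of_int m" y] by (simp add: unfold_n_int LIMSEQ_const_iff)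

lemma Rgen_iff: "((x, y), q) \<in> Rgen L \<longleftrightarrow> q = (x, y + 1 / M) \<and>
   (\<exists>k l i. i \<in> {1,2,3} \<and> x = real_of_int k + real_of_int i / 4 \<and>
     3 * real_of_int l + i - 1 \<le> M * y \<and> M * y \<le> 3 * real_of_int l + i)"
proof -
  have "a / M \<le> y \<longleftrightarrow> a \<le> M * y" "y \<le> a / M \<longleftrightarrow> M * y \<le> a" for a
    by (simp_all add: field_simps)
  then show ?thesis by (fastforce simp: Rgen_def aseg_def)
qed

text \<open>For \<open>n = 0\<close> the abscissa \<open>4 * x\<close> is an integer, where the
  inner height is the ordinate, and \<open>collapse_at_glue\<close> applies. A finer level reduces
  to the previous one by \<open>hgt_eq\<close>, because gluing keeps the abscissa.\<close>

lemma hgt_glue: "(p, q) \<in> Rgen L \<Longrightarrow> hgt (Phij L (int n) p) = hgt (Phij L (int n) q)"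
proof (induction n)
  case 0
  obtain x y where p: "p = (x, y)" by fastforce
  from 0 obtain k l i where *: "i \<in> {1,2,3}" "x = real_of_int k + real_of_int i / 4" "q = (x, y + 1 / M)"
     "3 * real_of_int l + i - 1 \<le> M * y" "M * y \<le> 3 * real_of_int l + i" by (auto simp: p Rgen_iff)
  have x4: "hgt (4 * x, v) = v" for v using hgt_int[of "4 * k + i"] *(2) by (simp add: add_divide_distrib)
  have "M * (y + 1 / M) = M * y + 1" by (simp add: algebra_simps)
  moreover have "hgt (x, v) = collapse_at x (M * v) / M" for v by (subst hgt_eq) (simp add: x4)
  ultimately show ?case using collapse_at_glue[OF *(1,4,5), of k] *(2,3)
    by (simp add: p)
next
  case (Suc n)
  have k: "hs (int n) = 4 * hs (int (Suc n))" "V (int n) = M * V (int (Suc n))"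
    using hs_Suc[of "int n"] V_Suc[of "int n"] by (simp_all add: add.commute)
  have k': "4 * (hs (int (Suc n)) * x) = hs (int n) * x" "M * (V (int (Suc n)) * y) = V (int n) * y" for x y
    by (simp_all only: k mult.assoc)
  have *: "hgt (Phij L (int (Suc n)) (x, y)) =
     collapse_at (hs (int (Suc n)) * x) (hgt (Phij L (int n) (x, y))) / M" for x y
    unfolding Phij_eq by (subst hgt_eq) (simp only: k')
  have "fst p = fst q" using Suc.prems by (auto simp: Rgen_def)
  then show ?case using Suc.IH[OF Suc.prems]
      *[of "fst p" "snd p", unfolded prod.collapse] *[of "fst q" "snd q", unfolded prod.collapse]
    by (simp del: of_nat_Suc)
qed

text \<open>Magnification turns the cell into one of the previous level. For a cell of width
  \<open>h\<close> the inner oscillation is at most \<open>8 * h\<close>, and the Lipschitz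
  constants give \<open>(80 + 36) * h / M\<close>, less than \<open>2 * h\<close>.\<close>

lemma hgt_osc:
  "z \<in> cellY L (int n) a b \<Longrightarrow> w \<in> cellY L (int n) a b \<Longrightarrow> \<bar>hgt z - hgt w\<bar> \<le> 2 * hs (int n)"
proof (induction n arbitrary: z w)
  case 0
  obtain x y x' y' where zw: "z = (x, y)" "w = (x', y')" by fastforce
  have "\<bar>y - y'\<bar> \<le> 1" using 0 by (auto simp: zw cellY_iff abs_le_iff)
  then show ?case using hgt_dist[of x y] hgt_dist[of x' y'] unfolding zw hs_0 of_nat_0 by linarith
next
  case (Suc n)
  obtain x y x' y' where zw: "z = (x, y)" "w = (x', y')" by fastforce
  have c: "(4 * x, M * y) \<in> cellY L (int n) a b" "(4 * x', M * y') \<in> cellY L (int n) a b"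
    using Phij_cell[OF Suc.prems(1), of "-1"] Phij_cell[OF Suc.prems(2), of "-1"]
      hs_minus_nat[of 1] V_minus_nat[of 1]
    by (simp_all add: zw Phij_eq)
  let ?h = "hs (int (Suc n))"
  have h: "hs (int n) = 4 * ?h" using hs_Suc[of "int n"] by (simp add: add.commute)
  have xx: "\<bar>x - x'\<bar> \<le> ?h" using Suc.prems by (auto simp: zw cellY_iff abs_le_iff algebra_simps)
  let ?u = "hgt (4 * x, M * y)" and ?v = "hgt (4 * x', M * y')"
  have "\<bar>hgt z - hgt w\<bar> = \<bar>collapse_at x ?u - collapse_at x' ?v\<bar> / M"
    unfolding zw hgt_eq[of x] hgt_eq[of x'] by (simp flip: diff_divide_distrib)
  also have "\<dots> \<le> (10 * (8 * ?h) + 36 * ?h) / M"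
  proof (intro divide_right_mono[OF _ M_nonneg])
    have "A \<le> 10 * B + 36 * X \<Longrightarrow> B \<le> 2 * (4 * e) \<Longrightarrow> X \<le> e \<Longrightarrow> A \<le> 10 * (8 * e) + 36 * e" for A B X e :: real
      by linarith
    from this[OF collapse_at_lip[of x ?u x' ?v] Suc.IH[OF c, unfolded h] xx]
    show "\<bar>collapse_at x ?u - collapse_at x' ?v\<bar> \<le> 10 * (8 * ?h) + 36 * ?h" .
  qed
  also have "\<dots> \<le> (10 * (8 * ?h) + 36 * ?h) / 300" using M_ge by (intro divide_left_mono) auto
  also have "\<dots> \<le> 2 * ?h"
    using hs_nonneg[of "int (Suc n)"] by (simp del: of_nat_Suc)
  finally show ?case .
qed

end

section \<open>Points at small distance\<close>

text \<open>As \<open>i\<close> is not 0 modulo 4, the exact power of 4 dividing the left side is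
  \<open>4 ^ a\<close>.\<close>

lemma line_unique_aux:
  fixes k k' i i' :: int
  assumes "i \<in> {1,2,3}" "4 ^ a * (4 * k + i) = 4 ^ b * (4 * k' + i')" shows "b \<le> a"
proof (rule ccontr)
  assume "\<not> b \<le> a"
  then obtain c where c: "b = a + Suc c" using less_iff_Suc_add by (metis add_Suc_right not_le)
  have "4 ^ a * (4 * k + i) = 4 ^ a * (4 * (4 ^ c * (4 * k' + i')))"
    using assms(2) by (simp add: c power_add algebra_simps)
  then have "4 * k + i = 4 * (4 ^ c * (4 * k' + i'))" by simp
  moreover have "i = 1 \<or> i = 2 \<or> i = 3" using assms(1) by auto
  ultimately show False by presburger
qed

lemma line_unique:
  fixes k k' i i' :: int
  assumes "i \<in> {1,2,3}" "i' \<in> {1,2,3}" "4 ^ a * (4 * k + i) = 4 ^ b * (4 * k' + i')"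
  shows "a = b \<and> k = k' \<and> i = i'"
proof -
  have ab: "a = b" using line_unique_aux[OF assms(1,3)] line_unique_aux[OF assms(2) assms(3)[symmetric]] by simp
  then have "4 * k + i = 4 * k' + i'" using assms(3) by simp
  moreover have "1 \<le> i" "i \<le> 3" "1 \<le> i'" "i' \<le> 3" using assms(1,2) by auto
  ultimately show ?thesis using ab by (cases k k' rule: linorder_cases) linarith+
qed

lemma mult_int_step:
  fixes c :: real
  shows "c * real_of_int z = c * real_of_int (z - 1) + c" "c * real_of_int (z + 1) = c * real_of_int (z - 1) + 2 * c"
  by (simp_all add: algebra_simps)

text \<open>Points of \<open>S\<close> at distance \<open>c\<close> or more do not affect the
  truncated distance, so only near ones need a partner for \<open>y'\<close>.\<close>

lemma min_infdist_le:
  fixes y y' :: real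
  assumes "S \<noteq> {}" "\<And>s. s \<in> S \<Longrightarrow> \<bar>y - s\<bar> < c \<Longrightarrow> \<exists>s'\<in>S. \<bar>y' - s'\<bar> \<le> \<bar>y - s\<bar>"
  shows "min c (infdist y' S) \<le> min c (infdist y S)"
proof -
  have "min c (infdist y' S) \<le> infdist y S"
  proof (rule infdist_ge[OF assms(1)])
    fix s assume s: "s \<in> S"
    show "min c (infdist y' S) \<le> \<bar>y - s\<bar>"
    proof (cases "\<bar>y - s\<bar> < c")
      case True
      then obtain s' where "s' \<in> S" "\<bar>y' - s'\<bar> \<le> \<bar>y - s\<bar>" using assms(2) s by blast
      then show ?thesis using infdist_le_abs[of s' S y'] by linarith
    qed auto
  qed
  then show ?thesis by simp
qed

context glued_plane begin

section \<open>Coarse gluing lines seen at unit scale\<close>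

abbreviation gline :: "nat \<Rightarrow> int \<Rightarrow> int \<Rightarrow> int" where "gline a k i \<equiv> 4 ^ a * (4 * k + i)"

text \<open>A glued segment and its translate by \<open>M ^ a\<close> are adjacent, so their union
  spans two steps, from \<open>i - 1\<close> to \<open>i + 1\<close>; \<open>e\<close> is a
  tolerance at both ends.\<close>

definition in_glued :: "real \<Rightarrow> nat \<Rightarrow> int \<Rightarrow> int \<Rightarrow> real \<Rightarrow> bool" where
  "in_glued e a i l v \<longleftrightarrow>
     M ^ a * real_of_int (3 * l + i - 1) - e \<le> v \<and> v \<le> M ^ a * real_of_int (3 * l + i + 1) + e"

text \<open>
  At unit scale the coarse lines are those with integer abscissa \<open>gline a k i\<close>, on which segments of
  length \<open>M ^ a\<close> are glued. A window around \<open>x0\<close> meets at most one of them, and \<open>copies\<close> collects the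
  heights identified with \<open>v0\<close> there, up to an error \<open>2e\<close>; the enlargement by \<open>2e\<close> makes the
  truncated distance to this set invariant under the gluing.
\<close>
definition copies :: "real \<Rightarrow> real \<Rightarrow> real \<Rightarrow> real set" where
  "copies e x0 v0 = insert v0 {s. \<exists>a k i l m. i \<in> {1,2,3} \<and> \<bar>real_of_int (gline a k i) - x0\<bar> < e \<and>
     in_glued (2 * e) a i l v0 \<and> in_glued (2 * e) a i l s \<and> s = v0 + real_of_int m * M ^ a}"

lemma M_pow_ge1: "1 \<le> M ^ a" using M_ge by (intro one_le_power) linarith

text \<open>Integer lines come from negative levels, with an index shift: level
  \<open>-(a + 1)\<close> sends the abscissa \<open>k + i/4\<close> to \<open>gline a k i\<close>
  and turns the step \<open>1 / M\<close> into \<open>M ^ a\<close>.\<close>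

lemma Rgen_push_neg:
  assumes "(p, q) \<in> Rgen L"
  obtains k l i y where "i \<in> {1,2,3}"
    "Phij L (- int (Suc a)) p = (real_of_int (gline a k i), y)"
    "Phij L (- int (Suc a)) q = (real_of_int (gline a k i), y + M ^ a)"
    "M ^ a * real_of_int (3 * l + i - 1) \<le> y" "y \<le> M ^ a * real_of_int (3 * l + i)"
proof -
  obtain x y where p: "p = (x, y)" by fastforce
  from assms obtain k l i where *: "i \<in> {1,2,3}" "x = real_of_int k + real_of_int i / 4" "q = (x, y + 1 / M)"
     "3 * real_of_int l + i - 1 \<le> M * y" "M * y \<le> 3 * real_of_int l + i" by (auto simp: p Rgen_iff)
  have h: "hs (- int (Suc a)) = 4 ^ Suc a" "V (- int (Suc a)) = M ^ Suc a"
    by (rule hs_minus_nat, rule V_minus_nat)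
  show thesis
  proof (rule that[OF *(1), of k "M ^ a * (M * y)" l])
    show "Phij L (- int (Suc a)) p = (real_of_int (gline a k i), M ^ a * (M * y))"
      unfolding p Phij_eq h using *(2) by (simp add: algebra_simps)
    show "Phij L (- int (Suc a)) q = (real_of_int (gline a k i), M ^ a * (M * y) + M ^ a)"
      unfolding *(3) Phij_eq h using *(2) by (simp add: algebra_simps)
    show "M ^ a * real_of_int (3 * l + i - 1) \<le> M ^ a * (M * y)" "M ^ a * (M * y) \<le> M ^ a * real_of_int (3 * l + i)"
      using *(4,5) by (auto intro!: mult_left_mono)
  qed
qed

lemma glue_at:
  assumes "i \<in> {1,2,3}" "M ^ a * real_of_int (3 * l + i - 1) \<le> y" "y \<le> M ^ a * real_of_int (3 * l + i)"
  shows "pr (Phij L n (real_of_int (gline a k i), y)) = pr (Phij L n (real_of_int (gline a k i), y + M ^ a))"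
proof -
  define p where "p = (real_of_int k + real_of_int i / 4, y / M ^ Suc a)"
  define q where "q = (real_of_int k + real_of_int i / 4, y / M ^ Suc a + 1 / M)"
  have y: "M * (y / M ^ Suc a) = y / M ^ a" by simp
  have Mp: "0 < M ^ a" by simp
  have "3 * real_of_int l + i - 1 \<le> y / M ^ a" "y / M ^ a \<le> 3 * real_of_int l + i"
    using assms(2,3) Mp by (simp_all add: pos_le_divide_eq pos_divide_le_eq mult.commute)
  then have "(p, q) \<in> Rgen L" unfolding p_def q_def Rgen_iff y using assms(1) by blast
  from pr_glue[OF this, of "n + - int (Suc a)"]
  have *: "pr (Phij L n (Phij L (- int (Suc a)) p)) = pr (Phij L n (Phij L (- int (Suc a)) q))"
    by (simp only: Phij_Phij)
  have h: "hs (- int (Suc a)) = 4 ^ Suc a" "V (- int (Suc a)) = M ^ Suc a"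
    by (rule hs_minus_nat, rule V_minus_nat)
  have "Phij L (- int (Suc a)) p = (real_of_int (gline a k i), y)"
    "Phij L (- int (Suc a)) q = (real_of_int (gline a k i), y + M ^ a)"
    unfolding p_def q_def Phij_eq h by (simp_all add: algebra_simps)
  then show ?thesis using * by simp
qed

lemma gline_near_unique:
  assumes "i \<in> {1,2,3}" "i' \<in> {1,2,3}" "\<bar>real_of_int (gline a k i) - x0\<bar> < e"
    "\<bar>real_of_int (gline a' k' i') - x0\<bar> < e" "e \<le> 1/10"
  shows "a = a' \<and> k = k' \<and> i = i'"
proof -
  have "gline a k i = gline a' k' i'" using assms(3-5) by linarith
  from line_unique[OF assms(1,2) this] show ?thesis .
qed

text \<open>Consecutive spans on a line are separated by a gap \<open>M ^ a\<close>, at least 1 and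
  thus larger than the combined tolerance \<open>4 * e\<close>.\<close>

lemma in_glued_unique:
  assumes "in_glued (2 * e) a i l v" "in_glued (2 * e) a i l' v" "e \<le> 1/10"
  shows "l = l'"
proof (rule ccontr)
  assume "l \<noteq> l'"
  have *: False if "in_glued (2 * e) a i l v" "in_glued (2 * e) a i l' v" "l < l'" for l l'
  proof -
    have "3 * l + i + 1 + 1 \<le> 3 * l' + i - 1" using that(3) by linarith
    then have "M ^ a * (real_of_int (3 * l + i + 1) + 1) \<le> M ^ a * real_of_int (3 * l' + i - 1)"
      by (intro mult_left_mono) (auto simp: zero_le_power)
    then show False using that(1,2) M_pow_ge1[of a] assms(3) unfolding in_glued_def distrib_left by linarith
  qed
  show False using *[OF assms(1,2)] *[OF assms(2,1)] \<open>l \<noteq> l'\<close> by linarith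
qed

text \<open>By uniqueness of line and span, \<open>s\<close> is itself a translate of
  \<open>v0\<close> within the span of \<open>y\<close>, so the two translations add up. The
  tolerance \<open>2 * e\<close> absorbs the distance from \<open>y\<close> to
  \<open>s\<close>.\<close>

lemma copies_shift:
  assumes e: "0 < e" "e \<le> 1/10" and i: "i \<in> {1,2,3}" and x: "\<bar>real_of_int (gline a k i) - x0\<bar> < e"
    and y: "in_glued 0 a i l y" "in_glued 0 a i l (y + real_of_int m * M ^ a)"
    and s: "s \<in> copies e x0 v0" "\<bar>y - s\<bar> < 2 * e"
  shows "s + real_of_int m * M ^ a \<in> copies e x0 v0"
proof -
  have g: "in_glued (2 * e) a i l s" "in_glued (2 * e) a i l (s + real_of_int m * M ^ a)"
    using y s(2) unfolding in_glued_def by linarith+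
  have "\<exists>m'. s = v0 + real_of_int m' * M ^ a \<and> in_glued (2 * e) a i l v0"
  proof (cases "s = v0")
    case True
    then show ?thesis using g by (intro exI[of _ 0]) auto
  next
    case False
    then obtain a' k' i' l' m' where *: "i' \<in> {1,2,3}" "\<bar>real_of_int (gline a' k' i') - x0\<bar> < e"
      "in_glued (2 * e) a' i' l' v0" "in_glued (2 * e) a' i' l' s" "s = v0 + real_of_int m' * M ^ a'"
      using s(1) unfolding copies_def by blast
    have u: "a = a' \<and> k = k' \<and> i = i'" by (rule gline_near_unique[OF i *(1) x *(2) e(2)])
    then have "l = l'" using g(1) *(4) by (intro in_glued_unique[OF _ _ e(2)]) auto
    then show ?thesis using * u by blast
  qed
  then obtain m' where m': "s = v0 + real_of_int m' * M ^ a" "in_glued (2 * e) a i l v0" by blast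
  have "s + real_of_int m * M ^ a = v0 + real_of_int (m' + m) * M ^ a" by (simp add: m'(1) algebra_simps)
  then show ?thesis unfolding copies_def using i x m'(2) g(2) by blast
qed

lemma in_glued_mono: "in_glued e a i l v \<Longrightarrow> e \<le> e' \<Longrightarrow> in_glued e' a i l v"
  unfolding in_glued_def by linarith

lemma in_glued_lower:
  assumes "M ^ a * real_of_int (3 * l + i - 1) \<le> y" "y \<le> M ^ a * real_of_int (3 * l + i)"
  shows "in_glued 0 a i l y" "in_glued 0 a i l (y + M ^ a)"
proof -
  show "in_glued 0 a i l y" "in_glued 0 a i l (y + M ^ a)"
    using assms M_pow_ge1[of a] unfolding in_glued_def mult_int_step[of "M ^ a" "3 * l + i"] by linarith+
qed

lemma min_max_lip:
  fixes A B A' B' e h :: real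
  assumes "\<bar>A - A'\<bar> \<le> h" "\<bar>B - B'\<bar> \<le> 2 * h"
  shows "\<bar>min e (max A (min (2 * e) B / 2)) - min e (max A' (min (2 * e) B' / 2))\<bar> \<le> h"
  using assms by (auto simp: min_def max_def abs_le_iff)

text \<open>The potential \<open>U\<close> vanishes at the centre and equals \<open>e\<close> as
  soon as one of the two conclusions fails.\<close>

lemma dinf_close:
  assumes e: "0 < e" "e \<le> 1/10"
    and dd: "d (pr (Phij L n (x0, y0))) (pr (Phij L n (x, y))) < e * hs n"
  shows "\<bar>x - x0\<bar> < e \<and> (\<exists>s\<in>copies e x0 (hgt (x0, y0)). \<bar>hgt (x, y) - s\<bar> < 2 * e)"
proof -
  define S where "S = copies e x0 (hgt (x0, y0))"
  have S: "S \<noteq> {}" "hgt (x0, y0) \<in> S" by (auto simp: S_def copies_def)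
  \<comment> \<open>The 1/2 offsets the 2 in \<open>hgt_osc\<close>. The cap \<open>2 * e\<close> on
    the height term makes it invariant by \<open>copies_shift\<close>; the outer cap
    \<open>e\<close> makes \<open>U\<close> constant outside the window around \<open>x0\<close>,
    where other lines glue.\<close>
  define U where "U z = min e (max \<bar>fst z - x0\<bar> (min (2 * e) (infdist (hgt z) S) / 2))" for z
  have "hs n * \<bar>U (x, y) - U (x0, y0)\<bar> \<le> d (pr (Phij L n (x, y))) (pr (Phij L n (x0, y0)))"
  proof (rule dinf_ge_potential_scaled)
    fix j p q assume pq: "(p, q) \<in> Rgen L"
    show "U (Phij L j p) = U (Phij L j q)"
    \<comment> \<open>Gluings of level \<open>j \<ge> 0\<close> are invisible to \<open>hgt\<close>.
      Those of negative level take place on integer lines, where \<open>hgt\<close> is the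
      ordinate.\<close>
    proof (cases "j \<ge> 0")
      case True
      then obtain n where n: "j = int n" using nonneg_int_cases by blast
      have "fst p = fst q" using pq by (auto simp: Rgen_def)
      then have "fst (Phij L j p) = fst (Phij L j q)" by (simp add: Phij_def)
      then show ?thesis using hgt_glue[OF pq, of n] by (simp add: U_def n)
    next
      case False
      then have "j = - int (Suc (nat (- j - 1)))" by simp
      then obtain a where a: "j = - int (Suc a)" by blast
      obtain k l i y where *: "i \<in> {1,2,3}"
        "Phij L j p = (real_of_int (gline a k i), y)"
        "Phij L j q = (real_of_int (gline a k i), y + M ^ a)"
        "M ^ a * real_of_int (3 * l + i - 1) \<le> y" "y \<le> M ^ a * real_of_int (3 * l + i)"
        by (rule Rgen_push_neg[OF pq, of a, folded a])
      note g = in_glued_lower[OF *(4,5)]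
      show ?thesis
      proof (cases "\<bar>real_of_int (gline a k i) - x0\<bar> < e")
        case True
        have "min (2 * e) (infdist y S) = min (2 * e) (infdist (y + M ^ a) S)"
        proof (intro antisym min_infdist_le S)
          fix s assume "s \<in> S" "\<bar>y + M ^ a - s\<bar> < 2 * e"
          then have "s + real_of_int (- 1) * M ^ a \<in> S" unfolding S_def
            using g by (intro copies_shift[OF e *(1) True, of l "y + M ^ a"]) auto
          then show "\<exists>s'\<in>S. \<bar>y - s'\<bar> \<le> \<bar>y + M ^ a - s\<bar>"
            by (intro bexI[of _ "s + real_of_int (- 1) * M ^ a"]) auto
        next
          fix s assume "s \<in> S" "\<bar>y - s\<bar> < 2 * e"
          then have "s + real_of_int 1 * M ^ a \<in> S" unfolding S_def
            using g by (intro copies_shift[OF e *(1) True, of l y]) auto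
          then show "\<exists>s'\<in>S. \<bar>y + M ^ a - s'\<bar> \<le> \<bar>y - s\<bar>"
            by (intro bexI[of _ "s + real_of_int 1 * M ^ a"]) auto
        qed
        then show ?thesis unfolding U_def *(2,3) by (simp only: hgt_int fst_conv)
      next
        case False
        then have "e \<le> max \<bar>real_of_int (gline a k i) - x0\<bar> c" for c by (simp only: le_max_iff_disj not_less simp_thms)
        then show ?thesis unfolding U_def *(2,3) fst_conv by (simp only: min_absorb1)
      qed
    qed
  next
    fix i :: int and a b z w assume "1 \<le> i" and zw: "z \<in> cellY L i a b" "w \<in> cellY L i a b"
    then obtain n where n: "i = int n" using nonneg_int_cases[of i] by auto
    have "\<bar>infdist (hgt z) S - infdist (hgt w) S\<bar> \<le> 2 * hs i"
      using hgt_osc[of z n a b w] zw infdist_lip[of "hgt z" S "hgt w"] unfolding n by linarith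
    moreover have "\<bar>fst z - fst w\<bar> \<le> hs i" using zw
      by (cases z; cases w) (simp add: cellY_iff abs_le_iff distrib_right)
    then have "\<bar>\<bar>fst z - x0\<bar> - \<bar>fst w - x0\<bar>\<bar> \<le> hs i" by linarith
    ultimately show "\<bar>U z - U w\<bar> \<le> hs i" unfolding U_def by (intro min_max_lip)
  next
    fix z show "0 \<le> U z" "U z \<le> 1" using e infdist_nonneg[of "hgt z" S] by (auto simp: U_def min_def max_def)
  qed
  also have "U (x0, y0) = 0" unfolding U_def infdist_zero[OF S(2)] fst_conv using e by simp
  finally have "hs n * \<bar>U (x, y)\<bar> \<le> d (pr (Phij L n (x, y))) (pr (Phij L n (x0, y0)))" by simp
  also have "\<dots> < hs n * e" using dd by (simp only: dinf_sym mult.commute)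
  finally have "U (x, y) < e" by (simp only: mult_less_cancel_left_pos[OF hs_pos])
  then have 1: "\<bar>x - x0\<bar> < e" "infdist (hgt (x, y)) S < 2 * e" using e by (auto simp: U_def min_def max_def split: if_splits)
  have "\<exists>s\<in>S. \<bar>hgt (x, y) - s\<bar> < 2 * e"
  proof (rule ccontr)
    assume "\<not> ?thesis"
    then have "2 * e \<le> infdist (hgt (x, y)) S" by (intro infdist_ge[OF S(1)]) (auto simp: not_less)
    then show False using 1 by linarith
  qed
  then show ?thesis using 1 by (simp add: S_def)
qed

lemma in_glued_shift_bound:
  assumes "in_glued (2 * e) a i l v" "in_glued (2 * e) a i l (v + real_of_int m * M ^ a)" "e \<le> 1/10"
  shows "\<bar>m\<bar> \<le> 2"
proof -
  have "\<bar>real_of_int m * M ^ a\<bar> \<le> 2 * M ^ a + 4/10"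
    using assms unfolding in_glued_def mult_int_step[of "M ^ a" "3 * l + i"] by linarith
  also have "\<dots> < 3 * M ^ a" using M_pow_ge1[of a] by linarith
  finally have "\<bar>real_of_int m\<bar> * M ^ a < 3 * M ^ a" by (simp add: abs_mult)
  then have "\<bar>real_of_int m\<bar> < 3" by (simp add: zero_less_power)
  then show ?thesis by linarith
qed

end

lemma emeasure_lborel_rect:
  fixes a b c e :: real
  assumes "a \<le> b" "c \<le> e"
  shows "emeasure lborel ({a..b} \<times> {c..e}) = ennreal ((b - a) * (e - c))"
proof -
  have "emeasure (lborel \<Otimes>\<^sub>M lborel) ({a..b} \<times> {c..e}) = emeasure lborel {a..b} * emeasure lborel {c..e}"
    by (intro lborel.emeasure_pair_measure_Times) auto
  then show ?thesis using assms by (simp add: lborel_prod ennreal_mult)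
qed

context glued_plane begin

lemma dinf_close_cases:
  assumes e: "0 < e" "e \<le> 1/10"
    and dd: "d (pr (Phij L n (x0, y0))) (pr (Phij L n (x, y))) < e * hs n"
  shows "\<bar>x - x0\<bar> < e"
    and "\<bar>hgt (x, y) - hgt (x0, y0)\<bar> < 2 * e \<or>
      (\<exists>a k i l m. i \<in> {1,2,3} \<and> \<bar>real_of_int (gline a k i) - x0\<bar> < e \<and> \<bar>m\<bar> \<le> 2 \<and>
        in_glued (2 * e) a i l (hgt (x0, y0)) \<and> in_glued (4 * e) a i l (hgt (x, y)) \<and>
        \<bar>hgt (x, y) - (hgt (x0, y0) + real_of_int m * M ^ a)\<bar> < 2 * e)"
proof -
  obtain s where x: "\<bar>x - x0\<bar> < e" and s: "s \<in> copies e x0 (hgt (x0, y0))" "\<bar>hgt (x, y) - s\<bar> < 2 * e"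
    using dinf_close[OF assms] by blast
  show "\<bar>x - x0\<bar> < e" by (rule x)
  show "\<bar>hgt (x, y) - hgt (x0, y0)\<bar> < 2 * e \<or>
      (\<exists>a k i l m. i \<in> {1,2,3} \<and> \<bar>real_of_int (gline a k i) - x0\<bar> < e \<and> \<bar>m\<bar> \<le> 2 \<and>
        in_glued (2 * e) a i l (hgt (x0, y0)) \<and> in_glued (4 * e) a i l (hgt (x, y)) \<and>
        \<bar>hgt (x, y) - (hgt (x0, y0) + real_of_int m * M ^ a)\<bar> < 2 * e)"
  proof (cases "s = hgt (x0, y0)")
    case False
    then obtain a k i l m where *: "i \<in> {1,2,3}" "\<bar>real_of_int (gline a k i) - x0\<bar> < e"
      "in_glued (2 * e) a i l (hgt (x0, y0))" "in_glued (2 * e) a i l s" "s = hgt (x0, y0) + real_of_int m * M ^ a"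
      using s(1) unfolding copies_def by blast
    have "\<bar>m\<bar> \<le> 2" using *(3-5) e by (intro in_glued_shift_bound[of e a i l "hgt (x0, y0)"]) auto
    moreover have "in_glued (4 * e) a i l (hgt (x, y))"
      using *(4) s(2) unfolding in_glued_def by linarith
    ultimately show ?thesis using * s(2) by blast
  qed (use s in blast)
qed

text \<open>At unit scale the ball is covered by five boxes of width 1/5 and height 1, one for each
  possible shift on the only coarse line that can be near; their areas add up to 1.\<close>

lemma ball_measure_le:
  "emeasure (muinf L) (Ball_inf L (pr (Phij L n (x0, y0))) (hs n / 10)) \<le> ennreal (hs n * V n)"
proof -
  define near where "near a \<longleftrightarrow> (\<exists>k i. i \<in> {1,2,3} \<and> \<bar>real_of_int (gline a k i) - x0\<bar> < 1/10)" for a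
  \<comment> \<open>Only one coarse level can occur near \<open>x0\<close>; without any, the value 0
    makes the five boxes coincide.\<close>
  define h where "h = (if \<exists>a. near a then M ^ (SOME a. near a) else 0)"
  have h: "h = M ^ a" if "near a" for a
  proof -
    have "near (SOME a. near a)" using that by (rule someI)
    then have "(SOME a. near a) = a" using that gline_near_unique[where e = "1/10"] unfolding near_def by blast
    then show ?thesis using that by (auto simp: h_def)
  qed
  define box where "box m = {hs n * (x0 - 1/10)..hs n * (x0 + 1/10)} \<times>
      {V n * (y0 + real_of_int m * h - 1/2)..V n * (y0 + real_of_int m * h + 1/2)}" for m
  have sub: "pr -` Ball_inf L (pr (Phij L n (x0, y0))) (hs n / 10) \<subseteq> (\<Union>m\<in>{-2..2}. box m)"
  proof
    fix z assume z: "z \<in> pr -` Ball_inf L (pr (Phij L n (x0, y0))) (hs n / 10)"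
    obtain x y where xy: "z = Phij L n (x, y)"
      using Phij_Phij[of n "-n" z] by (metis Phij_0 add.right_inverse surj_pair)
    have "d (pr (Phij L n (x0, y0))) (pr (Phij L n (x, y))) < 1/10 * hs n"
      using z by (simp add: Ball_inf_def xy)
    note c = dinf_close_cases[OF _ _ this]
    have x: "\<bar>x - x0\<bar> < 1/10" using c(1) by simp
    have "\<exists>m. \<bar>m\<bar> \<le> 2 \<and> \<bar>hgt (x, y) - (hgt (x0, y0) + real_of_int m * h)\<bar> < 2/10"
      using c(2)
    proof
      assume "\<exists>a k i l m. i \<in> {1,2,3} \<and> \<bar>real_of_int (gline a k i) - x0\<bar> < 1/10 \<and> \<bar>m\<bar> \<le> 2 \<and>
        in_glued (2 * (1/10)) a i l (hgt (x0, y0)) \<and> in_glued (4 * (1/10)) a i l (hgt (x, y)) \<and>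
        \<bar>hgt (x, y) - (hgt (x0, y0) + real_of_int m * M ^ a)\<bar> < 2 * (1/10)"
      then obtain a k i m where "i \<in> {1,2,3}" "\<bar>real_of_int (gline a k i) - x0\<bar> < 1/10" "\<bar>m\<bar> \<le> 2"
        "\<bar>hgt (x, y) - (hgt (x0, y0) + real_of_int m * M ^ a)\<bar> < 2/10" by auto
      moreover from this have "h = M ^ a" by (intro h) (auto simp: near_def)
      ultimately show ?thesis by (intro exI[of _ m]) simp
    qed (auto intro!: exI[of _ 0])
    then obtain m where m: "\<bar>m\<bar> \<le> 2" "\<bar>hgt (x, y) - (hgt (x0, y0) + real_of_int m * h)\<bar> < 2/10" by blast
    \<comment> \<open>Passing from \<open>hgt\<close> to the ordinate costs 1/20 at each point,
      which the half-height 1/2 of the boxes accommodates.\<close>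
    have "\<bar>y - (y0 + real_of_int m * h)\<bar> \<le> 1/2" using m(2) hgt_dist[of x y] hgt_dist[of x0 y0] by linarith
    then have "z \<in> box m" unfolding box_def xy Phij_eq using x by (auto; linarith)
    then show "z \<in> (\<Union>m\<in>{-2..2}. box m)" using m(1) by (intro UN_I[of m]) auto
  qed
  have bs: "box m \<in> sets lborel" for m unfolding box_def sets_lborel by (intro borel_closed closed_Times closed_atLeastAtMost)
  have "emeasure (muinf L) (Ball_inf L (pr (Phij L n (x0, y0))) (hs n / 10)) =
     emeasure lborel (pr -` Ball_inf L (pr (Phij L n (x0, y0))) (hs n / 10))" by (intro emeasure_muinf) simp
  also have "\<dots> \<le> emeasure lborel (\<Union>m\<in>{-2..2}. box m)" using bs by (intro emeasure_mono sub) auto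
  also have "\<dots> \<le> (\<Sum>m\<in>{-2..2}. emeasure lborel (box m))" using bs by (intro emeasure_subadditive_finite) auto
  also have "\<dots> = (\<Sum>m\<in>{-2..2::int}. ennreal (hs n / 5 * V n))"
  proof (rule sum.cong)
    fix m :: int
    have "hs n * (x0 + 1/10) - hs n * (x0 - 1/10) = hs n / 5"
      "V n * (y0 + real_of_int m * h + 1/2) - V n * (y0 + real_of_int m * h - 1/2) = V n"
      by (simp_all add: algebra_simps)
    then show "emeasure lborel (box m) = ennreal (hs n / 5 * V n)"
      unfolding box_def by (subst emeasure_lborel_rect) auto
  qed simp
  also have "\<dots> = ennreal (hs n * V n)" by (simp only: sum_constant) (simp flip: ennreal_numeral ennreal_mult')
  finally show ?thesis .
qed

section \<open>Classes at distance zero coincide\<close>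

lemma glue_steps:
  assumes i: "i \<in> {1,2,3}" and g: "in_glued 0 a i l y" "in_glued 0 a i l (y + real_of_int m * M ^ a)" and m: "0 \<le> m"
  shows "pr (Phij L n (real_of_int (gline a k i), y)) = pr (Phij L n (real_of_int (gline a k i), y + real_of_int m * M ^ a))"
proof -
  define b where "b = M ^ a * real_of_int (3 * l + i - 1)"
  have e: "M ^ a * real_of_int (3 * l + i) = b + M ^ a" "M ^ a * real_of_int (3 * l + i + 1) = b + 2 * M ^ a"
    unfolding b_def by (rule mult_int_step)+
  have G: "pr (Phij L n (real_of_int (gline a k i), v)) = pr (Phij L n (real_of_int (gline a k i), v + M ^ a))"
    if "b \<le> v" "v \<le> b + M ^ a" for v
    using glue_at[OF i, of a l v n k] that unfolding e b_def[symmetric] by blast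
  have b: "b \<le> y" "y + real_of_int m * M ^ a \<le> b + 2 * M ^ a"
    using g unfolding in_glued_def e b_def[symmetric] by auto
  have "\<bar>m\<bar> \<le> 2" using g by (intro in_glued_shift_bound[of 0 a i l y]) auto
  then consider "m = 0" | "m = 1" | "m = 2" using m by linarith
  then show ?thesis
  proof cases
    case 2
    then show ?thesis using G[of y] b by simp
  next
    case 3
    then have "y = b" "b + 2 * M ^ a = b + M ^ a + M ^ a" using b by auto
    then show ?thesis using G[of y] G[of "y + M ^ a"] 3 M_pow_ge1[of a] by (simp add: add.assoc)
  qed simp
qed

lemma in_glued_closed: "(\<And>e. 0 < e \<Longrightarrow> in_glued e a i l v) \<Longrightarrow> in_glued 0 a i l v"
  unfolding in_glued_def diff_le_eq diff_zero add_0_right by (blast intro: field_le_epsilon)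

text \<open>The abscissae agree by the first part of \<open>dinf_close_cases\<close>. After
  magnification the heights are more than 1 apart, so for every tolerance a coarse line must explain
  the distance zero; as the tolerance tends to 0, both points fall on one glued span.\<close>

lemma dinf_eq_0_imp:
  assumes "d (pr z) (pr w) = 0" shows "pr z = pr w"
proof (rule ccontr)
  assume ne: "pr z \<noteq> pr w"
  obtain X0 Y0 X1 Y1 where zw: "z = (X0, Y0)" "w = (X1, Y1)" by fastforce
  have "\<bar>X1 - X0\<bar> \<le> 0 + e" if "0 < e" for e
  proof -
    have "\<bar>X1 - X0\<bar> < min e (1/10)"
      using dinf_close_cases(1)[of "min e (1/10)" 0 X0 Y0 X1 Y1] assms that by (simp add: zw)
    then show ?thesis by simp
  qed
  then have X: "X1 = X0" using field_le_epsilon[of "\<bar>X1 - X0\<bar>" 0] by auto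
  then have Y: "\<bar>Y1 - Y0\<bar> > 0" using ne by (auto simp: zw)
  obtain n where n: "1 / \<bar>Y1 - Y0\<bar> < M ^ n" using real_arch_pow[of M "1 / \<bar>Y1 - Y0\<bar>"] M_ge by auto
  define x y0 y1 where "x = 4 ^ n * X0" and "y0 = M ^ n * Y0" and "y1 = M ^ n * Y1"
  have far: "1 < \<bar>y1 - y0\<bar>"
  proof -
    have "\<bar>y1 - y0\<bar> = M ^ n * \<bar>Y1 - Y0\<bar>" by (simp add: y0_def y1_def abs_mult flip: right_diff_distrib)
    then show ?thesis using n Y by (simp add: field_simps)
  qed
  have P: "pr z = pr (Phij L (int n) (x, y0))" "pr w = pr (Phij L (int n) (x, y1))"
    by (simp_all add: zw X Phij_eq x_def y0_def y1_def hs_nat V_nat power_one_over)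
  have cl: "\<bar>hgt (x, y1) - hgt (x, y0)\<bar> < 2 * e \<or>
      (\<exists>a k i l m. i \<in> {1,2,3} \<and> \<bar>real_of_int (gline a k i) - x\<bar> < e \<and> \<bar>m\<bar> \<le> 2 \<and>
        in_glued (2 * e) a i l (hgt (x, y0)) \<and> in_glued (4 * e) a i l (hgt (x, y1)) \<and>
        \<bar>hgt (x, y1) - (hgt (x, y0) + real_of_int m * M ^ a)\<bar> < 2 * e)" if "0 < e" "e \<le> 1/10" for e
    using assms that by (intro dinf_close_cases(2)[of e "int n" x y0 x y1]) (auto simp flip: P)
  have nt: "\<not> \<bar>hgt (x, y1) - hgt (x, y0)\<bar> < 2 * e" if "e \<le> 1/10" for e
    using that far hgt_dist[of x y1] hgt_dist[of x y0] by linarith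
  show False
  proof (cases "x \<in> \<int>")
    case False
    \<comment> \<open>With this tolerance no integer line lies in the window around
      \<open>x\<close>.\<close>
    define e where "e = min (1/10) (min (frac x) (1 - frac x))"
    have fr: "0 < frac x" "frac x < 1" using False frac_lt_1 by (auto simp: frac_gt_0_iff)
    have "e \<le> \<bar>real_of_int t - x\<bar>" for t
    proof (cases "t \<le> \<lfloor>x\<rfloor>")
      case True
      then have "real_of_int t \<le> \<lfloor>x\<rfloor>" by simp
      then show ?thesis unfolding e_def frac_def by linarith
    next
      case False
      then have "real_of_int t \<ge> \<lfloor>x\<rfloor> + 1" by linarith
      then show ?thesis unfolding e_def frac_def by linarith
    qed
    then have "\<not> \<bar>real_of_int t - x\<bar> < e" for t by (simp only: not_less)
    moreover have "0 < e" using fr by (simp add: e_def)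
    moreover have "e \<le> 1/10" unfolding e_def by (rule min.cobounded1)
    ultimately show False using cl[of e] nt[of e] by blast
  next
    case True
    then obtain N where N: "x = real_of_int N" by (auto elim: Ints_cases)
    have hx: "hgt (x, v) = v" for v unfolding N by (rule hgt_int)
    obtain a k i l m where *: "i \<in> {1,2,3}" "\<bar>real_of_int (gline a k i) - x\<bar> < 1/10"
        "in_glued (2 * (1/10)) a i l y0" "\<bar>y1 - (y0 + real_of_int m * M ^ a)\<bar> < 2 * (1/10)"
      using cl[of "1/10", OF _ order.refl] nt[of "1/10", OF order.refl] unfolding hx
      by (metis (no_types, lifting) divide_pos_pos zero_less_numeral zero_less_one)
    have "gline a k i = N" using *(2) unfolding N by linarith
    then have xg: "x = real_of_int (gline a k i)" using N by simp
    \<comment> \<open>By uniqueness, the line, span and shift found for tolerance 1/10 serve every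
      smaller one, which permits the limit.\<close>
    have all: "in_glued (2 * e) a i l y0 \<and> in_glued (4 * e) a i l y1 \<and> \<bar>y1 - (y0 + real_of_int m * M ^ a)\<bar> < 2 * e"
      if e: "0 < e" "e \<le> 1/10" for e
    proof -
      obtain a' k' i' l' m' where **: "i' \<in> {1,2,3}" "\<bar>real_of_int (gline a' k' i') - x\<bar> < e"
        "in_glued (2 * e) a' i' l' y0" "in_glued (4 * e) a' i' l' y1" "\<bar>y1 - (y0 + real_of_int m' * M ^ a')\<bar> < 2 * e"
        using cl[OF e] nt[OF e(2)] unfolding hx by blast
      have u: "a = a' \<and> k = k' \<and> i = i'"
        using *(1,2) **(1,2) e by (intro gline_near_unique[of i i' a k x "1/10"]) auto
      have l: "l = l'" using *(3) in_glued_mono[OF **(3), of "2 * (1/10)"] u e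
        by (intro in_glued_unique[of "1/10" a i l y0 l']) auto
      have "\<bar>real_of_int m * M ^ a - real_of_int m' * M ^ a\<bar> < 1"
        using *(4) **(5)[unfolded conjunct1[OF u, symmetric]] e by linarith
      then have l1: "\<bar>real_of_int (m - m')\<bar> * M ^ a < 1" by (simp add: abs_mult flip: left_diff_distrib)
      have "\<bar>real_of_int (m - m')\<bar> \<le> \<bar>real_of_int (m - m')\<bar> * M ^ a"
        using mult_left_mono[OF M_pow_ge1[of a], of "\<bar>real_of_int (m - m')\<bar>"] by simp
      then have "\<bar>real_of_int (m - m')\<bar> < 1" using l1 by (rule order.strict_trans1)
      then have "m = m'" by linarith
      then show ?thesis using ** u l by blast
    qed
    have y1: "y1 = y0 + real_of_int m * M ^ a"
    proof -
      have "\<bar>y1 - (y0 + real_of_int m * M ^ a)\<bar> \<le> 0 + e" if "0 < e" for e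
        using all[of "min (e/2) (1/10)", OF _ min.cobounded2] min.cobounded1[of "e/2" "1/10"] that by simp
      then show ?thesis using field_le_epsilon[of "\<bar>y1 - (y0 + real_of_int m * M ^ a)\<bar>" 0] by auto
    qed
    have "in_glued e a i l y0 \<and> in_glued e a i l y1" if "0 < e" for e
    proof -
      have "in_glued (2 * min (e/4) (1/10)) a i l y0" "in_glued (4 * min (e/4) (1/10)) a i l y1"
        using all[of "min (e/4) (1/10)", OF _ min.cobounded2] that by simp_all
      moreover have "2 * min (e/4) (1/10) \<le> e" "4 * min (e/4) (1/10) \<le> e"
        using min.cobounded1[of "e/4" "1/10"] that by linarith+
      ultimately show ?thesis by (blast intro: in_glued_mono)
    qed
    then have g: "in_glued 0 a i l y0" "in_glued 0 a i l y1" by (blast intro: in_glued_closed)+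
    have "pr (Phij L (int n) (x, y0)) = pr (Phij L (int n) (x, y1))"
    proof (cases "m \<ge> 0")
      case True
      then show ?thesis using glue_steps[OF *(1) g(1), of m "int n" k] g(2) unfolding xg y1 by blast
    next
      case False
      have y0: "y0 = y1 + real_of_int (- m) * M ^ a" using y1 by simp
      have "in_glued 0 a i l (y1 + real_of_int (- m) * M ^ a)" using g(1) y0 by simp
      from glue_steps[OF *(1) g(2) this, of "int n" k] False show ?thesis unfolding xg y0[symmetric] by simp
    qed
    then show False using ne P by simp
  qed
qed

end

section \<open>Curve families\<close>

lemma affine2_measurable [measurable]:
  "(\<lambda>z::pt. (x + c1 * fst z, y + c2 * snd z)) \<in> borel_measurable borel"
  by (intro borel_measurable_continuous_onI continuous_intros)

lemma fst_snd_borel [measurable]: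
  "(fst :: pt \<Rightarrow> real) \<in> borel_measurable borel" "(snd :: pt \<Rightarrow> real) \<in> borel_measurable borel"
  by (auto intro!: borel_measurable_continuous_onI continuous_intros)

lemma nn_integral_lborel_affine2:
  fixes f :: "pt \<Rightarrow> ennreal"
  assumes [measurable]: "f \<in> borel_measurable borel" and c: "c1 \<noteq> 0" "c2 \<noteq> 0"
  shows "(\<integral>\<^sup>+z. f z \<partial>lborel) = ennreal \<bar>c1 * c2\<bar> * (\<integral>\<^sup>+z. f (x + c1 * fst z, y + c2 * snd z) \<partial>lborel)"
proof -
  have B: "borel \<Otimes>\<^sub>M borel = (borel :: pt measure)" by (rule borel_prod)
  have f2: "f \<in> borel_measurable (lborel \<Otimes>\<^sub>M lborel)" by (simp add: lborel_prod)
  have g2: "(\<lambda>z. f (x + c1 * fst z, y + c2 * snd z)) \<in> borel_measurable (lborel \<Otimes>\<^sub>M lborel)"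
    unfolding lborel_prod using measurable_compose[OF affine2_measurable assms(1)] by simp
  have sec: "(\<lambda>v. f (s, v)) \<in> borel_measurable borel" for s by measurable
  have int: "(\<lambda>s. \<integral>\<^sup>+v. f (s, v) \<partial>lborel) \<in> borel_measurable borel"
    using lborel.borel_measurable_nn_integral_fst[OF f2] by simp
  have int2: "(\<lambda>t. \<integral>\<^sup>+w. f (x + c1 * t, y + c2 * w) \<partial>lborel) \<in> borel_measurable borel"
    using lborel.borel_measurable_nn_integral_fst[OF g2] by simp
  have "(\<integral>\<^sup>+z. f z \<partial>lborel) = (\<integral>\<^sup>+s. \<integral>\<^sup>+v. f (s, v) \<partial>lborel \<partial>lborel)"
    using lborel.nn_integral_fst[OF f2] by (simp add: lborel_prod)
  also have "\<dots> = ennreal \<bar>c1\<bar> * (\<integral>\<^sup>+t. \<integral>\<^sup>+v. f (x + c1 * t, v) \<partial>lborel \<partial>lborel)"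
    by (rule nn_integral_real_affine[OF int c(1)])
  also have "\<dots> = ennreal \<bar>c1\<bar> * (\<integral>\<^sup>+t. ennreal \<bar>c2\<bar> * (\<integral>\<^sup>+w. f (x + c1 * t, y + c2 * w) \<partial>lborel) \<partial>lborel)"
    by (subst nn_integral_real_affine[OF sec c(2), of _ y]) simp
  also have "\<dots> = ennreal \<bar>c1\<bar> * (ennreal \<bar>c2\<bar> * (\<integral>\<^sup>+t. \<integral>\<^sup>+w. f (x + c1 * t, y + c2 * w) \<partial>lborel \<partial>lborel))"
    using int2 by (subst nn_integral_cmult) auto
  also have "(\<integral>\<^sup>+t. \<integral>\<^sup>+w. f (x + c1 * t, y + c2 * w) \<partial>lborel \<partial>lborel) =
      (\<integral>\<^sup>+z. f (x + c1 * fst z, y + c2 * snd z) \<partial>lborel)"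
    using lborel.nn_integral_fst[OF g2] by (simp add: lborel_prod)
  finally show ?thesis by (simp add: abs_mult ennreal_mult mult.assoc)
qed

lemma emeasure_affine_vimage:
  assumes A: "A \<in> sets (borel :: pt measure)" and c: "c1 \<noteq> 0" "c2 \<noteq> 0"
  shows "emeasure lborel ((\<lambda>z. (x + c1 * fst z, y + c2 * snd z)) -` A) = ennreal (1 / \<bar>c1 * c2\<bar>) * emeasure lborel A"
proof -
  let ?h = "\<lambda>z::pt. (x + c1 * fst z, y + c2 * snd z)"
  have m: "?h \<in> borel_measurable borel" by (rule affine2_measurable)
  have s: "?h -` A \<in> sets lborel" using measurable_sets[OF m A] by simp
  have i: "indicator A (?h z) = (indicator (?h -` A) z :: ennreal)" for z by (simp split: split_indicator)
  have f: "(indicator A :: pt \<Rightarrow> ennreal) \<in> borel_measurable borel" using A by simp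
  have eq: "emeasure lborel A = ennreal \<bar>c1 * c2\<bar> * emeasure lborel (?h -` A)"
    using nn_integral_lborel_affine2[OF f c, of x y] A s unfolding i by simp
  have "ennreal (1 / k) * (ennreal k * E) = E" if "0 < k" for k :: real and E
    using that by (simp add: mult.assoc[symmetric] flip: ennreal_mult)
  from this[of "\<bar>c1 * c2\<bar>"] show ?thesis unfolding eq using c by simp
qed

context glued_plane begin

definition lip_on :: "(real \<Rightarrow> pt) \<Rightarrow> real \<Rightarrow> real \<Rightarrow> bool" where
  "lip_on f a b \<longleftrightarrow> (\<forall>s\<in>{a..b}. \<forall>t\<in>{a..b}. d (pr (f s)) (pr (f t)) \<le> 8 * \<bar>s - t\<bar>)"

lemma lip_on_cong: "lip_on f a b \<Longrightarrow> (\<And>t. a \<le> t \<Longrightarrow> t \<le> b \<Longrightarrow> pr (g t) = pr (f t)) \<Longrightarrow> lip_on g a b"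
  by (simp add: lip_on_def)

lemma lip_onI:
  assumes "\<And>s t. a \<le> s \<Longrightarrow> s \<le> t \<Longrightarrow> t \<le> b \<Longrightarrow> d (pr (f s)) (pr (f t)) \<le> 8 * (t - s)"
  shows "lip_on f a b"
  unfolding lip_on_def
proof (intro ballI)
  fix s t assume "s \<in> {a..b}" "t \<in> {a..b}"
  then show "d (pr (f s)) (pr (f t)) \<le> 8 * \<bar>s - t\<bar>"
    using assms[of s t] assms[of t s] dinf_sym[of "f s" "f t"] by (cases "s \<le> t") auto
qed

lemma lip_onD: "lip_on f a b \<Longrightarrow> a \<le> s \<Longrightarrow> s \<le> t \<Longrightarrow> t \<le> b \<Longrightarrow> d (pr (f s)) (pr (f t)) \<le> 8 * (t - s)"
proof -
  assume "lip_on f a b" "a \<le> s" "s \<le> t" "t \<le> b"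
  then have "d (pr (f s)) (pr (f t)) \<le> 8 * \<bar>s - t\<bar>" "\<bar>s - t\<bar> = t - s"
    unfolding lip_on_def by (metis atLeastAtMost_iff order.trans, simp)
  then show ?thesis by simp
qed

lemma lip_on_concat:
  assumes "lip_on f a b" "lip_on f b c" shows "lip_on f a c"
proof (rule lip_onI)
  fix s t assume st: "a \<le> s" "s \<le> t" "t \<le> c"
  consider "t \<le> b" | "b \<le> s" | "s \<le> b" "b \<le> t" by linarith
  then show "d (pr (f s)) (pr (f t)) \<le> 8 * (t - s)"
  proof cases
    case 3
    then show ?thesis using lip_onD[OF assms(1), of s b] lip_onD[OF assms(2), of b t] st
        dinf_triangle[of "f s" "f t" "f b"] by argo
  qed (use st lip_onD[OF assms(1)] lip_onD[OF assms(2)] in auto)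
qed

lemma lip_on_shift: "lip_on f a b \<Longrightarrow> lip_on (\<lambda>t. f (t - c)) (a + c) (b + c)"
proof (rule lip_onI)
  fix s t assume "lip_on f a b" "a + c \<le> s" "s \<le> t" "t \<le> b + c"
  then show "d (pr (f (s - c))) (pr (f (t - c))) \<le> 8 * (t - s)" using lip_onD[of f a b "s - c" "t - c"] by simp
qed

lemma lip_on_rev: "lip_on f a b \<Longrightarrow> lip_on (\<lambda>t. f (c - t)) (c - b) (c - a)"
proof (rule lip_onI)
  fix s t assume "lip_on f a b" "c - b \<le> s" "s \<le> t" "t \<le> c - a"
  then show "d (pr (f (c - s))) (pr (f (c - t))) \<le> 8 * (t - s)"
    using lip_onD[of f a b "c - t" "c - s"] dinf_sym[of "f (c - s)" "f (c - t)"] by simp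
qed

text \<open>
  A family is a planar map \<open>g\<close> of time and of a uniform parameter \<open>w \<in> [0, 1)\<close>; only its image in the
  quotient is continuous, since \<open>g\<close> jumps at glued points. Its occupation measure is bounded by the density \<open>\<rho>\<close>.
\<close>
abbreviation occ :: "(pt \<Rightarrow> pt) \<Rightarrow> real \<Rightarrow> pt set \<Rightarrow> pt set" where
  "occ g T A \<equiv> ({0..T} \<times> {0..<1}) \<inter> g -` A"

definition fam_of :: "(pt \<Rightarrow> pt) \<Rightarrow> (real \<Rightarrow> xpt) \<Rightarrow> (real \<Rightarrow> xpt) \<Rightarrow> real \<Rightarrow> (pt \<Rightarrow> ennreal) \<Rightarrow> bool" where
  "fam_of g \<sigma> \<tau> T \<rho> \<longleftrightarrow> g \<in> borel_measurable borel \<and>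
     (\<forall>w\<in>{0..<1}. pr (g (0, w)) = \<sigma> w \<and> pr (g (T, w)) = \<tau> w \<and> lip_on (\<lambda>t. g (t, w)) 0 T) \<and>
     (\<forall>A\<in>sets borel. emeasure lborel (occ g T A) \<le> (\<integral>\<^sup>+z. \<rho> z * indicator A z \<partial>lborel))"

lemma fam_ofD:
  assumes "fam_of g \<sigma> \<tau> T \<rho>"
  shows "g \<in> borel_measurable borel"
    and "0 \<le> w \<Longrightarrow> w < 1 \<Longrightarrow> pr (g (0, w)) = \<sigma> w"
    and "0 \<le> w \<Longrightarrow> w < 1 \<Longrightarrow> pr (g (T, w)) = \<tau> w"
    and "0 \<le> w \<Longrightarrow> w < 1 \<Longrightarrow> lip_on (\<lambda>t. g (t, w)) 0 T"
    and "A \<in> sets borel \<Longrightarrow> emeasure lborel (occ g T A) \<le> (\<integral>\<^sup>+z. \<rho> z * indicator A z \<partial>lborel)"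
  using assms unfolding fam_of_def by simp_all

definition fam :: "(real \<Rightarrow> xpt) \<Rightarrow> (real \<Rightarrow> xpt) \<Rightarrow> real \<Rightarrow> (pt \<Rightarrow> ennreal) \<Rightarrow> bool" where
  "fam \<sigma> \<tau> T \<rho> \<longleftrightarrow> 0 \<le> T \<and> \<rho> \<in> borel_measurable borel \<and> (\<exists>g. fam_of g \<sigma> \<tau> T \<rho>)"

lemma famD: "fam \<sigma> \<tau> T \<rho> \<Longrightarrow> 0 \<le> T" "fam \<sigma> \<tau> T \<rho> \<Longrightarrow> \<rho> \<in> borel_measurable borel"
  by (auto simp: fam_def)

lemma occ_sets:
  assumes "g \<in> borel_measurable borel" "A \<in> sets borel" shows "occ g T A \<in> sets (borel :: pt measure)"
proof -
  have "{0..T} \<times> {0..<1} \<in> sets (borel \<Otimes>\<^sub>M (borel :: real measure))" by (intro pair_measureI) auto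
  moreover have "g -` A \<in> sets borel" using measurable_sets[OF assms] by simp
  ultimately show ?thesis unfolding borel_prod by blast
qed

lemma fam_weaken:
  assumes "fam \<sigma> \<tau> T \<rho>" "\<And>z. \<rho> z \<le> \<rho>' z" "\<rho>' \<in> borel_measurable borel"
    "\<And>w. 0 \<le> w \<Longrightarrow> w < 1 \<Longrightarrow> \<sigma> w = \<sigma>' w" "\<And>w. 0 \<le> w \<Longrightarrow> w < 1 \<Longrightarrow> \<tau> w = \<tau>' w"
  shows "fam \<sigma>' \<tau>' T \<rho>'"
proof -
  obtain g where g: "fam_of g \<sigma> \<tau> T \<rho>" using assms(1) by (auto simp: fam_def)
  have "(\<integral>\<^sup>+z. \<rho> z * indicator A z \<partial>lborel) \<le> (\<integral>\<^sup>+z. \<rho>' z * indicator A z \<partial>lborel)" for A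
    using assms(2) by (intro nn_integral_mono mult_right_mono) auto
  then have "fam_of g \<sigma>' \<tau>' T \<rho>'" using g assms(4,5) unfolding fam_of_def
    by (auto intro: order.trans)
  then show ?thesis using assms(1,3) by (auto simp: fam_def)
qed

text \<open>Time moves the abscissa at unit speed and \<open>w\<close> spreads the ordinate over a
  height \<open>v\<close>, so the planar map has Jacobian \<open>v\<close>. For
  \<open>x = x'\<close> it degenerates, but then the time interval is null.\<close>

lemma fam_straight:
  assumes v: "0 < v"
  shows "fam (\<lambda>w. pr (x, (b + w) * v)) (\<lambda>w. pr (x', (b + w) * v)) \<bar>x' - x\<bar> (\<lambda>_. ennreal (1 / v))"
proof -
  define g where "g z = (x + sgn (x' - x) * fst z, b * v + v * snd z)" for z :: pt
  have gm: "g \<in> borel_measurable borel" unfolding g_def by (rule affine2_measurable)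
  have o: "emeasure lborel (occ g \<bar>x' - x\<bar> A) \<le> (\<integral>\<^sup>+z. ennreal (1 / v) * indicator A z \<partial>lborel)" if A: "A \<in> sets borel" for A
  proof (cases "x = x'")
    case True
    have "emeasure lborel (occ g \<bar>x' - x\<bar> A) \<le> emeasure lborel ({0..0::real} \<times> {0..1::real})"
      using True by (intro emeasure_mono) (auto intro!: borel_closed closed_Times)
    also have "\<dots> = 0" by (subst emeasure_lborel_rect) auto
    finally show ?thesis by simp
  next
    case False
    have "emeasure lborel (occ g \<bar>x' - x\<bar> A) \<le> emeasure lborel (g -` A)"
      using measurable_sets[OF gm A] by (intro emeasure_mono) auto
    also have "\<dots> = ennreal (1 / v) * emeasure lborel A"
      unfolding g_def using v False by (subst emeasure_affine_vimage[OF A]) (auto simp: abs_mult abs_sgn_eq sgn_zero_iff)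
    also have "\<dots> = (\<integral>\<^sup>+z. ennreal (1 / v) * indicator A z \<partial>lborel)"
      using A by (simp add: nn_integral_cmult_indicator)
    finally show ?thesis .
  qed
  have "lip_on (\<lambda>t. g (t, w)) 0 \<bar>x' - x\<bar>" for w
  proof (rule lip_onI)
    fix s t assume "s \<le> (t::real)"
    have "d (pr (g (s, w))) (pr (g (t, w))) \<le> 8 * \<bar>sgn (x' - x) * s - sgn (x' - x) * t\<bar>"
      using dinf_horizontal[of "x + sgn (x' - x) * s" "b * v + v * w" "x + sgn (x' - x) * t"]
      unfolding g_def fst_conv snd_conv by simp
    also have "\<bar>sgn (x' - x) * s - sgn (x' - x) * t\<bar> = \<bar>sgn (x' - x)\<bar> * (t - s)"
      using \<open>s \<le> t\<close> by (simp add: abs_mult flip: right_diff_distrib)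
    also have "\<dots> \<le> 1 * (t - s)" using \<open>s \<le> t\<close> by (intro mult_right_mono) (auto simp: abs_sgn_eq)
    finally show "d (pr (g (s, w))) (pr (g (t, w))) \<le> 8 * (t - s)" by simp
  qed
  moreover have "sgn (x' - x) * \<bar>x' - x\<bar> = x' - x" by (simp add: sgn_mult_abs)
  ultimately have "fam_of g (\<lambda>w. pr (x, (b + w) * v)) (\<lambda>w. pr (x', (b + w) * v)) \<bar>x' - x\<bar> (\<lambda>_. ennreal (1 / v))"
    unfolding fam_of_def using gm o by (auto simp: g_def algebra_simps)
  then show ?thesis by (auto simp: fam_def)
qed

lemma fam_rev:
  assumes "fam \<sigma> \<tau> T \<rho>" shows "fam \<tau> \<sigma> T \<rho>"
proof -
  obtain g where g: "fam_of g \<sigma> \<tau> T \<rho>" using assms by (auto simp: fam_def)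
  then have [measurable]: "g \<in> borel_measurable borel" by (simp add: fam_of_def)
  define r where "r z = (T + (-1) * fst z, 0 + 1 * snd z)" for z :: pt
  have rm: "r \<in> borel_measurable borel" unfolding r_def by (rule affine2_measurable)
  have "emeasure lborel (occ (g \<circ> r) T A) \<le> (\<integral>\<^sup>+z. \<rho> z * indicator A z \<partial>lborel)" if A: "A \<in> sets borel" for A
  proof -
    have "occ (g \<circ> r) T A = r -` occ g T A" by (auto simp: r_def)
    also have "emeasure lborel \<dots> = emeasure lborel (occ g T A)"
      unfolding r_def using occ_sets[of g A T] A by (subst emeasure_affine_vimage) auto
    finally show ?thesis using fam_ofD(5)[OF g A] by simp
  qed
  moreover have "lip_on (\<lambda>t. (g \<circ> r) (t, w)) 0 T" if "w \<in> {0..<1}" for w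
    using lip_on_rev[OF fam_ofD(4)[OF g, of w], of T] that by (simp add: r_def)
  ultimately have "fam_of (g \<circ> r) \<tau> \<sigma> T \<rho>"
    using g measurable_comp[OF rm, of g borel] unfolding fam_of_def by (auto simp: r_def)
  then show ?thesis using assms by (auto simp: fam_def)
qed

text \<open>At the joint the planar maps agree only after projection, which suffices because the
  Lipschitz bound lives in the quotient.\<close>

lemma fam_concat:
  assumes f: "fam \<sigma> \<tau> T1 \<rho>1" and h: "fam \<tau> \<upsilon> T2 \<rho>2"
  shows "fam \<sigma> \<upsilon> (T1 + T2) (\<lambda>z. \<rho>1 z + \<rho>2 z)"
proof -
  obtain g1 where g1: "fam_of g1 \<sigma> \<tau> T1 \<rho>1" using f by (auto simp: fam_def)
  obtain g2 where g2: "fam_of g2 \<tau> \<upsilon> T2 \<rho>2" using h by (auto simp: fam_def)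
  note [measurable] = famD(2)[OF f] famD(2)[OF h]
  have [measurable]: "g1 \<in> borel_measurable borel" "g2 \<in> borel_measurable borel"
    using g1 g2 by (auto simp: fam_of_def)
  have T: "0 \<le> T1" "0 \<le> T2" using f h famD by auto
  define r where "r z = (- T1 + 1 * fst z, 0 + 1 * snd z)" for z :: pt
  have rm [measurable]: "r \<in> borel_measurable borel" unfolding r_def by (rule affine2_measurable)
  define g where "g z = (if fst z < T1 then g1 z else g2 (r z))" for z
  have gm: "g \<in> borel_measurable borel" unfolding g_def by measurable
  have o: "emeasure lborel (occ g (T1 + T2) A) \<le> (\<integral>\<^sup>+z. (\<rho>1 z + \<rho>2 z) * indicator A z \<partial>lborel)" if A [measurable]: "A \<in> sets borel" for A
  proof -
    have s: "occ g1 T1 A \<in> sets borel" "occ g2 T2 A \<in> sets borel" by (intro occ_sets; simp)+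
    have s': "r -` occ g2 T2 A \<in> sets borel" using measurable_sets[OF rm s(2)] by simp
    have "occ g (T1 + T2) A \<subseteq> occ g1 T1 A \<union> r -` occ g2 T2 A" by (auto simp: g_def r_def split: if_splits)
    then have "emeasure lborel (occ g (T1 + T2) A) \<le> emeasure lborel (occ g1 T1 A \<union> r -` occ g2 T2 A)"
      using s s' by (intro emeasure_mono) (simp_all only: sets.Un sets_lborel)
    also have "\<dots> \<le> emeasure lborel (occ g1 T1 A) + emeasure lborel (r -` occ g2 T2 A)"
      using s s' by (intro emeasure_subadditive) (simp_all only: sets_lborel)
    also have "emeasure lborel (r -` occ g2 T2 A) = emeasure lborel (occ g2 T2 A)"
      unfolding r_def using s(2) by (subst emeasure_affine_vimage) auto
    also have "emeasure lborel (occ g1 T1 A) + emeasure lborel (occ g2 T2 A) \<le>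
       (\<integral>\<^sup>+z. \<rho>1 z * indicator A z \<partial>lborel) + (\<integral>\<^sup>+z. \<rho>2 z * indicator A z \<partial>lborel)"
      by (intro add_mono fam_ofD(5)[OF g1 A] fam_ofD(5)[OF g2 A])
    also have "\<dots> = (\<integral>\<^sup>+z. (\<rho>1 z + \<rho>2 z) * indicator A z \<partial>lborel)"
      by (subst nn_integral_add[symmetric]) (auto simp: distrib_right)
    finally show ?thesis .
  qed
  have "pr (g (0, w)) = \<sigma> w \<and> pr (g (T1 + T2, w)) = \<upsilon> w \<and> lip_on (\<lambda>t. g (t, w)) 0 (T1 + T2)" if w: "w \<in> {0..<1}" for w
  proof -
    have e: "pr (g1 (0, w)) = \<sigma> w" "pr (g1 (T1, w)) = \<tau> w" "pr (g2 (0, w)) = \<tau> w" "pr (g2 (T2, w)) = \<upsilon> w"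
      "lip_on (\<lambda>t. g1 (t, w)) 0 T1" "lip_on (\<lambda>t. g2 (t, w)) 0 T2"
      using fam_ofD[OF g1] fam_ofD[OF g2] w by simp_all
    have a: "pr (g (t, w)) = pr (g1 (t, w))" if "t \<le> T1" for t
      using e(2,3) that by (cases "t = T1") (auto simp: g_def r_def)
    have b: "g (t, w) = g2 (t - T1, w)" if "T1 \<le> t" for t using that by (auto simp: g_def r_def)
    have "lip_on (\<lambda>t. g (t, w)) 0 T1" using lip_on_cong[OF e(5)] a by simp
    moreover have "lip_on (\<lambda>t. g (t, w)) T1 (T1 + T2)"
      using lip_on_cong[OF lip_on_shift[OF e(6), of T1], of "\<lambda>t. g (t, w)"] b by (simp add: add.commute)
    ultimately have "lip_on (\<lambda>t. g (t, w)) 0 (T1 + T2)" by (rule lip_on_concat)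
    then show ?thesis using a[OF T(1)] b[of "T1 + T2"] e(1,4) T by simp
  qed
  then have "fam_of g \<sigma> \<upsilon> (T1 + T2) (\<lambda>z. \<rho>1 z + \<rho>2 z)" using gm o unfolding fam_of_def by auto
  then show ?thesis using T unfolding fam_def by (auto intro!: exI[of _ g])
qed

text \<open>The speed bound 8 keeps the curves in a ball, so the density can be cut off outside it.
  This turns the uniform density of each stage into one that can be compared with the Riesz
  potential.\<close>

lemma fam_local:
  assumes f: "fam \<sigma> \<tau> T \<rho>" and r: "\<And>w. 0 \<le> w \<Longrightarrow> w < 1 \<Longrightarrow> d (pr p) (\<sigma> w) \<le> r"
  shows "fam \<sigma> \<tau> T (\<lambda>z. \<rho> z * indicator {z. d (pr p) (pr z) \<le> r + 8 * T} z)"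
proof -
  obtain g where g: "fam_of g \<sigma> \<tau> T \<rho>" using f by (auto simp: fam_def)
  note [measurable] = famD(2)[OF f]
  let ?N = "{z. d (pr p) (pr z) \<le> r + 8 * T}"
  have N [measurable]: "?N \<in> sets borel"
  proof -
    have "(\<lambda>z. d (pr p) (pr z)) \<in> borel_measurable borel" by measurable
    from borel_measurable_le[OF this borel_measurable_const] show ?thesis by simp
  qed
  have o: "emeasure lborel (occ g T A) \<le> (\<integral>\<^sup>+z. \<rho> z * indicator ?N z * indicator A z \<partial>lborel)" if A [measurable]: "A \<in> sets borel" for A
  proof -
    have "g (t, w) \<in> ?N" if "t \<in> {0..T}" "w \<in> {0..<1}" for t w
    proof -
      have "pr (g (0, w)) = \<sigma> w" "d (pr (g (0, w))) (pr (g (t, w))) \<le> 8 * (t - 0)"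
        using fam_ofD(2,4)[OF g, of w] that lip_onD[of "\<lambda>t. g (t, w)" 0 T 0 t] by simp_all
      then show ?thesis using r[of w] dinf_triangle[of p "g (t, w)" "g (0, w)"] that by auto
    qed
    then have "g z \<in> ?N" if "z \<in> {0..T} \<times> {0..<1}" for z using that by (cases z) blast
    then have "occ g T A = occ g T (?N \<inter> A)" by blast
    also have "emeasure lborel \<dots> \<le> (\<integral>\<^sup>+z. \<rho> z * indicator (?N \<inter> A) z \<partial>lborel)"
      by (rule fam_ofD(5)[OF g sets.Int[OF N A]])
    finally show ?thesis by (simp add: indicator_inter_arith mult.assoc)
  qed
  have "fam_of g \<sigma> \<tau> T (\<lambda>z. \<rho> z * indicator ?N z)" using g o unfolding fam_of_def by auto
  then show ?thesis using famD(1)[OF f] unfolding fam_def by (auto intro!: exI[of _ g])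
qed

text \<open>
  For uniform \<open>w\<close> the digit \<open>\<lfloor>m w\<rfloor>\<close> and the remainder \<open>frac (m w)\<close> are independent and uniform, so the
  occupation measure is the average of those of the \<open>m\<close> families and no factor is lost.
\<close>
lemma fam_digit:
  fixes m :: nat
  assumes m: "0 < m" and F: "\<And>j. j < m \<Longrightarrow> fam (\<sigma> j) (\<tau> j) T \<rho>"
  shows "fam (\<lambda>w. \<sigma> (nat \<lfloor>m * w\<rfloor>) (frac (m * w))) (\<lambda>w. \<tau> (nat \<lfloor>m * w\<rfloor>) (frac (m * w))) T \<rho>"
proof -
  \<comment> \<open>The constant map for \<open>j \<ge> m\<close> keeps every \<open>G j\<close>
    measurable, as the selection over a countable index requires.\<close>
  define G where "G j = (if j < m then SOME g. fam_of g (\<sigma> j) (\<tau> j) T \<rho> else (\<lambda>_. (0, 0)))" for j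
  have G: "fam_of (G j) (\<sigma> j) (\<tau> j) T \<rho>" if "j < m" for j
    using someI_ex[of "\<lambda>g. fam_of g (\<sigma> j) (\<tau> j) T \<rho>"] F[OF that] that by (simp add: fam_def G_def)
  have [measurable]: "G j \<in> borel_measurable borel" for j
    using fam_ofD(1)[OF G] by (cases "j < m") (auto simp: G_def)
  define r where "r j z = (0 + 1 * fst z, - real j + real m * snd z)" for j and z :: pt
  have rm [measurable]: "r j \<in> borel_measurable borel" for j unfolding r_def by (rule affine2_measurable)
  define J where "J z = nat \<lfloor>real m * snd z\<rfloor>" for z :: pt
  have J [measurable]: "J \<in> borel \<rightarrow>\<^sub>M count_space UNIV" unfolding J_def by measurable
  define g where "g z = G (J z) (r (J z) z)" for z
  have gm: "g \<in> borel_measurable borel" unfolding g_def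
    by (rule measurable_compose_countable[OF _ J]) measurable
  have Jw: "J (t, w) < m \<and> g (t, w) = G (J (t, w)) (t, frac (m * w))
       \<and> r (J (t, w)) (t, w) = (t, frac (m * w))" if w: "0 \<le> w" "w < 1" for t w :: real
  proof -
    have 1: "0 \<le> m * w" "m * w < m" using w m by auto
    then have "\<lfloor>m * w\<rfloor> < int m" by (simp add: floor_less_iff)
    moreover have "real (J (t, w)) = \<lfloor>m * w\<rfloor>" using 1 by (simp add: J_def)
    ultimately show ?thesis using m by (auto simp: J_def g_def r_def frac_def nat_less_iff)
  qed
  have o: "emeasure lborel (occ g T A) \<le> (\<integral>\<^sup>+z. \<rho> z * indicator A z \<partial>lborel)" (is "_ \<le> ?R") if A [measurable]: "A \<in> sets borel" for A
  proof -
    have s: "occ (G j) T A \<in> sets borel" for j by (intro occ_sets; simp)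
    have s': "r j -` occ (G j) T A \<in> sets borel" for j using measurable_sets[OF rm s] by simp
    have "occ g T A \<subseteq> (\<Union>j<m. r j -` occ (G j) T A)"
    proof
      fix z assume z: "z \<in> occ g T A"
      obtain t w where tw: "z = (t, w)" by fastforce
      show "z \<in> (\<Union>j<m. r j -` occ (G j) T A)"
        using z Jw[of w t] by (intro UN_I[of "J z"]) (auto simp: tw frac_lt_1)
    qed
    then have "emeasure lborel (occ g T A) \<le> emeasure lborel (\<Union>j<m. r j -` occ (G j) T A)"
      using s' by (intro emeasure_mono) auto
    also have "\<dots> \<le> (\<Sum>j<m. emeasure lborel (r j -` occ (G j) T A))"
      using s' by (intro emeasure_subadditive_finite) auto
    also have "\<dots> \<le> (\<Sum>j<m. ennreal (1 / m) * ?R)"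
    proof (rule sum_mono)
      fix j assume "j \<in> {..<m}"
      then have "emeasure lborel (occ (G j) T A) \<le> ?R" using fam_ofD(5)[OF G A] by simp
      moreover have "emeasure lborel (r j -` occ (G j) T A) = ennreal (1 / m) * emeasure lborel (occ (G j) T A)"
        unfolding r_def using s[of j] m by (subst emeasure_affine_vimage) auto
      ultimately show "emeasure lborel (r j -` occ (G j) T A) \<le> ennreal (1 / m) * ?R"
        by (simp add: mult_left_mono)
    qed
    also have "\<dots> = (ennreal m * ennreal (1 / m)) * ?R"
      by (simp only: sum_constant card_lessThan ennreal_of_nat_eq_real_of_nat mult.assoc)
    also have "ennreal m * ennreal (1 / m) = 1" using m by (simp flip: ennreal_mult')
    also have "1 * ?R = ?R" by simp
    finally show ?thesis .
  qed
  have "pr (g (0, w)) = \<sigma> (nat \<lfloor>m * w\<rfloor>) (frac (m * w)) \<and> pr (g (T, w)) = \<tau> (nat \<lfloor>m * w\<rfloor>) (frac (m * w)) \<and>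
      lip_on (\<lambda>t. g (t, w)) 0 T" if w: "0 \<le> w" "w < 1" for w :: real
  proof -
    have j: "J (t, w) = nat \<lfloor>m * w\<rfloor>" for t by (simp add: J_def)
    have "nat \<lfloor>m * w\<rfloor> < m" "g (t, w) = G (nat \<lfloor>m * w\<rfloor>) (t, frac (m * w))" for t using Jw[OF w, of t] j by auto
    then show ?thesis using G[of "nat \<lfloor>m * w\<rfloor>"] frac_lt_1[of "m * w"] fam_ofD(2-4)[OF G, of "nat \<lfloor>m * w\<rfloor>" "frac (m * w)"] by simp
  qed
  then have "fam_of g (\<lambda>w. \<sigma> (nat \<lfloor>m * w\<rfloor>) (frac (m * w))) (\<lambda>w. \<tau> (nat \<lfloor>m * w\<rfloor>) (frac (m * w))) T \<rho>"
    using gm o unfolding fam_of_def by auto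
  then show ?thesis using F[OF m] unfolding fam_def by auto
qed


lemma fam_infinite:
  fixes T :: "nat \<Rightarrow> real"
  assumes F: "\<And>k. fam (\<sigma> k) (\<sigma> (Suc k)) (T k) (\<rho> k)"
    and T: "\<And>k. 0 < T k" "summable T"
    and p: "\<And>w. 0 \<le> w \<Longrightarrow> w < 1 \<Longrightarrow> (\<lambda>k. d (\<sigma> k w) (pr p)) \<longlonglongrightarrow> 0"
  shows "fam (\<sigma> 0) (\<lambda>_. pr p) (suminf T) (\<lambda>z. \<Sum>k. \<rho> k z)"
proof -
  have "\<forall>k. \<exists>g. fam_of g (\<sigma> k) (\<sigma> (Suc k)) (T k) (\<rho> k)" using F unfolding fam_def by blast
  then obtain G where G: "\<And>k. fam_of (G k) (\<sigma> k) (\<sigma> (Suc k)) (T k) (\<rho> k)" by metis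
  have Gm [measurable]: "G k \<in> borel_measurable borel" for k by (rule fam_ofD(1)[OF G])
  have \<rho>m [measurable]: "\<rho> k \<in> borel_measurable borel" for k by (rule famD(2)[OF F])
  define t where "t k = sum T {..<k}" for k
  define S where "S = suminf T"
  have t0: "t 0 = 0" and tS: "t (Suc k) = t k + T k" for k by (simp_all add: t_def)
  have tl: "t k < t (Suc k)" for k using T(1) by (simp add: tS)
  have tmono: "i \<le> j \<Longrightarrow> t i \<le> t j" for i j by (rule lift_Suc_mono_le[of t]) (use tl less_imp_le in blast)
  have tlS: "t k < S" for k
  proof -
    have "t (Suc k) \<le> S" unfolding t_def S_def using T by (intro sum_le_suminf) (auto intro: less_imp_le)
    then show ?thesis using tl[of k] by simp
  qed
  have tlim: "t \<longlonglongrightarrow> S" unfolding t_def S_def using summable_LIMSEQ[OF T(2)] .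
  have S0: "0 < S" using tlS[of 0] t0 by simp
  define K where "K s = (LEAST k. s < t (Suc k))" for s
  have K_eq: "K s = k" if "t k \<le> s" "s < t (Suc k)" for s k
    unfolding K_def
  proof (rule Least_equality)
    show "s < t (Suc k)" by (rule that(2))
    fix j assume j: "s < t (Suc j)"
    show "k \<le> j"
    proof (rule ccontr)
      assume "\<not> k \<le> j"
      then show False using tmono[of "Suc j" k] that j by simp
    qed
  qed
  have K_ex: "\<exists>k. t k \<le> s \<and> s < t (Suc k)" if "0 \<le> s" "s < S" for s
  proof -
    have "\<forall>\<^sub>F k in sequentially. s < t k" using order_tendstoD(1)[OF tlim that(2)] .
    then obtain k where "s < t k" by (auto simp: eventually_sequentially)
    then have ex: "s < t (Suc k)" using tl[of k] by simp
    have 1: "s < t (Suc (K s))" unfolding K_def by (rule LeastI[of "\<lambda>k. s < t (Suc k)", OF ex])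
    have "t (K s) \<le> s"
    proof (cases "K s")
      case (Suc j)
      then have "\<not> s < t (Suc j)" using not_less_Least[of j "\<lambda>k. s < t (Suc k)"] unfolding K_def by simp
      then show ?thesis using Suc by simp
    qed (use t0 that in simp)
    then show ?thesis using 1 by blast
  qed
  define r where "r k z = (- t k + 1 * fst z, 0 + 1 * snd z)" for k and z :: pt
  have rm [measurable]: "r k \<in> borel_measurable borel" for k unfolding r_def by (rule affine2_measurable)
  define g where "g z = (if fst z < S then G (K (fst z)) (r (K (fst z)) z) else p)" for z
  have Km: "(\<lambda>z::pt. K (fst z)) \<in> borel \<rightarrow>\<^sub>M count_space UNIV" unfolding K_def by measurable
  have "(\<lambda>z. G (K (fst z)) (r (K (fst z)) z)) \<in> borel_measurable borel"
    by (rule measurable_compose_countable[OF _ Km]) measurable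
  then have gm [measurable]: "g \<in> borel_measurable borel" unfolding g_def by measurable
  have a: "g (s, w) = G k (s - t k, w)" if "t k \<le> s" "s < t (Suc k)" for s k w
  proof -
    have "s < S" using that(2) tlS[of "Suc k"] by simp
    then show ?thesis using K_eq[OF that] by (simp add: g_def r_def)
  qed
  have o: "emeasure lborel (occ g S A) \<le> (\<integral>\<^sup>+z. (\<Sum>k. \<rho> k z) * indicator A z \<partial>lborel)" if A [measurable]: "A \<in> sets borel" for A
  proof -
    have s: "occ (G k) (T k) A \<in> sets borel" for k by (intro occ_sets; simp)
    have s': "r k -` occ (G k) (T k) A \<in> sets borel" for k using measurable_sets[OF rm s] by simp
    have UN: "(\<Union>k. r k -` occ (G k) (T k) A) \<in> sets borel" using s' by (intro sets.countable_UN) blast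
    \<comment> \<open>The final instant belongs to no stage; it is a null set.\<close>
    let ?N = "{S..S} \<times> {0..1::real}"
    have N: "?N \<in> sets borel" by (intro borel_closed closed_Times) auto
    have "occ g S A \<subseteq> ?N \<union> (\<Union>k. r k -` occ (G k) (T k) A)"
    proof
      fix z assume z: "z \<in> occ g S A"
      obtain u w where uw: "z = (u, w)" by fastforce
      show "z \<in> ?N \<union> (\<Union>k. r k -` occ (G k) (T k) A)"
      proof (cases "u < S")
        case True
        then obtain k where k: "t k \<le> u" "u < t (Suc k)" using K_ex[of u] z uw by auto
        then have "z \<in> r k -` occ (G k) (T k) A" using z a[OF k, of w] tS[of k] by (simp add: uw r_def)
        then show ?thesis by (intro UnI2 UN_I[of k]) simp_all
      next
        case False
        then have "u = S" "0 \<le> w" "w \<le> 1" using z uw by simp_all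
        then have "z \<in> ?N" unfolding uw by simp
        then show ?thesis by (rule UnI1)
      qed
    qed
    then have "emeasure lborel (occ g S A) \<le> emeasure lborel (?N \<union> (\<Union>k. r k -` occ (G k) (T k) A))"
      by (rule emeasure_mono) (simp only: sets_lborel sets.Un[OF N UN])
    also have "\<dots> \<le> emeasure lborel ?N + emeasure lborel (\<Union>k. r k -` occ (G k) (T k) A)"
      by (rule emeasure_subadditive) (simp_all only: sets_lborel N UN)
    also have "emeasure lborel ?N = 0" by (subst emeasure_lborel_rect) auto
    also have "0 + emeasure lborel (\<Union>k. r k -` occ (G k) (T k) A) \<le> (\<Sum>k. emeasure lborel (r k -` occ (G k) (T k) A))"
      unfolding add_0_left using s' by (intro emeasure_subadditive_countably) (simp only: sets_lborel image_subset_iff, blast)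
    also have "\<dots> \<le> (\<Sum>k. \<integral>\<^sup>+z. \<rho> k z * indicator A z \<partial>lborel)"
    proof (intro suminf_le summableI)
      fix k
      have "emeasure lborel (r k -` occ (G k) (T k) A) = emeasure lborel (occ (G k) (T k) A)"
        unfolding r_def using s[of k] by (subst emeasure_affine_vimage) auto
      then show "emeasure lborel (r k -` occ (G k) (T k) A) \<le> (\<integral>\<^sup>+z. \<rho> k z * indicator A z \<partial>lborel)"
        using fam_ofD(5)[OF G A] by simp
    qed
    also have "\<dots> = (\<integral>\<^sup>+z. (\<Sum>k. \<rho> k z * indicator A z) \<partial>lborel)"
      by (intro nn_integral_suminf[symmetric]) measurable
    also have "\<dots> = (\<integral>\<^sup>+z. (\<Sum>k. \<rho> k z) * indicator A z \<partial>lborel)" by simp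
    finally show ?thesis .
  qed
  have "pr (g (0, w)) = \<sigma> 0 w \<and> pr (g (S, w)) = pr p \<and> lip_on (\<lambda>s. g (s, w)) 0 S" if w: "0 \<le> w" "w < 1" for w
  proof -
    note Gw = fam_ofD(2-4)[OF G w]
    have st: "pr (g (t k, w)) = \<sigma> k w" for k using a[of k "t k" w] tl[of k] Gw(1)[of k] by simp
    have b: "pr (g (s, w)) = pr (G k (s - t k, w))" if "t k \<le> s" "s \<le> t (Suc k)" for s k
    proof (cases "s = t (Suc k)")
      case True
      then show ?thesis using st[of "Suc k"] Gw(2)[of k] by (simp add: tS)
    qed (use a[of k s w] that in simp)
    have lk: "lip_on (\<lambda>s. g (s, w)) 0 (t k)" for k
    proof (induction k)
      case 0
      show ?case by (simp add: t0 lip_on_def)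
    next
      case (Suc k)
      have "lip_on (\<lambda>s. G k (s - t k, w)) (0 + t k) (T k + t k)" by (rule lip_on_shift[OF Gw(3)])
      then have "lip_on (\<lambda>s. G k (s - t k, w)) (t k) (t (Suc k))" by (simp only: add_0_left tS add.commute)
      then have "lip_on (\<lambda>s. g (s, w)) (t k) (t (Suc k))" by (rule lip_on_cong) (rule b)
      with Suc show ?case by (rule lip_on_concat)
    qed
    have gS: "g (S, w) = p" by (simp add: g_def)
    have "lip_on (\<lambda>s. g (s, w)) 0 S"
    proof (rule lip_onI)
      fix s u assume su: "0 \<le> s" "s \<le> u" "u \<le> S"
      consider "u < S" | "u = S" "s < S" | "s = S" "u = S" using su by linarith
      then show "d (pr (g (s, w))) (pr (g (u, w))) \<le> 8 * (u - s)"
      proof cases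
        case 1
        then obtain k where "u < t (Suc k)" using K_ex[of u] su by auto
        then show ?thesis using lip_onD[OF lk[of "Suc k"], of s u] su by simp
      next
        case 2
        then obtain k0 where k0: "s < t (Suc k0)" using K_ex[of s] su by auto
        \<comment> \<open>The Lipschitz bound at the final time is the limit of the bounds at the
          ends \<open>t k\<close> of the stages.\<close>
        have lim: "(\<lambda>k. 8 * (t k - s) + d (\<sigma> k w) (pr p)) \<longlonglongrightarrow> 8 * (S - s) + 0"
          by (intro tendsto_intros tlim p w)
        have "d (pr (g (s, w))) (pr p) \<le> 8 * (t k - s) + d (\<sigma> k w) (pr p)" if "k \<ge> Suc k0" for k
        proof -
          have "s \<le> t k" using tmono[OF that] k0 by simp
          then show ?thesis using lip_onD[OF lk[of k], of s "t k"] su(1) st[of k]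
              dinf_triangle[of "g (s, w)" p "g (t k, w)"] by simp
        qed
        then have "d (pr (g (s, w))) (pr p) \<le> 8 * (S - s) + 0"
          by (intro LIMSEQ_le_const[OF lim]) blast
        then show ?thesis using 2 gS by simp
      qed simp
    qed
    then show ?thesis using st[of 0] t0 gS by simp
  qed
  then have "fam_of g (\<sigma> 0) (\<lambda>_. pr p) S (\<lambda>z. \<Sum>k. \<rho> k z)" using gm o unfolding fam_of_def by simp
  then show ?thesis using S0 unfolding fam_def S_def[symmetric] by (auto intro!: exI[of _ g])
qed

section \<open>Transport between strips\<close>

definition strip :: "int \<Rightarrow> real \<Rightarrow> int \<Rightarrow> real \<Rightarrow> xpt" where
  "strip n x b w = pr (Phij L n (x, real_of_int b + w))"

text \<open>Durations are measured in units of \<open>4\<^sup>-\<^sup>n\<close> and densities in units of the inverse height of a level-\<open>n\<close> strip.\<close>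
definition famc :: "int \<Rightarrow> (real \<Rightarrow> xpt) \<Rightarrow> (real \<Rightarrow> xpt) \<Rightarrow> real \<Rightarrow> real \<Rightarrow> bool" where
  "famc n \<sigma> \<tau> T c \<longleftrightarrow> 0 \<le> c \<and> fam \<sigma> \<tau> (hs n * T) (\<lambda>_. ennreal (c / V n))"

lemma famc_concat: "famc n \<sigma> \<tau> T c \<Longrightarrow> famc n \<tau> \<upsilon> T' c' \<Longrightarrow> famc n \<sigma> \<upsilon> (T + T') (c + c')"
proof -
  assume a: "famc n \<sigma> \<tau> T c" "famc n \<tau> \<upsilon> T' c'"
  then have f: "fam \<sigma> \<tau> (hs n * T) (\<lambda>_. ennreal (c / V n))" "fam \<tau> \<upsilon> (hs n * T') (\<lambda>_. ennreal (c' / V n))" "0 \<le> c" "0 \<le> c'"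
    unfolding famc_def by simp_all
  have "ennreal (c / V n) + ennreal (c' / V n) = ennreal ((c + c') / V n)"
    using f(3,4) by (simp add: add_divide_distrib ennreal_plus)
  then show ?thesis using fam_concat[OF f(1,2)] f(3,4) unfolding famc_def by (simp add: distrib_left)
qed

lemma famc_rev: "famc n \<sigma> \<tau> T c \<Longrightarrow> famc n \<tau> \<sigma> T c"
  unfolding famc_def by (blast intro: fam_rev)

lemma famc_mono: "famc n \<sigma> \<tau> T c \<Longrightarrow> c \<le> c' \<Longrightarrow> famc n \<sigma> \<tau> T c'"
  unfolding famc_def by (auto elim!: fam_weaken intro!: ennreal_leI divide_right_mono)

lemma famc_horizontal: "famc n (strip n x b) (strip n x' b) \<bar>x' - x\<bar> 1"
proof -
  have "fam (\<lambda>w. pr (hs n * x, (real_of_int b + w) * V n)) (\<lambda>w. pr (hs n * x', (real_of_int b + w) * V n))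
      \<bar>hs n * x' - hs n * x\<bar> (\<lambda>_. ennreal (1 / V n))" by (rule fam_straight) simp
  moreover have "\<bar>hs n * x' - hs n * x\<bar> = hs n * \<bar>x' - x\<bar>" by (simp add: abs_mult flip: right_diff_distrib)
  ultimately show ?thesis unfolding famc_def strip_def Phij_eq by (simp add: mult.commute)
qed

text \<open>Going out and back along the strip spends the surplus time. Equal durations are needed
  because \<open>fam_digit\<close> runs all its families over one time interval.\<close>

lemma famc_pad:
  assumes "famc n \<sigma> (strip n x b) T c" "T \<le> T'" shows "famc n \<sigma> (strip n x b) T' (c + 2)"
proof -
  let ?y = "x + (T' - T) / 2"
  have "famc n (strip n x b) (strip n x b) (\<bar>?y - x\<bar> + \<bar>x - ?y\<bar>) (1 + 1)"
    by (rule famc_concat[OF famc_horizontal famc_horizontal])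
  moreover have "\<bar>?y - x\<bar> + \<bar>x - ?y\<bar> = T' - T" using assms(2) by simp
  ultimately have "famc n (strip n x b) (strip n x b) (T' - T) 2" by simp
  from famc_concat[OF assms(1) this] show ?thesis by simp
qed

abbreviation hI :: "nat \<Rightarrow> int" where "hI a \<equiv> (3 * int L) ^ a"

lemma hI_real: "real_of_int (hI a) = M ^ a" by (simp add: mv_def)

text \<open>Glued segments end at integer heights, so the strict bound on the integer
  \<open>b\<close> leaves room for the whole strip and all offsets \<open>w\<close> are glued at
  once.\<close>

lemma strip_glue:
  assumes "i \<in> {1,2,3}" "hI a * (3 * l + i - 1) \<le> b" "b < hI a * (3 * l + i)" "0 \<le> w" "w < 1"
  shows "strip n (real_of_int (gline a k i)) b w = strip n (real_of_int (gline a k i)) (b + hI a) w"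
proof -
  have "real_of_int (hI a * (3 * l + i - 1)) \<le> b" "real_of_int (b + 1) \<le> real_of_int (hI a * (3 * l + i))"
    using assms(2,3) by (simp_all only: of_int_le_iff)
  then have "M ^ a * real_of_int (3 * l + i - 1) \<le> b" "real_of_int b + 1 \<le> M ^ a * real_of_int (3 * l + i)"
    unfolding of_int_mult hI_real by simp_all
  then have "M ^ a * real_of_int (3 * l + i - 1) \<le> b + w" "b + w \<le> M ^ a * real_of_int (3 * l + i)"
    using assms(4,5) by linarith+
  from glue_at[OF assms(1) this, of n k] show ?thesis
    unfolding strip_def of_int_add hI_real by (simp add: add_ac)
qed

lemma famc_jump:
  assumes "i \<in> {1,2,3}" "hI a * (3 * l + i - 1) \<le> b" "b < hI a * (3 * l + i)"
  shows "famc n (strip n x b) (strip n x (b + hI a)) (2 * \<bar>real_of_int (gline a k i) - x\<bar>) 2"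
proof -
  let ?x = "real_of_int (gline a k i)"
  have "famc n (strip n x b) (strip n ?x b) \<bar>?x - x\<bar> 1" by (rule famc_horizontal)
  then have "famc n (strip n x b) (strip n ?x (b + hI a)) \<bar>?x - x\<bar> 1"
    unfolding famc_def using strip_glue[OF assms, of _ n k] by (auto elim!: fam_weaken)
  from famc_concat[OF this famc_horizontal[of n ?x "b + hI a" x]]
  show ?thesis by (simp add: abs_minus_commute)
qed

text \<open>Unit strips are glued on the lines \<open>4k + i\<close>; \<open>b\<close> modulo 3
  selects the column, and such a line lies within distance 4 of \<open>x\<close>. The time 8 pays
  for the way there and back, the density 4 for this and for padding.\<close>

lemma famc_up: "famc n (strip n x b) (strip n x (b + 1)) 8 4"
proof -
  define i l k where "i = b mod 3 + 1" and "l = b div 3" and "k = \<lfloor>x / 4\<rfloor>"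
  have "0 \<le> b mod 3" "b mod 3 < 3" by simp_all
  then have i: "i = 1 \<or> i = 2 \<or> i = 3" unfolding i_def by presburger
  have b: "3 * l + i - 1 = b" by (simp add: i_def l_def)
  have J: "famc n (strip n x b) (strip n x (b + hI 0)) (2 * \<bar>real_of_int (gline 0 k i) - x\<bar>) 2"
    using i b by (intro famc_jump[of i 0 l]) auto
  have "real_of_int k \<le> x / 4" "x / 4 < real_of_int k + 1" unfolding k_def by linarith+
  then have "\<bar>real_of_int (gline 0 k i) - x\<bar> \<le> 4" using i by auto
  then show ?thesis using famc_pad[OF J, of 8] by simp
qed

text \<open>Nearer targets are padded so that the duration depends on \<open>R\<close> alone; the
  \<open>+ 1\<close> is the density of the trivial motion for \<open>R = 0\<close>.\<close>

lemma famc_move: "\<bar>b' - b\<bar> \<le> int R \<Longrightarrow> famc n (strip n x b) (strip n x b') (8 * R) (4 * R + 1)"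
proof (induction R arbitrary: b')
  case 0
  then show ?case using famc_horizontal[of n x b x] by simp
next
  case (Suc R)
  consider "\<bar>b' - b\<bar> \<le> int R" | "\<bar>b' - 1 - b\<bar> \<le> int R" | "\<bar>b' + 1 - b\<bar> \<le> int R" using Suc.prems by linarith
  then show ?case
  proof cases
    case 1
    from famc_mono[OF famc_pad[OF Suc.IH[OF 1], of "8 * Suc R"], of "4 * Suc R + 1"] show ?thesis by simp
  next
    case 2
    from famc_concat[OF Suc.IH[OF 2] famc_up[of n x "b' - 1"]] show ?thesis by (simp add: algebra_simps)
  next
    case 3
    from famc_concat[OF Suc.IH[OF 3] famc_rev[OF famc_up[of n x b']]] show ?thesis by (simp add: algebra_simps)
  qed
qed

lemma hI_ge1: "1 \<le> hI a" using L_ge by (intro one_le_power) linarith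

lemma famc_coarse_jump:
  assumes i: "i \<in> {1,2,3}" and x: "\<bar>real_of_int (gline a k i) - x\<bar> \<le> 1"
    and b: "hI a * (3 * l + i - 1) - 2 \<le> b" "b \<le> hI a * (3 * l + i) + 1"
  shows "famc n (strip n x b) (strip n x (b + hI a)) 34 22"
proof -
  have h: "hI a * (3 * l + i) = hI a * (3 * l + i - 1) + hI a" by (simp add: algebra_simps)
  \<comment> \<open>The strip nearest to \<open>b\<close> that lies wholly in the lower segment, at
    most two strips away.\<close>
  define e where "e = max (hI a * (3 * l + i - 1)) (min b (hI a * (3 * l + i) - 1))"
  have e: "hI a * (3 * l + i - 1) \<le> e" "e < hI a * (3 * l + i)" "\<bar>e - b\<bar> \<le> int 2" "\<bar>b + hI a - (e + hI a)\<bar> \<le> int 2"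
    using b h hI_ge1[of a] unfolding e_def by linarith+
  note 1 = famc_move[OF e(3), of n x]
  note 2 = famc_jump[OF i e(1,2), of n x k]
  note 3 = famc_move[OF e(4), of n x]
  from famc_pad[OF famc_concat[OF famc_concat[OF 1 2] 3], of 34] x show ?thesis by simp
qed

lemma famc_coarse_jumps:
  assumes i: "i \<in> {1,2,3}" and x: "\<bar>real_of_int (gline a k i) - x\<bar> \<le> 1" and m: "0 \<le> m" "m \<le> 2"
    and y: "in_glued (1/2) a i l y" "in_glued (1/2) a i l y'" "\<bar>y' - (y + real_of_int m * M ^ a)\<bar> < 1/2"
  shows "famc n (strip n x \<lfloor>y\<rfloor>) (strip n x \<lfloor>y'\<rfloor>) 80 60"
proof -
  let ?s = "hI a * (3 * l + i - 1)"
  have h: "hI a * (3 * l + i) = ?s + hI a" by (simp add: algebra_simps)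
  have r1: "M ^ a * real_of_int (3 * l + i - 1) = real_of_int ?s" by (simp only: of_int_mult hI_real)
  have "real_of_int (?s + 2 * hI a) = real_of_int ?s + 2 * M ^ a"
    by (simp only: of_int_add of_int_mult[of 2] of_int_numeral hI_real)
  then have "M ^ a * real_of_int (3 * l + i + 1) = real_of_int (?s + 2 * hI a)"
    unfolding mult_int_step(2)[of "M ^ a" "3 * l + i"] r1 by (rule sym)
  note r = r1 this
  have y1: "real_of_int ?s - 1/2 \<le> y" "y' \<le> real_of_int (?s + 2 * hI a) + 1/2"
    using y(1,2) unfolding in_glued_def r by auto
  have y2: "\<bar>y' - (y + real_of_int (m * hI a))\<bar> < 1/2" using y(3) unfolding of_int_mult hI_real .
  have lo: "?s - 1 \<le> \<lfloor>y\<rfloor>" using y1(1) by linarith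
  have up: "\<lfloor>y\<rfloor> \<le> ?s + 2 * hI a - m * hI a + 1"
  proof -
    have "y \<le> real_of_int (?s + 2 * hI a) - real_of_int (m * hI a) + 1" using y1(2) y2 by linarith
    also have "\<dots> = real_of_int (?s + 2 * hI a - m * hI a + 1)" by simp
    finally show ?thesis by linarith
  qed
  \<comment> \<open>As \<open>hI a\<close> is an integer, jumps keep fractional parts; an error
    below 1/2 can shift the floor by at most one strip.\<close>
  have dist: "\<bar>\<lfloor>y'\<rfloor> - (\<lfloor>y\<rfloor> + m * hI a)\<bar> \<le> int 1" using y2 by linarith
  note last = famc_move[OF dist, of n x]
  consider "m = 0" | "m = 1" | "m = 2" using m by linarith
  then show ?thesis
  proof cases
    case 1
    then have "famc n (strip n x \<lfloor>y\<rfloor>) (strip n x \<lfloor>y'\<rfloor>) 8 5" using last by simp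
    from famc_mono[OF famc_pad[OF this, of 80], of 60] show ?thesis by simp
  next
    case 2
    have "famc n (strip n x \<lfloor>y\<rfloor>) (strip n x (\<lfloor>y\<rfloor> + hI a)) 34 22"
      by (rule famc_coarse_jump[OF i x, where l = l]; use lo up[unfolded 2] h in linarith)
    moreover have "famc n (strip n x (\<lfloor>y\<rfloor> + hI a)) (strip n x \<lfloor>y'\<rfloor>) 8 5" using last 2 by simp
    ultimately have "famc n (strip n x \<lfloor>y\<rfloor>) (strip n x \<lfloor>y'\<rfloor>) (34 + 8) (22 + 5)" by (rule famc_concat)
    from famc_mono[OF famc_pad[OF this, of 80], of 60] show ?thesis by simp
  next
    case 3
    have j1: "famc n (strip n x \<lfloor>y\<rfloor>) (strip n x (\<lfloor>y\<rfloor> + hI a)) 34 22"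
      by (rule famc_coarse_jump[OF i x, where l = l]; use lo up[unfolded 3] h hI_ge1[of a] in linarith)
    have j2: "famc n (strip n x (\<lfloor>y\<rfloor> + hI a)) (strip n x (\<lfloor>y\<rfloor> + hI a + hI a)) 34 22"
      by (rule famc_coarse_jump[OF i x, where l = l]; use lo up[unfolded 3] h hI_ge1[of a] in linarith)
    have "famc n (strip n x (\<lfloor>y\<rfloor> + hI a + hI a)) (strip n x \<lfloor>y'\<rfloor>) 8 5" 
    proof -
      have "\<lfloor>y\<rfloor> + m * hI a = \<lfloor>y\<rfloor> + hI a + hI a" unfolding 3 by linarith
      from last[unfolded this] show ?thesis by simp
    qed
    from famc_concat[OF famc_concat[OF j1 j2] this]
    have "famc n (strip n x \<lfloor>y\<rfloor>) (strip n x \<lfloor>y'\<rfloor>) (34 + 34 + 8) (22 + 22 + 5)" .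
    from famc_mono[OF famc_pad[OF this, of 80], of 60] show ?thesis by simp
  qed
qed

text \<open>Turns the alternative of \<open>dinf_close_cases\<close> into curves: a move to an
  adjacent strip, or jumps on one coarse line, then a horizontal correction.\<close>

lemma famc_middle:
  assumes "d (pr (Phij L n (x0, y0))) (pr (Phij L n (x, y))) < hs n / 10"
  shows "famc n (strip n x0 \<lfloor>y0\<rfloor>) (strip n x \<lfloor>y\<rfloor>) 81 63"
proof -
  have dd: "d (pr (Phij L n (x0, y0))) (pr (Phij L n (x, y))) < 1/10 * hs n" using assms by simp
  note c = dinf_close_cases[OF _ _ dd]
  have e1: "0 < 1/(10::real)" and e2: "1/10 \<le> 1/(10::real)" by simp_all
  have x: "\<bar>x - x0\<bar> < 1/10" by (rule c(1)[OF e1 e2])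
  have "famc n (strip n x0 \<lfloor>y0\<rfloor>) (strip n x0 \<lfloor>y\<rfloor>) 80 60"
  proof (cases "\<bar>hgt (x, y) - hgt (x0, y0)\<bar> < 2 * (1/10)")
    case True
    then have "\<bar>y - y0\<bar> < 1/2" using hgt_dist[of x y] hgt_dist[of x0 y0] by linarith
    then have "\<bar>\<lfloor>y\<rfloor> - \<lfloor>y0\<rfloor>\<bar> \<le> int 1" by linarith
    from famc_mono[OF famc_pad[OF famc_move[OF this], of 80 n x0], of 60] show ?thesis by simp
  next
    case False
    then obtain a k i l m where *: "i \<in> {1,2,3}" "\<bar>real_of_int (gline a k i) - x0\<bar> < 1/10" "\<bar>m\<bar> \<le> 2"
        "in_glued (2 * (1/10)) a i l (hgt (x0, y0))" "in_glued (4 * (1/10)) a i l (hgt (x, y))"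
        "\<bar>hgt (x, y) - (hgt (x0, y0) + real_of_int m * M ^ a)\<bar> < 2 * (1/10)" using c(2)[OF e1 e2] by blast
    have g: "in_glued (1/2) a i l y0" "in_glued (1/2) a i l y"
      using *(4,5) hgt_dist[of x0 y0] hgt_dist[of x y] unfolding in_glued_def by linarith+
    have m: "\<bar>y - (y0 + real_of_int m * M ^ a)\<bar> < 1/2"
      using *(6) hgt_dist[of x0 y0] hgt_dist[of x y] by linarith
    have x1: "\<bar>real_of_int (gline a k i) - x0\<bar> \<le> 1" using *(2) by linarith
    show ?thesis
    proof (cases "m \<ge> 0")
      case True
      then show ?thesis using *(3) by (intro famc_coarse_jumps[OF *(1) x1 True _ g m]) auto
    next
      case False
      have "\<bar>y0 - (y + real_of_int (- m) * M ^ a)\<bar> < 1/2" using m by (simp add: abs_minus_commute algebra_simps) 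
      moreover have "0 \<le> - m" "- m \<le> 2" using False *(3) by auto
      ultimately have "famc n (strip n x0 \<lfloor>y\<rfloor>) (strip n x0 \<lfloor>y0\<rfloor>) 80 60"
        using famc_coarse_jumps[OF *(1) x1 _ _ g(2,1), of "- m" n] by blast
      then show ?thesis by (rule famc_rev)
    qed
  qed
  from famc_pad[OF famc_concat[OF this famc_horizontal[of n x0 "\<lfloor>y\<rfloor>" x]], of 81] x
  show ?thesis by simp
qed

end

section \<open>Curves ending in a point and the Riesz potential\<close>

lemma frac_mult_frac: "frac (real m * frac z) = frac (real m * z)"
proof -
  have "real m * frac z = real m * z - real_of_int (int m * \<lfloor>z\<rfloor>)" by (simp add: frac_def algebra_simps)
  then show ?thesis by (simp add: frac_def del: of_int_mult)
qed

context glued_plane begin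

abbreviation mN :: nat where "mN \<equiv> 3 * L"

lemma M_eq: "M = real mN" by (simp add: mv_def)

text \<open>The vertical segment above the abscissa of \<open>p\<close> that crosses the
  level-\<open>k\<close> strip containing \<open>p\<close>, parametrized uniformly.\<close>

definition home :: "pt \<Rightarrow> int \<Rightarrow> real \<Rightarrow> xpt" where
  "home p k = strip k (fst p / hs k) \<lfloor>snd p / V k\<rfloor>"

lemma home_eq: "home p k w = pr (fst p, V k * (real_of_int \<lfloor>snd p / V k\<rfloor> + w))"
  by (simp add: home_def strip_def Phij_eq)

lemma home_near: "0 \<le> w \<Longrightarrow> w < 1 \<Longrightarrow> d (pr p) (home p k w) \<le> 2 * hs k"
proof -
  assume w: "0 \<le> w" "w < 1"
  have "\<bar>snd p / V k - (real_of_int \<lfloor>snd p / V k\<rfloor> + w)\<bar> \<le> 1" using w by linarith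
  then have "V k * \<bar>snd p / V k - (real_of_int \<lfloor>snd p / V k\<rfloor> + w)\<bar> \<le> V k * 1" by (intro mult_left_mono) auto
  then have "\<bar>V k * (snd p / V k - (real_of_int \<lfloor>snd p / V k\<rfloor> + w))\<bar> \<le> V k" by (simp add: abs_mult)
  then have "\<bar>snd p - V k * (real_of_int \<lfloor>snd p / V k\<rfloor> + w)\<bar> \<le> V k" by (simp add: right_diff_distrib)
  then show ?thesis unfolding home_eq using dinf_near[of "fst p" "fst p" k "snd p"] by simp
qed

lemma fam_reparam:
  "0 < m \<Longrightarrow> fam \<sigma> \<tau> T \<rho> \<Longrightarrow> fam (\<lambda>w. \<sigma> (frac (real m * w))) (\<lambda>w. \<tau> (frac (real m * w))) T \<rho>"
  by (rule fam_digit)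

text \<open>All \<open>mN\<close> substrips lie within \<open>mN\<close> elementary steps of the one
  containing \<open>p\<close>, so \<open>famc_move\<close> with \<open>R = mN\<close> gives a common
  duration and \<open>fam_digit\<close> assembles them.\<close>

lemma fam_stage:
  "fam (home p k) (\<lambda>w. home p (k + 1) (frac (M * w))) (hs (k + 1) * (8 * M)) (\<lambda>_. ennreal ((4 * M + 1) / V (k + 1)))"
proof -
  define b where "b = \<lfloor>snd p / V k\<rfloor>"
  define b' where "b' = \<lfloor>snd p / V (k + 1)\<rfloor>"
  define x where "x = fst p / hs (k + 1)"
  have b: "real_of_int b \<le> snd p / V k" "snd p / V k < real_of_int b + 1" unfolding b_def by linarith+
  have MV: "snd p / V (k + 1) = M * (snd p / V k)" by (simp add: V_Suc)
  have "M * real_of_int b \<le> M * (snd p / V k)" "M * (snd p / V k) < M * (real_of_int b + 1)"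
    using b by (intro mult_left_mono mult_strict_left_mono; simp)+
  then have "real_of_int (int mN * b) \<le> snd p / V (k + 1)" "snd p / V (k + 1) < real_of_int (int mN * b + int mN)"
    unfolding MV M_eq by (simp_all add: distrib_left)
  then have b': "int mN * b \<le> b'" "b' < int mN * b + int mN" unfolding b'_def by linarith+
  have F: "fam (strip (k + 1) x (int mN * b + int j)) (strip (k + 1) x b') (hs (k + 1) * (8 * M)) (\<lambda>_. ennreal ((4 * M + 1) / V (k + 1)))"
    if "j < mN" for j
  proof -
    have "\<bar>b' - (int mN * b + int j)\<bar> \<le> int mN" using b' that by linarith
    from famc_move[OF this, of "k + 1" x] show ?thesis unfolding famc_def M_eq by (simp add: add.commute)
  qed
  have "0 < mN" using L_ge by simp
  from fam_digit[OF this F]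
  have D: "fam (\<lambda>w. strip (k + 1) x (int mN * b + int (nat \<lfloor>real mN * w\<rfloor>)) (frac (real mN * w)))
    (\<lambda>w. strip (k + 1) x b' (frac (real mN * w))) (hs (k + 1) * (8 * M)) (\<lambda>_. ennreal ((4 * M + 1) / V (k + 1)))" .
  show ?thesis
  proof (rule fam_weaken[OF D order.refl])
    fix w :: real assume w: "0 \<le> w" "w < 1"
    then have fl: "int (nat \<lfloor>real mN * w\<rfloor>) = \<lfloor>real mN * w\<rfloor>" by simp
    have "real_of_int (int mN * b + \<lfloor>real mN * w\<rfloor>) + frac (real mN * w) = M * (real_of_int b + w)"
      unfolding M_eq by (simp add: frac_def distrib_left)
    then have "V (k + 1) * (real_of_int (int mN * b + \<lfloor>real mN * w\<rfloor>) + frac (real mN * w)) = V k * (real_of_int b + w)"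
      by (simp add: V_Suc)
    then show "strip (k + 1) x (int mN * b + int (nat \<lfloor>real mN * w\<rfloor>)) (frac (real mN * w)) = home p k w"
      unfolding home_eq fl strip_def Phij_eq b_def[symmetric] x_def by simp
  next
    fix w :: real
    show "strip (k + 1) x b' (frac (real mN * w)) = home p (k + 1) (frac (M * w))"
      unfolding home_def b'_def x_def M_eq ..
  qed simp
qed

text \<open>The density of stage \<open>k\<close> after \<open>fam_local\<close>: the curves start
  within \<open>2 * hs k\<close> of \<open>p\<close> and run for time
  \<open>8 * M * hs (k + 1)\<close> at speed 8, hence the radius.\<close>

definition dens :: "pt \<Rightarrow> int \<Rightarrow> pt \<Rightarrow> ennreal" where
  "dens p k z = ennreal ((4 * M + 1) / V (k + 1)) * indicator {z. d (pr p) (pr z) \<le> hs k * (2 + 16 * M)} z"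

lemma fam_half:
  "fam (home p n) (\<lambda>_. pr p) (hs n * (8 * M / 3)) (\<lambda>z. \<Sum>j. dens p (n + int j) z)"
proof -
  \<comment> \<open>After \<open>j\<close> stages the offset is the remainder of \<open>w\<close>
    beyond its first \<open>j\<close> digits in base \<open>mN\<close>.\<close>
  define \<sigma> where "\<sigma> j w = home p (n + int j) (frac (real (mN ^ j) * w))" for j w
  define T where "T j = hs (n + int j + 1) * (8 * M)" for j
  have TS: "T j = hs n * (2 * M) * (1/4) ^ j" for j unfolding T_def hs_Suc by (simp add: hs_add hs_nat)
  have sums: "T sums (hs n * (8 * M / 3))"
  proof -
    have e: "hs n * (2 * M) * (1 / (1 - 1/4)) = hs n * (8 * M / 3)" by simp
    have "(\<lambda>j. hs n * (2 * M) * (1/4) ^ j) sums (hs n * (2 * M) * (1 / (1 - 1/4)))"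
      by (intro sums_mult geometric_sums) simp
    then show ?thesis unfolding TS e .
  qed
  have F: "fam (\<sigma> j) (\<sigma> (Suc j)) (T j) (dens p (n + int j))" for j
  proof -
    let ?k = "n + int j"
    have "0 < mN ^ j" using L_ge by simp
    from fam_reparam[OF this fam_stage[of p ?k]]
    have "fam (\<sigma> j) (\<lambda>w. home p (?k + 1) (frac (M * frac (real (mN ^ j) * w)))) (T j) (\<lambda>_. ennreal ((4 * M + 1) / V (?k + 1)))"
      unfolding \<sigma>_def T_def .
    moreover have "home p (?k + 1) (frac (M * frac (real (mN ^ j) * w))) = \<sigma> (Suc j) w" for w
    proof -
      have k: "?k + 1 = n + int (Suc j)" by simp
      have m: "real mN * (real (mN ^ j) * w) = real (mN ^ Suc j) * w" by simp
      show ?thesis unfolding \<sigma>_def M_eq frac_mult_frac m k ..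
    qed
    ultimately have f: "fam (\<sigma> j) (\<sigma> (Suc j)) (T j) (\<lambda>_. ennreal ((4 * M + 1) / V (?k + 1)))" by simp
    have "d (pr p) (\<sigma> j w) \<le> 2 * hs ?k" for w
      unfolding \<sigma>_def by (rule home_near) (auto simp: frac_lt_1)
    from fam_local[OF f this] have g: "fam (\<sigma> j) (\<sigma> (Suc j)) (T j) (\<lambda>z. ennreal ((4 * M + 1) / V (?k + 1)) *
        indicator {z. d (pr p) (pr z) \<le> 2 * hs ?k + 8 * T j} z)" by blast
    have "2 * hs ?k + 8 * T j = hs ?k * (2 + 16 * M)" unfolding T_def hs_Suc by (simp add: algebra_simps)
    then show ?thesis using g unfolding dens_def[abs_def] by simp
  qed
  have "fam (\<sigma> 0) (\<lambda>_. pr p) (suminf T) (\<lambda>z. \<Sum>j. dens p (n + int j) z)"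
  proof (rule fam_infinite)
    show "fam (\<sigma> j) (\<sigma> (Suc j)) (T j) (dens p (n + int j))" for j by (rule F)
    show "0 < T k" for k by (simp add: T_def)
    show "summable T" using sums by (rule sums_summable)
    fix w :: real
    have "(\<lambda>j. 2 * (hs n * (1/4) ^ j)) \<longlonglongrightarrow> 2 * (hs n * 0)" by (intro tendsto_intros LIMSEQ_power_zero) simp
    then have l: "(\<lambda>j. 2 * hs (n + int j)) \<longlonglongrightarrow> 0" by (simp add: hs_add hs_nat)
    have b: "0 \<le> d (\<sigma> j w) (pr p) \<and> d (\<sigma> j w) (pr p) \<le> 2 * hs (n + int j)" for j
      using home_near[OF frac_ge_0 frac_lt_1, of p "n + int j" "real (mN ^ j) * w"]
      unfolding \<sigma>_def home_eq by (simp add: dinf_sym[of _ p])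
    show "(\<lambda>j. d (\<sigma> j w) (pr p)) \<longlonglongrightarrow> 0"
      by (rule tendsto_sandwich[OF _ _ tendsto_const l]) (use b in auto)
  qed
  then have f: "fam (\<sigma> 0) (\<lambda>_. pr p) (hs n * (8 * M / 3)) (\<lambda>z. \<Sum>j. dens p (n + int j) z)"
    unfolding sums_unique[OF sums, symmetric] .
  show ?thesis by (rule fam_weaken[OF f order.refl famD(2)[OF f]]) (simp_all add: \<sigma>_def frac_eq)
qed

section \<open>Comparison with the Riesz density\<close>

definition rdens :: "pt \<Rightarrow> xpt \<Rightarrow> ennreal" where
  "rdens p x = ennreal (d (pr p) x) / emeasure (muinf L) (Ball_inf L (pr p) (d (pr p) x))"

lemma ball_measure_scale:
  assumes "10 * r \<le> hs i" shows "emeasure (muinf L) (Ball_inf L (pr p) r) \<le> ennreal (hs i * V i)"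
proof -
  have p: "pr p = pr (Phij L i (fst p / hs i, snd p / V i))" by (simp add: Phij_eq)
  have "Ball_inf L (pr p) r \<subseteq> Ball_inf L (pr p) (hs i / 10)" using assms by (auto simp: Ball_inf_def)
  then have "emeasure (muinf L) (Ball_inf L (pr p) r) \<le> emeasure (muinf L) (Ball_inf L (pr p) (hs i / 10))"
    by (intro emeasure_mono) (simp_all add: muinf_def)
  also have "\<dots> \<le> ennreal (hs i * V i)" unfolding p by (rule ball_measure_le)
  finally show ?thesis .
qed

text \<open>A volume bound for the ball of radius \<open>r\<close> at the matching scale
  \<open>i\<close> makes the quotient at least of order \<open>1 / V i\<close>. The constant
  \<open>c\<close> in the distance costs at most \<open>N\<close> levels, that is a factor
  \<open>M ^ N\<close> in the height.\<close>

lemma rdens_lower: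
  assumes N: "40 * c \<le> 4 ^ N" and r: "0 < d (pr p) (pr z)" "d (pr p) (pr z) \<le> hs k * c"
  shows "ennreal (1 / V k) \<le> ennreal (40 * M ^ N) * rdens p (pr z)"
proof -
  let ?r = "d (pr p) (pr z)"
  obtain i where i: "10 * ?r \<le> hs i" "hs i \<le> 4 * (10 * ?r)" using hs_scale[of "10 * ?r"] r by auto
  have "hs i \<le> 40 * ?r" using i by simp
  also have "\<dots> \<le> hs k * (40 * c)" using r by simp
  also have "\<dots> \<le> hs k * 4 ^ N" using N by (intro mult_left_mono) auto
  also have "\<dots> = hs (k - int N)" using hs_add[of k "- int N"] by (simp add: hs_minus_nat)
  finally have "k - int N \<le> i" by (simp add: hs_le_iff)
  then have "V i \<le> V (k - int N)" by (simp add: V_le_iff)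
  also have "\<dots> = V k * M ^ N" using V_add[of k "- int N"] by (simp add: V_minus_nat)
  finally have Vi: "V i \<le> V k * M ^ N" .
  have "1 / V k * (hs i * V i) \<le> 1 / V k * ((40 * ?r) * (V k * M ^ N))"
    using Vi i r by (intro mult_left_mono mult_mono) auto
  also have "\<dots> = 40 * M ^ N * ?r" by simp
  finally have key: "1 / V k * (hs i * V i) \<le> 40 * M ^ N * ?r" .
  let ?E = "emeasure (muinf L) (Ball_inf L (pr p) ?r)"
  have E: "?E \<le> ennreal (hs i * V i)" by (rule ball_measure_scale[OF i(1)])
  have "ennreal (1 / V k) * ?E \<le> ennreal (1 / V k) * ennreal (hs i * V i)" by (intro mult_left_mono E) simp
  also have "\<dots> \<le> ennreal (40 * M ^ N * ?r)" using key by (subst ennreal_mult[symmetric]) (auto intro: ennreal_leI)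
  finally have k1: "ennreal (1 / V k) * ?E \<le> ennreal (40 * M ^ N) * ennreal ?r" by (simp add: ennreal_mult')
  show ?thesis
  proof (cases "?E = 0")
    case True
    have "rdens p (pr z) = top" unfolding rdens_def True using r by (simp add: ennreal_divide_eq_top_iff)
    moreover have "ennreal (40 * M ^ N) \<noteq> 0" by simp
    ultimately show ?thesis by (simp add: ennreal_mult_top)
  next
    case False
    have Et: "?E \<noteq> top" using E by (metis ennreal_neq_top neq_top_trans)
    have "ennreal (1 / V k) = ennreal (1 / V k) * ?E / ?E"
      using False Et by (simp add: ennreal_mult_divide_eq)
    also have "\<dots> \<le> ennreal (40 * M ^ N) * ennreal ?r / ?E" by (rule divide_right_mono_ennreal[OF k1])
    also have "\<dots> = ennreal (40 * M ^ N) * rdens p (pr z)" by (simp add: rdens_def ennreal_times_divide)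
    finally show ?thesis .
  qed
qed

text \<open>The terms grow by the factor \<open>M\<close>, so the last one dominates.\<close>

lemma sum_inverse_heights: "(\<Sum>j\<le>J. 1 / V (n + int j)) \<le> 2 / V (n + int J)"
proof (induction J)
  case (Suc J)
  have V: "V (n + int (Suc J)) = V (n + int J) / M" using V_Suc[of "n + int J"] by (simp add: add_ac)
  have "(\<Sum>j\<le>Suc J. 1 / V (n + int j)) \<le> 2 / V (n + int J) + M / V (n + int J)" using Suc by (simp add: V del: of_nat_Suc)
  also have "\<dots> \<le> (2 * M) / V (n + int J)" using M_ge by (simp add: divide_right_mono flip: add_divide_distrib)
  finally show ?case by (simp add: V del: of_nat_Suc)
qed (simp add: divide_right_mono)

text \<open>At a point off \<open>p\<close> only finitely many stages contribute. The last of them,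
  \<open>J\<close>, dominates the sum, and its ball still contains \<open>z\<close>, so
  \<open>rdens_lower\<close> applies at its scale.\<close>

lemma suminf_dens_le:
  assumes N: "40 * (2 + 16 * M) \<le> 4 ^ N" and r: "0 < d (pr p) (pr z)"
  shows "(\<Sum>j. dens p (n + int j) z) \<le> ennreal ((4 * M + 1) * M * 2 * (40 * M ^ N)) * rdens p (pr z)"
proof -
  let ?r = "d (pr p) (pr z)"
  define Q where "Q j \<longleftrightarrow> ?r \<le> hs (n + int j) * (2 + 16 * M)" for j
  have dens0: "dens p (n + int j) z = 0" if "\<not> Q j" for j using that by (simp add: dens_def Q_def)
  have dens1: "dens p (n + int j) z \<le> ennreal ((4 * M + 1) * M * (1 / V (n + int j)))" for j
    unfolding dens_def by (auto simp: V_Suc mult.commute split: split_indicator)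
  show ?thesis
  proof (cases "\<exists>j. Q j")
    case False
    then show ?thesis using dens0 by simp
  next
    case True
    have "\<exists>B. \<forall>j. Q j \<longrightarrow> j \<le> B"
    proof -
      have "(\<lambda>j. hs n * (1/4) ^ j * (2 + 16 * M)) \<longlonglongrightarrow> hs n * 0 * (2 + 16 * M)" by (intro tendsto_intros LIMSEQ_power_zero) simp
      then have "(\<lambda>j. hs (n + int j) * (2 + 16 * M)) \<longlonglongrightarrow> 0" by (simp add: hs_add hs_nat)
      from order_tendstoD(2)[OF this r] obtain B where "\<forall>j\<ge>B. hs (n + int j) * (2 + 16 * M) < ?r"
        by (auto simp: eventually_sequentially)
      then show ?thesis unfolding Q_def by (intro exI[of _ B]) (force simp: not_less[symmetric])
    qed
    then obtain B j0 where B: "\<forall>j. Q j \<longrightarrow> j \<le> B" and j0: "Q j0" using True by blast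
    define J where "J = (GREATEST j. Q j)"
    have J: "Q J" "Q j \<Longrightarrow> j \<le> J" for j
      unfolding J_def using GreatestI_nat[of Q j0 B] Greatest_le_nat[of Q _ B] B j0 by blast+
    have "(\<Sum>j. dens p (n + int j) z) = (\<Sum>j\<le>J. dens p (n + int j) z)"
    proof (rule suminf_finite)
      fix j assume "j \<notin> {..J}"
      then have "\<not> Q j" using J(2)[of j] by auto
      then show "dens p (n + int j) z = 0" by (rule dens0)
    qed simp
    also have "\<dots> \<le> (\<Sum>j\<le>J. ennreal ((4 * M + 1) * M * (1 / V (n + int j))))" by (intro sum_mono dens1)
    also have "\<dots> = ennreal (\<Sum>j\<le>J. (4 * M + 1) * M * (1 / V (n + int j)))" by (intro sum_ennreal) simp
    also have "\<dots> \<le> ennreal ((4 * M + 1) * M * (2 / V (n + int J)))"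
      unfolding sum_distrib_left[symmetric] by (intro ennreal_leI mult_left_mono sum_inverse_heights) simp
    also have "\<dots> = ennreal ((4 * M + 1) * M * 2) * ennreal (1 / V (n + int J))"
      by (subst ennreal_mult[symmetric]) auto
    also have "\<dots> \<le> ennreal ((4 * M + 1) * M * 2) * (ennreal (40 * M ^ N) * rdens p (pr z))"
      using rdens_lower[OF N r] J(1) unfolding Q_def by (intro mult_left_mono) auto
    also have "\<dots> = ennreal ((4 * M + 1) * M * 2 * (40 * M ^ N)) * rdens p (pr z)"
      unfolding mult.assoc[symmetric, where c = "rdens p (pr z)"] by (subst ennreal_mult[symmetric]) auto
    finally show ?thesis .
  qed
qed

lemma measure_ball_finite: "emeasure (muinf L) (Ball_inf L (pr p) r) \<noteq> top"
proof -
  obtain i where "10 * r \<le> hs i" using hs_scale[of "max 1 (10 * r)"] by (metis max.bounded_iff less_max_iff_disj zero_less_one)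
  from ball_measure_scale[OF this, of p] show ?thesis by (metis ennreal_neq_top neq_top_trans)
qed

lemma rdens_measurable [measurable]: "rdens p \<in> borel_measurable (Xmeas L)"
proof -
  have "mono (\<lambda>r. measure (muinf L) (Ball_inf L (pr p) r))"
  proof (rule monoI)
    fix r s :: real assume "r \<le> s"
    then have "Ball_inf L (pr p) r \<subseteq> Ball_inf L (pr p) s" by (auto simp: Ball_inf_def)
    then show "measure (muinf L) (Ball_inf L (pr p) r) \<le> measure (muinf L) (Ball_inf L (pr p) s)"
      using measure_ball_finite[of p s] by (intro measure_mono_fmeasurable fmeasurableI) (auto simp: muinf_def less_top)
  qed
  then have [measurable]: "(\<lambda>r. measure (muinf L) (Ball_inf L (pr p) r)) \<in> borel_measurable borel" by (rule borel_measurable_mono)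
  have "rdens p = (\<lambda>x. ennreal (d (pr p) x) / ennreal (measure (muinf L) (Ball_inf L (pr p) (d (pr p) x))))"
    unfolding rdens_def by (intro ext) (simp add: emeasure_eq_ennreal_measure measure_ball_finite)
  then show ?thesis by simp
qed

lemma emeasure_riesz:
  assumes A [measurable]: "A \<in> sets (Xmeas L)"
  shows "emeasure (riesz L (pr p)) A = (\<integral>\<^sup>+z. rdens p (pr z) * indicator A (pr z) \<partial>lborel)"
proof -
  have s: "sets (muinf L) = sets (Xmeas L)" by (simp add: muinf_def)
  have "emeasure (riesz L (pr p)) A = (\<integral>\<^sup>+x. rdens p x * indicator A x \<partial>muinf L)"
    unfolding riesz_def rdens_def[symmetric] using rdens_measurable[of p] A
    by (intro emeasure_density) (simp_all add: s cong: measurable_cong_sets)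
  also have "\<dots> = (\<integral>\<^sup>+z. rdens p (pr z) * indicator A (pr z) \<partial>lborel)"
    unfolding muinf_def by (intro nn_integral_distr) measurable
  finally show ?thesis .
qed

end

section \<open>Joining two points\<close>

lemma AE_lborel_fst_neq: "AE z in (lborel :: (real \<times> real) measure). fst z \<noteq> a"
proof (rule AE_I)
  have "emeasure (lborel \<Otimes>\<^sub>M lborel) ({a} \<times> (UNIV :: real set)) = emeasure lborel {a} * emeasure lborel (UNIV :: real set)"
    by (intro lborel.emeasure_pair_measure_Times) auto
  then show "emeasure lborel ({a} \<times> (UNIV :: real set)) = 0" by (simp add: lborel_prod)
  show "{a} \<times> (UNIV :: real set) \<in> sets lborel"
    unfolding sets_lborel by (intro borel_closed closed_Times) auto
qed auto

context glued_plane begin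

lemma fst_le_dinf: "\<bar>fst z - fst w\<bar> \<le> d (pr z) (pr w)"
proof (rule dinf_ge_potential)
  fix j p q assume "(p, q) \<in> Rgen L"
  then have "fst p = fst q" by (auto simp: Rgen_def)
  then show "fst (Phij L j p) = fst (Phij L j q)" by (simp add: Phij_def)
next
  fix i a b z w assume "z \<in> cellY L i a b" "w \<in> cellY L i a b"
  then show "\<bar>fst z - fst w\<bar> \<le> hs i"
    by (cases z; cases w) (simp add: cellY_iff abs_le_iff distrib_right)
qed

text \<open>Two halves of duration \<open>hs n * (8 * M / 3)\<close> and a middle piece of
  \<open>hs n * 81\<close>, at a scale \<open>hs n \<le> 80 * d\<close>, give the bound on
  \<open>T\<close>. The middle piece stays within \<open>2 + 8 * 81 = 650\<close> units of
  \<open>p\<close>, inside the radius \<open>2 + 16 * M\<close> that \<open>N\<close> already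
  covers.\<close>

lemma fam_between:
  assumes N: "40 * (2 + 16 * M) \<le> 4 ^ N" and pq: "0 < d (pr p) (pr q)"
  obtains T \<rho> where "fam (\<lambda>_. pr p) (\<lambda>_. pr q) T \<rho>"
    "T \<le> 80 * (6 * M + 81) * d (pr p) (pr q)"
    "\<And>z. 0 < d (pr p) (pr z) \<Longrightarrow> 0 < d (pr q) (pr z) \<Longrightarrow>
       \<rho> z \<le> ennreal ((4 * M + 1) * M * 2 * (40 * M ^ N) + 63 * (40 * M ^ N)) * (rdens p (pr z) + rdens q (pr z))"
proof -
  let ?d = "d (pr p) (pr q)"
  \<comment> \<open>The factor 20 makes the distance less than \<open>hs n / 10\<close>, the range
    of \<open>famc_middle\<close>.\<close>
  obtain n where n: "20 * ?d \<le> hs n" "hs n \<le> 4 * (20 * ?d)" using hs_scale[of "20 * ?d"] pq by auto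
  define P where "P z = (fst z / hs n, snd z / V n)" for z :: pt
  have P: "Phij L n (P z) = z" for z by (simp add: P_def Phij_eq)
  have "?d < hs n / 10" using n pq by linarith
  then have "d (pr (Phij L n (P p))) (pr (Phij L n (P q))) < hs n / 10" by (simp only: P)
  from famc_middle[OF this[unfolded P_def]]
  have m: "fam (home p n) (home q n) (hs n * 81) (\<lambda>_. ennreal (63 / V n))"
    unfolding famc_def home_def by simp
  have m': "fam (home p n) (home q n) (hs n * 81)
      (\<lambda>z. ennreal (63 / V n) * indicator {z. d (pr p) (pr z) \<le> 2 * hs n + 8 * (hs n * 81)} z)"
    (is "fam _ _ _ ?\<rho>") by (rule fam_local[OF m]) (rule home_near)
  note F = fam_concat[OF fam_concat[OF fam_rev[OF fam_half[of p n]] m'] fam_half[of q n]]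
  show thesis
  proof (rule that[OF F])
    have "hs n * (8 * M / 3) + hs n * 81 + hs n * (8 * M / 3) = hs n * (16 * M / 3 + 81)" by (simp add: algebra_simps)
    also have "\<dots> \<le> (4 * (20 * ?d)) * (6 * M + 81)" using n(2) pq by (intro mult_mono) (auto simp: field_simps)
    finally show "hs n * (8 * M / 3) + hs n * 81 + hs n * (8 * M / 3) \<le> 80 * (6 * M + 81) * ?d" by (simp add: mult_ac)
  next
    fix z assume z: "0 < d (pr p) (pr z)" "0 < d (pr q) (pr z)"
    let ?A = "(4 * M + 1) * M * 2 * (40 * M ^ N)" and ?B = "63 * (40 * M ^ N)"
    have 1: "(\<Sum>j. dens p (n + int j) z) \<le> ennreal ?A * rdens p (pr z)" by (rule suminf_dens_le[OF N z(1)])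
    have 2: "(\<Sum>j. dens q (n + int j) z) \<le> ennreal ?A * rdens q (pr z)" by (rule suminf_dens_le[OF N z(2)])
    have 3: "?\<rho> z \<le> ennreal ?B * rdens p (pr z)"
    proof (cases "d (pr p) (pr z) \<le> 2 * hs n + 8 * (hs n * 81)")
      case True
      have "d (pr p) (pr z) \<le> hs n * 650" using True by simp
      also have "\<dots> \<le> hs n * (2 + 16 * M)" using M_ge by (intro mult_left_mono) auto
      finally have "d (pr p) (pr z) \<le> hs n * (2 + 16 * M)" .
      note k = rdens_lower[OF N z(1) this]
      have "ennreal (63 / V n) = ennreal 63 * ennreal (1 / V n)" by (subst ennreal_mult[symmetric]) auto
      then have "?\<rho> z = ennreal 63 * ennreal (1 / V n)" using True by simp
      also have "\<dots> \<le> ennreal 63 * (ennreal (40 * M ^ N) * rdens p (pr z))" by (intro mult_left_mono k) simp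
      also have "\<dots> = ennreal ?B * rdens p (pr z)"
        unfolding mult.assoc[symmetric, where c = "rdens p (pr z)"] by (subst ennreal_mult[symmetric]) auto
      finally show ?thesis .
    qed simp
    have "(\<Sum>j. dens p (n + int j) z) + ?\<rho> z + (\<Sum>j. dens q (n + int j) z) \<le>
        ennreal ?A * rdens p (pr z) + ennreal ?B * rdens p (pr z) + (ennreal ?A + ennreal ?B) * rdens q (pr z)"
      by (intro add_mono 1 3 order.trans[OF 2]) (simp add: distrib_right)
    also have "\<dots> = (ennreal ?A + ennreal ?B) * (rdens p (pr z) + rdens q (pr z))" by (simp add: distrib_left distrib_right)
    also have "ennreal ?A + ennreal ?B = ennreal (?A + ?B)" by (rule ennreal_plus[symmetric]) auto
    finally show "(\<Sum>j. dens p (n + int j) z) + ?\<rho> z + (\<Sum>j. dens q (n + int j) z) \<le>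
        ennreal (?A + ?B) * (rdens p (pr z) + rdens q (pr z))" .
  qed
qed

text \<open>The parameters in the theorem are sequences; the uniform measure on the unit interval is
  carried by the constant ones, and curves read coordinate 0.\<close>

definition unit_measure :: "(nat \<Rightarrow> real) measure" where
  "unit_measure = distr (restrict_space lborel {0..<1}) (PiM UNIV (\<lambda>_. borel)) (\<lambda>w _. w)"

lemma const_measurable: "(\<lambda>w _. w) \<in> restrict_space lborel {0..<1} \<rightarrow>\<^sub>M PiM UNIV (\<lambda>_::nat. (borel :: real measure))"
  by (intro measurable_PiM_single') (auto simp: measurable_restrict_space1)

lemma prob_space_unit_measure: "prob_space unit_measure"
  unfolding unit_measure_def
proof (intro prob_space.prob_space_distr const_measurable prob_spaceI)
  show "emeasure (restrict_space lborel {0..<1}) (space (restrict_space lborel {0..<1::real})) = 1"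
    by (simp add: space_restrict_space emeasure_restrict_space)
qed

text \<open>The parameter enters through \<open>frac\<close> because a measured family must be Lipschitz for every \<open>f\<close>, not just almost every one.\<close>
definition curve :: "(pt \<Rightarrow> pt) \<Rightarrow> real \<Rightarrow> (nat \<Rightarrow> real) \<Rightarrow> xpt" where
  "curve g t f = pr (g (t, frac (f 0)))"

lemma curve_measurable:
  assumes g: "g \<in> borel_measurable borel"
  shows "(\<lambda>(t, f). curve g t f) \<in> restrict_space lborel {a..b} \<Otimes>\<^sub>M unit_measure \<rightarrow>\<^sub>M Xmeas L"
proof -
  let ?N = "restrict_space lborel {a..b} \<Otimes>\<^sub>M unit_measure"
  have s: "sets unit_measure = sets (PiM UNIV (\<lambda>_::nat. (borel :: real measure)))" by (simp add: unit_measure_def)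
  have "(\<lambda>f. f 0) \<in> PiM UNIV (\<lambda>_::nat. (borel :: real measure)) \<rightarrow>\<^sub>M borel" by measurable
  then have c: "(\<lambda>f. f 0) \<in> unit_measure \<rightarrow>\<^sub>M borel" using measurable_cong_sets[OF s refl] by blast
  have fr: "(frac :: real \<Rightarrow> real) \<in> borel_measurable borel" unfolding frac_def[abs_def] by measurable
  have 2: "(\<lambda>x. frac (snd x 0)) \<in> borel_measurable ?N"
    by (rule measurable_compose[OF measurable_compose[OF measurable_snd c] fr])
  have "(\<lambda>t::real. t) \<in> restrict_space lborel {a..b} \<rightarrow>\<^sub>M borel" by (intro measurable_restrict_space1) simp
  from measurable_compose[OF measurable_fst this]
  have 1: "(\<lambda>x. fst x) \<in> borel_measurable ?N" .
  have "(\<lambda>x. (fst x, frac (snd x 0))) \<in> ?N \<rightarrow>\<^sub>M borel \<Otimes>\<^sub>M borel" by (rule measurable_Pair[OF 1 2])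
  then have "(\<lambda>x. (fst x, frac (snd x 0))) \<in> ?N \<rightarrow>\<^sub>M borel" by (simp only: borel_prod)
  from measurable_compose[OF measurable_compose[OF this g] pr_measurable]
  show ?thesis unfolding curve_def case_prod_beta' .
qed

lemma emeasure_curve_measure:
  assumes g [measurable]: "g \<in> borel_measurable borel" and A [measurable]: "A \<in> sets (Xmeas L)"
  shows "emeasure (curve_measure L (curve g) 0 T unit_measure) A = emeasure lborel (occ g T (pr -` A))"
proof -
  let ?N = "restrict_space lborel {0..T} \<Otimes>\<^sub>M unit_measure"
  interpret prob_space unit_measure by (rule prob_space_unit_measure)
  define S where "S = (\<lambda>(t, f). curve g t f) -` A \<inter> space ?N"
  have S: "S \<in> sets ?N" unfolding S_def by (rule measurable_sets[OF curve_measurable[OF g] A])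
  have spU: "space unit_measure = UNIV" by (simp add: unit_measure_def space_PiM)
  have B: "pr -` A \<in> sets borel" using measurable_sets[OF pr_measurable A] by simp
  have O: "occ g T (pr -` A) \<in> sets (lborel \<Otimes>\<^sub>M lborel)" unfolding lborel_prod sets_lborel by (rule occ_sets[OF g B])
  have sec: "emeasure unit_measure (Pair t -` S) * indicator {0..T} t = emeasure lborel (Pair t -` occ g T (pr -` A))" for t
  proof (cases "t \<in> {0..T}")
    case True
    have "Pair t -` S \<in> sets unit_measure" using S by (rule sets_Pair1)
    then have "emeasure unit_measure (Pair t -` S) =
       emeasure (restrict_space lborel {0..<1}) ((\<lambda>w _. w) -` (Pair t -` S) \<inter> space (restrict_space lborel {0..<1}))"
      unfolding unit_measure_def by (intro emeasure_distr const_measurable) simp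
    also have "(\<lambda>w _. w) -` (Pair t -` S) \<inter> space (restrict_space lborel {0..<1}) = Pair t -` occ g T (pr -` A)"
      using True by (auto simp: S_def space_restrict_space space_pair_measure spU curve_def frac_eq[THEN iffD2])
    also have "emeasure (restrict_space lborel {0..<1}) \<dots> = emeasure lborel (Pair t -` occ g T (pr -` A))"
      by (rule emeasure_restrict_space) auto
    finally show ?thesis using True by simp
  next
    case False
    then have "Pair t -` occ g T (pr -` A) = {}" by auto
    then show ?thesis unfolding indicator_simps(2)[OF False] by (simp only: emeasure_empty mult_zero_right)
  qed
  have "emeasure (curve_measure L (curve g) 0 T unit_measure) A = emeasure ?N S"
    unfolding curve_measure_def S_def by (rule emeasure_distr[OF curve_measurable[OF g] A])
  also have "\<dots> = (\<integral>\<^sup>+t. emeasure unit_measure (Pair t -` S) \<partial>restrict_space lborel {0..T})"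
    by (rule emeasure_pair_measure_alt[OF S])
  also have "\<dots> = (\<integral>\<^sup>+t. emeasure unit_measure (Pair t -` S) * indicator {0..T} t \<partial>lborel)"
    by (rule nn_integral_restrict_space) simp
  also have "\<dots> = (\<integral>\<^sup>+t. emeasure lborel (Pair t -` occ g T (pr -` A)) \<partial>lborel)" unfolding sec ..
  also have "\<dots> = emeasure (lborel \<Otimes>\<^sub>M lborel) (occ g T (pr -` A))"
    by (rule lborel.emeasure_pair_measure_alt[OF O, symmetric])
  finally show ?thesis by (simp add: lborel_prod)
qed

lemma curve_family:
  assumes g: "fam_of g (\<lambda>_. P) (\<lambda>_. Q) T \<rho>" and T: "0 \<le> T" and C: "8 \<le> C"
  shows "measured_family L (curve g) 0 T unit_measure C" "joins (curve g) 0 T unit_measure P Q"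
proof -
  have "d (curve g s f) (curve g t f) \<le> C * \<bar>s - t\<bar>" if "s \<in> {0..T}" "t \<in> {0..T}" for s t f
  proof -
    have "d (curve g s f) (curve g t f) \<le> 8 * \<bar>s - t\<bar>"
      using fam_ofD(4)[OF g frac_ge_0 frac_lt_1, of "f 0"] that unfolding lip_on_def curve_def by blast
    also have "\<dots> \<le> C * \<bar>s - t\<bar>" using C by (intro mult_right_mono) auto
    finally show ?thesis .
  qed
  then show "measured_family L (curve g) 0 T unit_measure C"
    unfolding measured_family_def using T prob_space_unit_measure curve_measurable[OF fam_ofD(1)[OF g], of 0 T] by blast
  show "joins (curve g) 0 T unit_measure P Q"
    unfolding joins_def curve_def
    by (simp add: fam_ofD(2)[OF g frac_ge_0 frac_lt_1] fam_ofD(3)[OF g frac_ge_0 frac_lt_1])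
qed

text \<open>Each curve joins \<open>p\<close> to \<open>q\<close> in time \<open>T\<close> at speed
  8, so it stays in both balls of radius \<open>R\<close> and restricting to them loses nothing. The
  points where a distance vanishes lie on two vertical lines, a null set, by
  \<open>fst_le_dinf\<close>.\<close>

lemma curve_measure_bound:
  assumes g: "fam_of g (\<lambda>_. pr p) (\<lambda>_. pr q) T \<rho>" and T: "0 \<le> T" and C: "0 \<le> C" "8 * T < R"
    and \<rho>: "\<And>z. 0 < d (pr p) (pr z) \<Longrightarrow> 0 < d (pr q) (pr z) \<Longrightarrow> \<rho> z \<le> ennreal C * (rdens p (pr z) + rdens q (pr z))"
    and A: "A \<in> sets (Xmeas L)"
  shows "emeasure (curve_measure L (curve g) 0 T unit_measure) A \<le>
     ennreal C * (emeasure (riesz L (pr p)) (A \<inter> Ball_inf L (pr p) R) + emeasure (riesz L (pr q)) (A \<inter> Ball_inf L (pr q) R))"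
proof -
  let ?P = "A \<inter> Ball_inf L (pr p) R" and ?Q = "A \<inter> Ball_inf L (pr q) R"
  have PQ [measurable]: "?P \<in> sets (Xmeas L)" "?Q \<in> sets (Xmeas L)" using A by auto
  have PQ' [measurable]: "?P \<inter> ?Q \<in> sets (Xmeas L)" using PQ by (rule sets.Int)
  have B: "pr -` (?P \<inter> ?Q) \<in> sets borel" using measurable_sets[OF pr_measurable PQ'] by simp
  have "pr (g (t, w)) \<in> ?P \<inter> ?Q" if "t \<in> {0..T}" "w \<in> {0..<1}" "pr (g (t, w)) \<in> A" for t w
  proof -
    have e: "pr (g (0, w)) = pr p" "pr (g (T, w)) = pr q" "lip_on (\<lambda>t. g (t, w)) 0 T"
      using fam_ofD(2-4)[OF g, of w] that by simp_all
    have "d (pr p) (pr (g (t, w))) \<le> 8 * (t - 0)" using lip_onD[OF e(3), of 0 t] that e(1) by simp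
    moreover have "d (pr q) (pr (g (t, w))) \<le> 8 * (T - t)"
      using lip_onD[OF e(3), of t T] that e(2) dinf_sym[of q "g (t, w)"] by simp
    moreover have "8 * (t - 0) \<le> 8 * T" "8 * (T - t) \<le> 8 * T" using that by simp_all
    ultimately have "d (pr p) (pr (g (t, w))) < R" "d (pr q) (pr (g (t, w))) < R" using C(2) by linarith+
    then show ?thesis using that by (simp add: Ball_inf_def)
  qed
  then have "pr (g z) \<in> ?P \<inter> ?Q" if "z \<in> {0..T} \<times> {0..<1}" "pr (g z) \<in> A" for z
    using that by (cases z) blast
  then have "occ g T (pr -` A) = occ g T (pr -` (?P \<inter> ?Q))" by blast
  then have "emeasure (curve_measure L (curve g) 0 T unit_measure) A = emeasure lborel (occ g T (pr -` (?P \<inter> ?Q)))"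
    using emeasure_curve_measure[OF fam_ofD(1)[OF g] A] by simp
  also have "\<dots> \<le> (\<integral>\<^sup>+z. \<rho> z * indicator (pr -` (?P \<inter> ?Q)) z \<partial>lborel)" by (rule fam_ofD(5)[OF g B])
  also have "\<dots> \<le> (\<integral>\<^sup>+z. ennreal C * (rdens p (pr z) * indicator ?P (pr z) + rdens q (pr z) * indicator ?Q (pr z)) \<partial>lborel)"
  proof (rule nn_integral_mono_AE)
    have "AE z in (lborel :: pt measure). fst z \<noteq> fst p \<and> fst z \<noteq> fst q" using AE_lborel_fst_neq by (intro AE_conjI)
    then show "AE z in lborel. \<rho> z * indicator (pr -` (?P \<inter> ?Q)) z \<le>
       ennreal C * (rdens p (pr z) * indicator ?P (pr z) + rdens q (pr z) * indicator ?Q (pr z))"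
    proof eventually_elim
      case (elim z)
      have "0 < d (pr p) (pr z)" "0 < d (pr q) (pr z)"
        using fst_le_dinf[of p z] fst_le_dinf[of q z] elim by auto
      from \<rho>[OF this] show ?case by (auto split: split_indicator)
    qed
  qed
  also have "\<dots> = ennreal C * ((\<integral>\<^sup>+z. rdens p (pr z) * indicator ?P (pr z) \<partial>lborel) + (\<integral>\<^sup>+z. rdens q (pr z) * indicator ?Q (pr z) \<partial>lborel))"
  proof -
    have [measurable]: "(\<lambda>z. rdens p (pr z) * indicator ?P (pr z)) \<in> borel_measurable lborel"
      "(\<lambda>z. rdens q (pr z) * indicator ?Q (pr z)) \<in> borel_measurable lborel" by measurable
    show ?thesis by (subst nn_integral_cmult; (subst nn_integral_add)?) measurable
  qed
  finally show ?thesis by (simp only: emeasure_riesz[OF PQ(1)] emeasure_riesz[OF PQ(2)])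
qed

lemma pencil_exists:
  "\<exists>C. \<forall>p\<in>Xinf L. \<forall>q\<in>Xinf L. \<exists>(\<Gamma> :: real \<Rightarrow> (nat \<Rightarrow> real) \<Rightarrow> xpt) a b \<nu>.
      measured_family L \<Gamma> a b \<nu> C \<and> joins \<Gamma> a b \<nu> p q \<and> b - a \<le> C * d p q \<and>
      (\<forall>A\<in>sets (Xmeas L).
         emeasure (curve_measure L \<Gamma> a b \<nu>) A \<le>
           ennreal C * (emeasure (riesz L p) (A \<inter> Ball_inf L p (C * d p q))
                      + emeasure (riesz L q) (A \<inter> Ball_inf L q (C * d p q))))"
proof -
  obtain N where "40 * (2 + 16 * M) < 4 ^ N" using real_arch_pow[of 4 "40 * (2 + 16 * M)"] by auto
  then have N: "40 * (2 + 16 * M) \<le> 4 ^ N" by simp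
  define C2 where "C2 = (4 * M + 1) * M * 2 * (40 * M ^ N) + 63 * (40 * M ^ N)"
  define Ct where "Ct = 80 * (6 * M + 81)"
  \<comment> \<open>The term \<open>8 * Ct\<close> makes the balls contain the curves,
    \<open>C2\<close> bounds the density, and 9 covers the speed 8 and makes the radius bound
    strict.\<close>
  define C where "C = 8 * Ct + C2 + 9"
  have C2: "0 \<le> C2" and Ct: "0 \<le> Ct" by (simp_all add: C2_def Ct_def)
  have C: "8 \<le> C" "C2 \<le> C" "Ct \<le> C" "8 * Ct < C" using C2 Ct by (simp_all add: C_def)
  show ?thesis
  proof (rule exI[of _ C], intro ballI)
    fix P Q assume "P \<in> Xinf L" "Q \<in> Xinf L"
    then obtain p q where pq: "P = pr p" "Q = pr q" by (auto simp: Xinf_eq)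
    show "\<exists>(\<Gamma> :: real \<Rightarrow> (nat \<Rightarrow> real) \<Rightarrow> xpt) a b \<nu>.
      measured_family L \<Gamma> a b \<nu> C \<and> joins \<Gamma> a b \<nu> P Q \<and> b - a \<le> C * d P Q \<and>
      (\<forall>A\<in>sets (Xmeas L).
         emeasure (curve_measure L \<Gamma> a b \<nu>) A \<le>
           ennreal C * (emeasure (riesz L P) (A \<inter> Ball_inf L P (C * d P Q))
                      + emeasure (riesz L Q) (A \<inter> Ball_inf L Q (C * d P Q))))"
    proof (cases "d P Q = 0")
      case True
      then have "P = Q" unfolding pq by (rule dinf_eq_0_imp)
      \<comment> \<open>At distance zero the classes are equal, and a constant curve of duration 0
        has zero occupation measure.\<close>
      have g: "fam_of (\<lambda>_. p) (\<lambda>_. P) (\<lambda>_. Q) 0 (\<lambda>_. top)"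
        unfolding fam_of_def
      proof (intro conjI ballI)
        fix A :: "pt set" assume "A \<in> sets borel"
        have "emeasure lborel (occ (\<lambda>_. p) 0 A) \<le> emeasure lborel ({0..0::real} \<times> {0..1::real})"
          by (intro emeasure_mono) (auto intro!: borel_closed closed_Times)
        also have "\<dots> = 0" by (subst emeasure_lborel_rect) auto
        finally show "emeasure lborel (occ (\<lambda>_. p) 0 A) \<le> (\<integral>\<^sup>+z. top * indicator A z \<partial>lborel)" by simp
      qed (simp_all add: pq \<open>P = Q\<close>[unfolded pq] lip_on_def)
      have "emeasure (curve_measure L (curve (\<lambda>_. p)) 0 0 unit_measure) A = 0" if A: "A \<in> sets (Xmeas L)" for A
      proof -
        have "emeasure lborel (occ (\<lambda>_. p) 0 (pr -` A)) \<le> emeasure lborel ({0..0::real} \<times> {0..1::real})"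
          by (intro emeasure_mono) (auto intro!: borel_closed closed_Times)
        also have "\<dots> = 0" by (subst emeasure_lborel_rect) auto
        finally show ?thesis by (simp add: emeasure_curve_measure[OF fam_ofD(1)[OF g] A])
      qed
      then show ?thesis using curve_family[OF g order.refl C(1)] True
        by (intro exI[of _ "curve (\<lambda>_. p)"] exI[of _ 0] exI[of _ unit_measure]) simp
    next
      case False
      then have pos: "0 < d (pr p) (pr q)" using dinf_nonneg[of p q] unfolding pq by linarith
      obtain T \<rho> where F: "fam (\<lambda>_. pr p) (\<lambda>_. pr q) T \<rho>" and T: "T \<le> Ct * d (pr p) (pr q)"
        and \<rho>: "\<And>z. 0 < d (pr p) (pr z) \<Longrightarrow> 0 < d (pr q) (pr z) \<Longrightarrow> \<rho> z \<le> ennreal C2 * (rdens p (pr z) + rdens q (pr z))"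
        using fam_between[OF N pos] unfolding C2_def Ct_def by metis
      obtain g where g: "fam_of g (\<lambda>_. pr p) (\<lambda>_. pr q) T \<rho>" and T0: "0 \<le> T" using F unfolding fam_def by blast
      have "8 * T \<le> 8 * Ct * d (pr p) (pr q)" using T by simp
      also have "\<dots> < C * d (pr p) (pr q)" using C(4) pos by (rule mult_strict_right_mono)
      finally have R: "8 * T < C * d (pr p) (pr q)" .
      have "ennreal C2 * x \<le> ennreal C * x" for x using C(2) by (intro mult_right_mono ennreal_leI) auto
      with \<rho> have \<rho>': "\<rho> z \<le> ennreal C * (rdens p (pr z) + rdens q (pr z))"
        if "0 < d (pr p) (pr z)" "0 < d (pr q) (pr z)" for z using that by (meson order.trans)
      have "0 \<le> C" using C(1) by simp
      have "T \<le> C * d (pr p) (pr q)" using T mult_right_mono[OF C(3), of "d (pr p) (pr q)"] pos by linarith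
      then show ?thesis unfolding pq
        using curve_family[OF g T0 C(1)] curve_measure_bound[OF g T0 \<open>0 \<le> C\<close> R \<rho>']
        by (intro exI[of _ "curve g"] exI[of _ 0] exI[of _ T] exI[of _ unit_measure]) simp
    qed
  qed
qed

end

theorem mainTheorem16:
  fixes L :: nat
  assumes "L \<ge> 100"
  shows "\<exists>C::real. \<forall>p\<in>Xinf L. \<forall>q\<in>Xinf L.
    \<exists>(\<Gamma> :: real \<Rightarrow> (nat \<Rightarrow> real) \<Rightarrow> xpt) a b \<nu>.
      measured_family L \<Gamma> a b \<nu> C \<and> joins \<Gamma> a b \<nu> p q \<and>
      b - a \<le> C * dinf L p q \<and>
      (\<forall>A\<in>sets (Xmeas L).
         emeasure (curve_measure L \<Gamma> a b \<nu>) A \<le>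
           ennreal C * (emeasure (riesz L p) (A \<inter> Ball_inf L p (C * dinf L p q))
                      + emeasure (riesz L q) (A \<inter> Ball_inf L q (C * dinf L p q))))"
  using glued_plane.pencil_exists[OF glued_plane.intro[OF assms]] .

end
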